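(* Let $\mu\in M_+(\mathbb D^-)$, and let $b$ be a non-extreme point of $H^\infty_1$ which is $\mu$-admissible. Let $h=d(\mu|\mathbb T)/dm$. Then the following assertions are equivalent: (1) The measure $\mu$ is a reverse Carleson measure for $\mathscr H(b)$. (2) There is a constant $C>0$ such that $\|k^b_\lambda\|_b\le C\|k^b_\lambda\|_\mu$ for every $\lambda\in\mathbb D$. (3) The measure $\nu$ defined by $d\nu:=(1-|b|)\,d\mu$ satisfies $$\inf_I\frac{\nu(S(I))}{m(I)}>0,$$ where the infimum is over all open arcs $I$ of $\mathbb T$. (4) $\operatorname{ess\,inf}_{\mathbb T}(1-|b|)h>0$.
   Context: $\mathbb D$ is the open unit disk, $\mathbb D^-$ its closure, $\mathbb T=\partial\mathbb D$, $m$ normalized Lebesgue measure on $\mathbb T$. $H^\infty_1$ is the closed unit ball of $H^\infty$ (bounded analytic functions on $\mathbb D$ with sup norm). A function $b\in H^\infty_1$ is a non-extreme point of $H^\infty_1$ iff $\int_{\mathbb T}\log(1-|b|)\,dm>-\infty$. For $b\in H^\infty_1$, the de Branges–Rovnyak space $\mathscr H(b)$ is the reproducing kernel Hilbert space of analytic functions on $\mathbb D$ with reproducing kernel $k^b_\lambda(z)=\frac{1-\overline{b(\lambda)}b(z)}{1-\overline\lambda z}$ ($\lambda,z\in\mathbb D$); its norm is denoted $\|\cdot\|_b$. It is contractively contained in $H^2$. $M_+(\mathbb D^-)$ is the set of positive finite Borel measures on $\mathbb D^-$. For $\mu\in M_+(\mathbb D^-)$, an analytic function $f$ on $\mathbb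 D$ is $\mu$-admissible if its non-tangential limits exist $\mu$-almost everywhere on $\mathbb T$; such an $f$ is extended $\mu$-a.e. to $\mathbb T$ by its non-tangential limits, and $\|f\|_\mu\in[0,+\infty]$ denotes its $L^2(\mu)$ norm. $\mathscr H(b)_\mu$ is the set of $\mu$-admissible functions in $\mathscr H(b)$. The measure $\mu$ is a reverse Carleson measure for $\mathscr H(b)$ if $\mathscr H(b)_\mu$ is dense in $\mathscr H(b)$ and there is a constant $C>0$ with $\|f\|_b\le C\|f\|_\mu$ for all $f\in\mathscr H(b)_\mu$ (the value $\|f\|_\mu=\infty$ is allowed). $d(\mu|\mathbb T)/dm$ is the Radon–Nikodym derivative of the absolutely continuous part (with respect to $m$) of the restriction of $\mu$ to $\mathbb T$. For an open arc $I\subset\mathbb T$, $S(I)=\{z\in\mathbb D^-:\ z/|z|\in I,\ 1-|z|\le m(I)/2\}$. *)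

theory Defs
  imports "HOL-Analysis.Analysis"
begin

section \<open>Bounded analytic functions on the disk\<close>

text \<open>Functions on the open unit disk are functions \<open>complex \<Rightarrow> complex\<close> of which only the values
  on \<^term>\<open>ball 0 1 :: complex set\<close> matter. Boundary values are never taken from such a function
  itself but from its non-tangential limits; see \<open>nt_ext\<close> below.\<close>

definition Hinf_ball :: "(complex \<Rightarrow> complex) set" where
  "Hinf_ball = {f. f holomorphic_on ball 0 1 \<and> (\<forall>z\<in>ball 0 1. cmod (f z) \<le> 1)}"

text \<open>This is \<^const>\<open>extreme_point_of\<close>, spelled out because the function type is not an
  instance of \<^class>\<open>real_vector\<close>, and with equality of functions meaning equality on the disk.\<close>

definition Hinf_extreme :: "(complex \<Rightarrow> complex) \<Rightarrow> bool" where
  "Hinf_extreme b \<longleftrightarrow> b \<in> Hinf_ball \<and>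
     (\<forall>f\<in>Hinf_ball. \<forall>g\<in>Hinf_ball. \<forall>t::real. 0 < t \<and> t < 1 \<longrightarrow>
        (\<forall>z\<in>ball 0 1. b z = of_real (1 - t) * f z + of_real t * g z) \<longrightarrow>
        (\<forall>z\<in>ball 0 1. f z = g z))"

definition Hinf_nonextreme :: "(complex \<Rightarrow> complex) \<Rightarrow> bool" where
  "Hinf_nonextreme b \<longleftrightarrow> b \<in> Hinf_ball \<and> \<not> Hinf_extreme b"


section \<open>Reproducing kernel Hilbert spaces and \<open>\<H>(b)\<close>\<close>

text \<open>\<open>H\<close> with inner product \<open>ip\<close> (linear in the first argument) is the Hilbert space of functions
  on \<open>X\<close> with reproducing kernel \<open>K\<close>, where \<open>K \<lambda>\<close> is the kernel function at \<open>\<lambda>\<close>. A function on \<open>X\<close>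
  is represented by its extension by \<open>0\<close>, so that each one has exactly one representative. The
  pair \<open>(H, ip)\<close> is thus determined by \<open>X\<close> and the values of \<open>K\<close> on \<open>X\<close> (\<open>ip\<close> only on \<open>H\<close>).\<close>

locale rkhs =
  fixes X :: "'a set"
    and K :: "'a \<Rightarrow> 'a \<Rightarrow> complex"
    and H :: "('a \<Rightarrow> complex) set"
    and ip :: "('a \<Rightarrow> complex) \<Rightarrow> ('a \<Rightarrow> complex) \<Rightarrow> complex"
  assumes supported: "f \<in> H \<Longrightarrow> z \<notin> X \<Longrightarrow> f z = 0"
    and zero_mem: "(\<lambda>z. 0) \<in> H"
    and add_mem: "f \<in> H \<Longrightarrow> g \<in> H \<Longrightarrow> (\<lambda>z. f z + g z) \<in> H"
    and scale_mem: "f \<in> H \<Longrightarrow> (\<lambda>z. c * f z) \<in> H"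
    and ip_add: "f \<in> H \<Longrightarrow> g \<in> H \<Longrightarrow> k \<in> H \<Longrightarrow> ip (\<lambda>z. f z + g z) k = ip f k + ip g k"
    and ip_scale: "f \<in> H \<Longrightarrow> g \<in> H \<Longrightarrow> ip (\<lambda>z. c * f z) g = c * ip f g"
    and ip_cnj: "f \<in> H \<Longrightarrow> g \<in> H \<Longrightarrow> ip g f = cnj (ip f g)"
    and ip_nonneg: "f \<in> H \<Longrightarrow> 0 \<le> Re (ip f f)"
    and ip_definite: "f \<in> H \<Longrightarrow> ip f f = 0 \<Longrightarrow> f = (\<lambda>z. 0)"
    and complete: "\<lbrakk>\<And>n::nat. s n \<in> H;
        \<And>e::real. 0 < e \<Longrightarrow> \<exists>N. \<forall>m\<ge>N. \<forall>n\<ge>N.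
           sqrt (Re (ip (\<lambda>z. s m z - s n z) (\<lambda>z. s m z - s n z))) < e\<rbrakk>
      \<Longrightarrow> \<exists>f\<in>H. (\<lambda>n. sqrt (Re (ip (\<lambda>z. s n z - f z) (\<lambda>z. s n z - f z)))) \<longlonglongrightarrow> 0"
    and kernel_mem: "w \<in> X \<Longrightarrow> (\<lambda>z. if z \<in> X then K w z else 0) \<in> H"
    and reproducing: "w \<in> X \<Longrightarrow> f \<in> H \<Longrightarrow> f w = ip f (\<lambda>z. if z \<in> X then K w z else 0)"

definition ip_norm :: "((complex \<Rightarrow> complex) \<Rightarrow> (complex \<Rightarrow> complex) \<Rightarrow> complex) \<Rightarrow>
    (complex \<Rightarrow> complex) \<Rightarrow> real" where
  "ip_norm ip f = sqrt (Re (ip f f))"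

definition kb :: "(complex \<Rightarrow> complex) \<Rightarrow> complex \<Rightarrow> complex \<Rightarrow> complex" where
  "kb b w z = (if z \<in> ball 0 1 then (1 - cnj (b w) * b z) / (1 - cnj w * z) else 0)"

definition de_Branges_Rovnyak :: "(complex \<Rightarrow> complex) \<Rightarrow> (complex \<Rightarrow> complex) set \<Rightarrow>
    ((complex \<Rightarrow> complex) \<Rightarrow> (complex \<Rightarrow> complex) \<Rightarrow> complex) \<Rightarrow> bool" where
  "de_Branges_Rovnyak b H ip \<longleftrightarrow>
     rkhs (ball 0 1) (kb b) H ip \<and> (\<forall>f\<in>H. f holomorphic_on ball 0 1)"


section \<open>Measures on the circle and the closed disk\<close>

definition circle_measure :: "complex measure" where
  "circle_measure = distr (uniform_measure lborel {0..<2 * pi})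
     (restrict_space borel (sphere 0 1)) cis"

definition disk_measures :: "complex measure set" where
  "disk_measures = {\<mu>. sets \<mu> = sets (restrict_space borel (cball 0 1)) \<and> finite_measure \<mu>}"

text \<open>\<open>h\<close> is (a version of) the Radon--Nikodym derivative with respect to \<open>m\<close> of the absolutely
  continuous part of \<open>\<rho>\<close>: the Lebesgue decomposition of \<open>\<rho>\<close> is \<open>h dm\<close> plus the restriction of \<open>\<rho>\<close>
  to an \<open>m\<close>-null set. (\<^const>\<open>RN_deriv\<close> is only meaningful when \<open>\<rho>\<close> itself is absolutely
  continuous.)\<close>

definition ac_density :: "'a measure \<Rightarrow> 'a measure \<Rightarrow> ('a \<Rightarrow> ennreal) \<Rightarrow> bool" where
  "ac_density m \<rho> h \<longleftrightarrow> h \<in> borel_measurable m \<and>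
     (\<exists>N\<in>null_sets m. \<forall>A\<in>sets m. emeasure \<rho> A = (\<integral>\<^sup>+z\<in>A. h z \<partial>m) + emeasure \<rho> (A \<inter> N))"

definition ess_inf :: "'a measure \<Rightarrow> ('a \<Rightarrow> ennreal) \<Rightarrow> ennreal" where
  "ess_inf m f = Sup {c. AE z in m. c \<le> f z}"

text \<open>Arcs are parametrized by angle; \<open>t - s \<le> 2 * pi\<close> allows everything up to the circle minus
  one point.\<close>

definition open_arc :: "complex set \<Rightarrow> bool" where
  "open_arc I \<longleftrightarrow> (\<exists>s t. s < t \<and> t - s \<le> 2 * pi \<and> I = cis ` {s<..<t})"

definition carleson_window :: "complex set \<Rightarrow> complex set" where
  "carleson_window I =
     {z \<in> cball 0 1. z / of_real (cmod z) \<in> I \<and> 1 - cmod z \<le> measure circle_measure I / 2}"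


section \<open>Non-tangential limits and admissible functions\<close>

definition stolz :: "real \<Rightarrow> complex \<Rightarrow> complex set" where
  "stolz \<alpha> \<zeta> = {z \<in> ball 0 1. cmod (z - \<zeta>) < \<alpha> * (1 - cmod z)}"

definition has_nt_limit :: "(complex \<Rightarrow> complex) \<Rightarrow> complex \<Rightarrow> complex \<Rightarrow> bool" where
  "has_nt_limit f \<zeta> L \<longleftrightarrow> (\<forall>\<alpha>>1. (f \<longlongrightarrow> L) (at \<zeta> within stolz \<alpha> \<zeta>))"

lemma at_within_stolz_nontrivial:
  assumes "cmod \<zeta> = 1" "1 < \<alpha>"
  shows "at \<zeta> within stolz \<alpha> \<zeta> \<noteq> bot"
proof -
  have "\<exists>z\<in>stolz \<alpha> \<zeta>. z \<noteq> \<zeta> \<and> dist z \<zeta> < e" if "0 < e" for e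
  proof -
    define r where "r = min (e / 2) (1 / 2)"
    have r: "0 < r" "r < 1" "r < e" using that by (auto simp: r_def min_def)
    define z where "z = of_real (1 - r) * \<zeta>"
    have nz: "cmod z = 1 - r" using r assms(1) by (simp add: z_def norm_mult del: of_real_diff)
    have "z - \<zeta> = of_real (- r) * \<zeta>" by (simp add: z_def algebra_simps)
    then have d: "cmod (z - \<zeta>) = r" using r assms(1) by (simp add: norm_mult)
    have "r < \<alpha> * r" using r assms(2) by simp
    then have "z \<in> stolz \<alpha> \<zeta>" using nz d r by (simp add: stolz_def)
    moreover have "z \<noteq> \<zeta>" using d r by auto
    moreover have "dist z \<zeta> < e" using d r by (simp add: dist_norm)
    ultimately show ?thesis by blast
  qed
  then have "\<zeta> islimpt stolz \<alpha> \<zeta>" by (simp add: islimpt_approachable)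
  then show ?thesis by (simp add: trivial_limit_within)
qed

lemma has_nt_limit_unique:
  assumes "cmod \<zeta> = 1" "has_nt_limit f \<zeta> L" "has_nt_limit f \<zeta> L'"
  shows "L = L'"
  using tendsto_unique[OF at_within_stolz_nontrivial[OF assms(1), of 2], of f L L'] assms(2,3)
  by (auto simp: has_nt_limit_def)

text \<open>Extension of a function on the disk to those points of the circle where it has a
  non-tangential limit; the value \<open>0\<close> elsewhere is irrelevant for admissible functions.\<close>

definition nt_ext :: "(complex \<Rightarrow> complex) \<Rightarrow> complex \<Rightarrow> complex" where
  "nt_ext f z = (if z \<in> ball 0 1 then f z
     else if \<exists>L. has_nt_limit f z L then THE L. has_nt_limit f z L else 0)"

definition admissible :: "complex measure \<Rightarrow> (complex \<Rightarrow> complex) \<Rightarrow> bool" where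
  "admissible \<mu> f \<longleftrightarrow> f holomorphic_on ball 0 1 \<and>
     (AE z in \<mu>. z \<in> sphere 0 1 \<longrightarrow> (\<exists>L. has_nt_limit f z L))"

definition L2_norm_ext :: "complex measure \<Rightarrow> (complex \<Rightarrow> complex) \<Rightarrow> ennreal" where
  "L2_norm_ext \<mu> f = (let q = \<integral>\<^sup>+z. ennreal ((cmod (nt_ext f z))\<^sup>2) \<partial>\<mu>
     in if q = \<infinity> then \<infinity> else ennreal (sqrt (enn2real q)))"

definition reverse_Carleson :: "complex measure \<Rightarrow> (complex \<Rightarrow> complex) set \<Rightarrow>
    ((complex \<Rightarrow> complex) \<Rightarrow> (complex \<Rightarrow> complex) \<Rightarrow> complex) \<Rightarrow> bool" where
  "reverse_Carleson \<mu> H ip \<longleftrightarrow>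
     (\<forall>f\<in>H. \<forall>e>0. \<exists>g\<in>H. admissible \<mu> g \<and> ip_norm ip (\<lambda>z. f z - g z) < e) \<and>
     (\<exists>C>0. \<forall>f\<in>H. admissible \<mu> f \<longrightarrow> ennreal (ip_norm ip f) \<le> ennreal C * L2_norm_ext \<mu> f)"

end

theory Submission
  imports Defs "HOL-Complex_Analysis.Complex_Analysis"
begin

text \<open>Condition (4) implies (1): let \<open>F\<close> be a finite combination of the kernels \<open>k\<^sup>b\<close> at points \<open>w\<close> and \<open>G\<close> the same
  combination of Szego kernels. Then \<open>\<integral> (1 - \<bar>b\<bar>\<^sup>2) \<bar>G\<bar>\<^sup>2 dm \<le> \<parallel>F\<parallel>\<^sub>b\<^sup>2\<close>, because \<open>\<parallel>F\<parallel>\<^sub>b\<^sup>2 = \<parallel>G\<parallel>\<^sup>2 - \<parallel>P(cnj b * G)\<parallel>\<^sup>2\<close>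
  with \<open>P\<close> the projection onto \<open>H\<^sup>2\<close>. As \<open>\<langle>f, F\<rangle>\<^sub>b = \<integral> f * cnj G dm\<close>, the Cauchy--Schwarz inequality with weight
  \<open>1 - \<bar>b\<bar>\<^sup>2\<close> bounds \<open>\<parallel>f\<parallel>\<^sub>b\<^sup>2\<close> by \<open>\<integral> \<bar>f\<bar>\<^sup>2 / (1 - \<bar>b\<bar>\<^sup>2) dm\<close>, and (4) bounds this by \<open>\<parallel>f\<parallel>\<^sub>\<mu>\<^sup>2\<close>. Admissible functions are
  dense since the kernels themselves are admissible.

  (2) implies (4): multiply the inequality for \<open>w = r \<zeta>\<close> by \<open>(1 - r\<^sup>2) \<phi>(\<zeta>)\<close>, integrate over the circle and let \<open>r \<rightarrow> 1\<close>. In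
  the limit only \<open>\<mu>\<close> on the circle contributes, and \<open>\<integral> \<phi> (1 - \<bar>b\<bar>\<^sup>2) dm \<le> C\<^sup>2 \<integral> \<phi> (1 - \<bar>b\<bar>\<^sup>2)\<^sup>2 d\<mu>\<close>. So
  \<open>1 \<le> C\<^sup>2 (1 - \<bar>b\<bar>\<^sup>2) h\<close> wherever \<open>\<bar>b\<bar> < 1\<close>, and that is almost everywhere because \<open>b\<close> is not extreme: if \<open>\<bar>b\<bar> = 1\<close>
  on a set of positive measure and \<open>b\<close> is a proper convex combination of \<open>f\<close> and \<open>g\<close>, then \<open>f - g\<close> vanishes on
  that set, hence identically.

  (3) implies (4): summing over the arcs of a fine grid that meet a compact set \<open>K\<close> gives \<open>c * m(K) \<le> \<nu>(K)\<close>.\<close>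

section \<open>Integration on the circle\<close>

text \<open>Two kinds of information are missing at the boundary, and this shapes the proof.
  \<open>H\<close> is given only through its kernel, so its norm is explicit only on finite kernel
  sums. Norm estimates are proved there for dilates of \<open>b\<close>, which are continuous on the
  closed disk and turn norms into integrals of continuous functions; Fatou's lemma and density of
  the span carry them further. Non-tangential limits are given \<mu>-almost everywhere, while (4)
  and the weighted estimate speak of \<open>m\<close>-almost every point. Starting from (2), \<mu>
  does not charge the part of the circle where \<open>b\<close> has no limits, so the testing
  inequality sends the means of \<open>1 - |b|^2\<close> over that part to \<open>0\<close> along
  some radii, and non-extremality forbids this on a set of positive measure. For this reason the
  uniqueness statement behind non-extremality is phrased with means over circles of radius less than
  \<open>1\<close>, and not with boundary values.\<close>

notation circle_measure (\<open>\<sigma>\<close>)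

lemma space_circle_measure [simp]: "space \<sigma> = sphere 0 1"
  by (simp add: circle_measure_def space_restrict_space)

lemma sets_circle_measure:
  "sets \<sigma> = sets (restrict_space borel (sphere 0 1))"
  by (simp add: circle_measure_def)

lemma sets_circle_iff: "A \<in> sets \<sigma> \<longleftrightarrow> A \<subseteq> sphere 0 1 \<and> A \<in> sets borel"
  by (simp add: sets_circle_measure sets_restrict_space_iff)

lemma borel_measurable_circleI:
  assumes "continuous_on (sphere 0 1) f"
  shows "f \<in> borel_measurable \<sigma>"
  using borel_measurable_continuous_on_restrict[OF assms]
  by (simp add: measurable_cong_sets[OF sets_circle_measure refl])

lemma continuous_on_cis': "continuous_on S cis"
  unfolding cis_conv_exp by (intro continuous_intros)

lemma measurable_cis_circle:
  "cis \<in> measurable borel (restrict_space borel (sphere 0 1))"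
  by (intro measurable_restrict_space2 borel_measurable_continuous_onI continuous_on_cis') auto

lemma emeasure_2pi: "emeasure lborel {0..<2 * pi} = ennreal (2 * pi)"
  by simp

lemma emeasure_circle_measure:
  assumes "A \<in> sets \<sigma>"
  shows "emeasure \<sigma> A = emeasure lborel ({0..<2 * pi} \<inter> cis -` A) / ennreal (2 * pi)"
proof -
  have m: "cis \<in> measurable (uniform_measure lborel {0..<2 * pi}) (restrict_space borel (sphere 0 1))"
    using measurable_cis_circle by (subst measurable_cong_sets[OF sets_uniform_measure refl]) simp
  have A: "A \<in> sets (restrict_space borel (sphere 0 1))"
    using assms by (simp add: sets_circle_measure)
  have "cis -` A \<in> sets borel"
    using measurable_sets[OF measurable_cis_circle A] by simp
  then show ?thesis
    unfolding circle_measure_def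
    by (subst emeasure_distr[OF m A]) (simp add: emeasure_uniform_measure emeasure_2pi)
qed

lemma emeasure_space_circle [simp]: "emeasure \<sigma> (sphere 0 1) = 1"
proof -
  have "{0..<2 * pi} \<inter> cis -` sphere 0 1 = {0..<2 * pi}" by auto
  then show ?thesis
    by (subst emeasure_circle_measure) (auto simp: sets_circle_iff divide_ennreal emeasure_2pi simp del: emeasure_lborel_Ico)
qed

interpretation circle: finite_measure \<sigma>
  by standard simp

lemma measure_space_circle [simp]: "measure \<sigma> (sphere 0 1) = 1"
  by (simp add: measure_def)

lemma integral_circle_const [simp]:
  "(\<integral>z. c \<partial>\<sigma>) = (c :: 'b::{banach, second_countable_topology})"
  by (simp add: measure_def)

lemma integrable_circleI:
  fixes f :: "complex \<Rightarrow> 'b::{banach, second_countable_topology}"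
  assumes "continuous_on (sphere 0 1) f"
  shows "integrable \<sigma> f"
proof -
  have "bounded (f ` sphere 0 1)"
    by (rule compact_imp_bounded, rule compact_continuous_image[OF assms]) auto
  then obtain B where "\<And>x. x \<in> sphere 0 1 \<Longrightarrow> norm (f x) \<le> B"
    unfolding bounded_iff by blast
  then show ?thesis
    by (intro circle.integrable_const_bound[where B=B] borel_measurable_circleI assms AE_I2) auto
qed

lemma integral_circle_measure:
  fixes f :: "complex \<Rightarrow> 'b::euclidean_space"
  assumes "continuous_on (sphere 0 1) f"
  shows "integral\<^sup>L \<sigma> f = integral {0..2 * pi} (\<lambda>t. f (cis t)) /\<^sub>R (2 * pi)"
proof -
  have m: "cis \<in> measurable (uniform_measure lborel {0..<2 * pi}) (restrict_space borel (sphere 0 1))"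
    using measurable_cis_circle by (subst measurable_cong_sets[OF sets_uniform_measure refl]) simp
  have f: "f \<in> borel_measurable (restrict_space borel (sphere 0 1))"
    using borel_measurable_continuous_on_restrict[OF assms] .
  have c: "continuous_on S (\<lambda>t. f (cis t))" for S
    by (rule continuous_on_compose2[OF assms]) (auto intro!: continuous_on_cis')
  have cm [measurable]: "(\<lambda>t. f (cis t)) \<in> borel_measurable borel"
    by (intro borel_measurable_continuous_onI c)
  have u: "uniform_measure lborel {0..<2 * pi} = density lborel (\<lambda>t. ennreal (indicator {0..<2*pi} t / (2 * pi)))"
    unfolding uniform_measure_def emeasure_2pi
  proof (intro arg_cong2[where f=density] refl ext)
    fix t :: real
    show "indicator {0..<2 * pi} t / ennreal (2 * pi) = ennreal (indicator {0..<2*pi} t / (2 * pi))"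
      using divide_ennreal[of 1 "2 * pi"] by (simp add: indicator_def)
  qed
  have "integral\<^sup>L \<sigma> f = (\<integral>t. f (cis t) \<partial>uniform_measure lborel {0..<2 * pi})"
    unfolding circle_measure_def by (rule integral_distr[OF m f])
  also have "\<dots> = (\<integral>t. (indicator {0..<2*pi} t / (2 * pi)) *\<^sub>R f (cis t) \<partial>lborel)"
    unfolding u
    by (intro integral_density) (auto intro!: borel_measurable_continuous_onI c)
  \<comment> \<open>The half-open interval of \<open>circle_measure\<close> is exchanged for the
    closed one used by the gauge integral; the endpoint is null.\<close>
  also have "\<dots> = (\<integral>t. (indicator {0..2*pi} t *\<^sub>R f (cis t)) /\<^sub>R (2 * pi) \<partial>lborel)"
  proof (intro integral_cong_AE)
    show "AE t in lborel. (indicator {0..<2*pi} t / (2 * pi)) *\<^sub>R f (cis t) = (indicator {0..2*pi} t *\<^sub>R f (cis t)) /\<^sub>R (2 * pi)"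
      using AE_lborel_singleton[of "2 * pi"]
      by eventually_elim (auto simp: indicator_def divide_simps)
  qed (use cm in measurable)
  also have "\<dots> = (\<integral>t\<in>{0..2*pi}. f (cis t) \<partial>lborel) /\<^sub>R (2 * pi)"
    unfolding set_lebesgue_integral_def by (rule integral_scaleR_right)
  also have "(\<integral>t\<in>{0..2*pi}. f (cis t) \<partial>lborel) = integral {0..2 * pi} (\<lambda>t. f (cis t))"
    by (rule set_borel_integral_eq_integral(2)) (simp add: borel_integrable_atLeastAtMost' c)
  finally show ?thesis .
qed

section \<open>Szego kernel of the Hardy space \<open>H^2\<close>, Poisson kernel, and their
  integral formulas\<close>

definition szego :: "complex \<Rightarrow> complex \<Rightarrow> complex" where
  "szego w z = 1 / (1 - cnj w * z)"

lemma szego_denominator_nonzero: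
  assumes "cmod w < 1" "cmod z \<le> 1"
  shows "1 - cnj w * z \<noteq> 0"
proof
  assume "1 - cnj w * z = 0"
  then have "cmod (cnj w * z) = 1" by simp
  moreover have "cmod (cnj w * z) \<le> cmod w * 1"
    unfolding norm_mult complex_mod_cnj by (intro mult_left_mono assms) auto
  ultimately show False using assms by simp
qed

lemma continuous_on_szego [continuous_intros]:
  assumes "cmod w < 1" "continuous_on S f" "\<And>x. x \<in> S \<Longrightarrow> cmod (f x) \<le> 1"
  shows "continuous_on S (\<lambda>x. szego w (f x))"
  unfolding szego_def
  by (intro continuous_intros assms) (use szego_denominator_nonzero[OF assms(1)] assms(3) in auto)

lemma holomorphic_on_szego:
  assumes "cmod w < 1" "S \<subseteq> cball 0 1"
  shows "szego w holomorphic_on S"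
  unfolding szego_def
  by (intro holomorphic_intros) (use szego_denominator_nonzero[OF assms(1)] assms(2) in auto)

text \<open>On the circle \<open>cnj z = 1 / z\<close>, so
  \<open>cnj (szego w z) = z / (z - w)\<close>; with \<open>dz = \<i> * z dt\<close> the Cauchy
  formula becomes a pairing with the Szego kernel.\<close>

lemma circle_Cauchy_integral:
  assumes c: "continuous_on (cball 0 1) u" and h: "u holomorphic_on ball 0 1" and w: "cmod w < 1"
  shows "(\<integral>z. u z * cnj (szego w z) \<partial>\<sigma>) = u w"
proof -
  have cc: "continuous_on (sphere 0 1) (\<lambda>z. u z * cnj (szego w z))"
    using c by (intro continuous_intros w) (auto intro: continuous_on_subset)
  have "((\<lambda>z. u z / (z - w)) has_contour_integral (2 * of_real pi * \<i> * u w)) (circlepath 0 1)"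
    by (rule Cauchy_integral_circlepath) (use c h w in auto)
  then have "((\<lambda>t. u (cis t) / (cis t - w) * \<i> * cis t) has_integral 2 * of_real pi * \<i> * u w) {0..2 * pi}"
    unfolding circlepath_def
    by (subst (asm) has_contour_integral_part_circlepath_iff) (auto simp: algebra_simps)
  then have "((\<lambda>t. (1 / \<i>) * (u (cis t) / (cis t - w) * \<i> * cis t)) has_integral (1 / \<i>) * (2 * of_real pi * \<i> * u w)) {0..2 * pi}"
    by (rule has_integral_mult_right)
  then have "((\<lambda>t. u (cis t) * cnj (szego w (cis t))) has_integral 2 * of_real pi * u w) {0..2 * pi}"
  proof (rule has_integral_eq_rhs[OF has_integral_eq, rotated])
    fix t
    have n: "cis t \<noteq> w" using w norm_cis[of t] by auto
    have s: "cnj (szego w (cis t)) = 1 / (1 - w / cis t)"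
      by (simp add: szego_def cis_cnj divide_inverse)
    have "1 / (1 - w / cis t) = cis t / (cis t - w)" using n by (simp add: field_simps)
    then show "1 / \<i> * (u (cis t) / (cis t - w) * \<i> * cis t) = u (cis t) * cnj (szego w (cis t))"
      unfolding s using n by (simp add: field_simps)
  qed simp
  then have "integral {0..2 * pi} (\<lambda>t. u (cis t) * cnj (szego w (cis t))) = 2 * of_real pi * u w"
    by (rule integral_unique)
  then show ?thesis
    unfolding integral_circle_measure[OF cc] by (simp add: scaleR_conv_of_real)
qed

lemma circle_mean_value:
  assumes "continuous_on (cball 0 1) u" "u holomorphic_on ball 0 1"
  shows "(\<integral>z. u z \<partial>\<sigma>) = u 0"
  using circle_Cauchy_integral[OF assms, of 0] by (simp add: szego_def)

text \<open>This is \<open>|szego w z|^2 / szego w w\<close>. The form is chosen because Poisson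
  kernels will arise from squared moduli of kernel functions.\<close>

definition poisson :: "complex \<Rightarrow> complex \<Rightarrow> real" where
  "poisson w z = (1 - (cmod w)\<^sup>2) * (cmod (szego w z))\<^sup>2"

lemma poisson_nonneg: "cmod w \<le> 1 \<Longrightarrow> 0 \<le> poisson w z"
  unfolding poisson_def by (intro mult_nonneg_nonneg) (auto simp: power_le_one)

lemma continuous_on_poisson:
  assumes "cmod w < 1"
  shows "continuous_on (sphere 0 1) (poisson w)"
  unfolding poisson_def by (intro continuous_intros assms) auto

text \<open>The Cauchy formula is applied to \<open>u * szego w\<close>, whose value at
  \<open>w\<close> is \<open>u w / (1 - |w|^2)\<close>.\<close>

lemma circle_Poisson_integral:
  assumes c: "continuous_on (cball 0 1) u" and h: "u holomorphic_on ball 0 1" and w: "cmod w < 1"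
  shows "(\<integral>z. u z * of_real (poisson w z) \<partial>\<sigma>) = u w"
proof -
  have ww: "szego w w = 1 / of_real (1 - (cmod w)\<^sup>2)"
    unfolding szego_def of_real_diff complex_norm_square by (simp add: mult.commute)
  have w1: "(cmod w)\<^sup>2 < 1" using w by (simp add: abs_square_less_1)
  have "(\<integral>z. u z * szego w z * cnj (szego w z) \<partial>\<sigma>) = u w * szego w w"
    by (rule circle_Cauchy_integral)
       (use c w in \<open>auto intro!: continuous_intros holomorphic_intros h holomorphic_on_szego\<close>)
  then have "of_real (1 - (cmod w)\<^sup>2) * (\<integral>z. u z * szego w z * cnj (szego w z) \<partial>\<sigma>) = u w"
    unfolding ww using w1 by (simp del: of_real_diff)
  moreover have "of_real (1 - (cmod w)\<^sup>2) * (\<integral>z. u z * szego w z * cnj (szego w z) \<partial>\<sigma>)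
    = (\<integral>z. of_real (1 - (cmod w)\<^sup>2) * (u z * szego w z * cnj (szego w z)) \<partial>\<sigma>)"
    by simp
  moreover have "(\<lambda>z. of_real (1 - (cmod w)\<^sup>2) * (u z * szego w z * cnj (szego w z))) =
      (\<lambda>z. u z * of_real (poisson w z))"
    by (intro ext) (simp add: poisson_def complex_norm_square[symmetric] mult_ac del: of_real_diff)
  ultimately show ?thesis by metis
qed

lemma integral_poisson:
  assumes "cmod w < 1"
  shows "(\<integral>z. poisson w z \<partial>\<sigma>) = 1"
proof -
  have "(\<integral>z. 1 * complex_of_real (poisson w z) \<partial>\<sigma>) = 1"
    by (rule circle_Poisson_integral) (use assms in auto)
  then have "complex_of_real (\<integral>z. poisson w z \<partial>\<sigma>) = of_real 1"
    by simp
  then show ?thesis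
    by (simp only: of_real_eq_iff)
qed

section \<open>Arcs, trigonometric approximation and Poisson averages\<close>

lemma inj_on_cis: "inj_on cis {0..<2 * pi}"
proof (rule inj_onI)
  fix x y assume xy: "x \<in> {0..<2 * pi}" "y \<in> {0..<2 * pi}" "cis x = cis y"
  then show "x = y"
    using Arg2pi_unique[of 1 x "cis x"] Arg2pi_unique[of 1 y "cis x"]
    by (auto simp: cis_conv_exp)
qed

lemma cis_image_borel: "cis ` {s<..<t} \<in> sets borel"
proof -
  have "{s<..<t} = (\<Union>n. {s + 1 / Suc n..t - 1 / Suc n})"
  proof (intro set_eqI iffI)
    fix x assume x: "x \<in> {s<..<t}"
    then obtain n where "1 / Suc n < min (x - s) (t - x)"
      using reals_Archimedean[of "min (x - s) (t - x)"] by (auto simp: inverse_eq_divide)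
    then show "x \<in> (\<Union>n. {s + 1 / Suc n..t - 1 / Suc n})"
      by (intro UN_I[of n]) auto
  next
    fix x assume "x \<in> (\<Union>n. {s + 1 / Suc n..t - 1 / Suc n})"
    then obtain n where "s + 1 / Suc n \<le> x" "x \<le> t - 1 / Suc n" by auto
    moreover have "0 < 1 / real (Suc n)" by simp
    ultimately show "x \<in> {s<..<t}" unfolding greaterThanLessThan_iff by linarith
  qed
  then have "cis ` {s<..<t} = (\<Union>n. cis ` {s + 1 / Suc n..t - 1 / Suc n})"
    by (simp add: image_UN)
  moreover have "cis ` {a..b} \<in> sets borel" for a b
    by (intro borel_closed compact_imp_closed compact_continuous_image continuous_on_cis') auto
  ultimately show ?thesis by auto
qed

lemma cis_image_sets: "cis ` {s<..<t} \<in> sets \<sigma>"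
  by (auto simp: sets_circle_iff cis_image_borel)

lemma emeasure_cis_image:
  assumes "0 \<le> s" "s \<le> t" "t \<le> 2 * pi"
  shows "emeasure \<sigma> (cis ` {s<..<t}) = ennreal ((t - s) / (2 * pi))"
proof -
  have "{0..<2 * pi} \<inter> cis -` (cis ` {s<..<t}) = {s<..<t}"
    using assms inj_on_cis by (fastforce simp: inj_on_def)
  then show ?thesis
    using assms by (simp add: emeasure_circle_measure[OF cis_image_sets] divide_ennreal)
qed

lemma open_arc_sets: "open_arc I \<Longrightarrow> I \<in> sets \<sigma>"
  by (auto simp: open_arc_def cis_image_sets)

text \<open>The exact length is available only for angles within one period. An arc that crosses the
  angle \<open>0\<close> is shifted by a multiple of \<open>2 * pi\<close> and cut off at
  \<open>2 * pi\<close>; the remaining piece is non-degenerate, which suffices for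
  positivity.\<close>

lemma emeasure_open_arc_pos:
  assumes "open_arc I"
  shows "0 < emeasure \<sigma> I"
proof -
  obtain s t where st: "s < t" "I = cis ` {s<..<t}"
    using assms by (auto simp: open_arc_def)
  define k where "k = \<lfloor>s / (2 * pi)\<rfloor>"
  define s' where "s' = s - 2 * pi * k"
  define t' where "t' = min (t - 2 * pi * k) (2 * pi)"
  have "of_int k \<le> s / (2 * pi)" "s / (2 * pi) < of_int k + 1"
    unfolding k_def by linarith+
  then have s': "0 \<le> s'" "s' < 2 * pi"
    by (auto simp: s'_def field_simps)
  have lt: "s' < t'" using st s' by (auto simp: s'_def t'_def)
  have "cis ` {s'<..<t'} \<subseteq> I"
  proof
    fix z assume "z \<in> cis ` {s'<..<t'}"
    then obtain x where x: "x \<in> {s'<..<t'}" "z = cis x" by auto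
    have "z = cis (x + 2 * pi * k)"
      by (simp add: x cis_mult[symmetric])
    then show "z \<in> I" using x by (auto simp: st s'_def t'_def intro!: image_eqI)
  qed
  then have "emeasure \<sigma> (cis ` {s'<..<t'}) \<le> emeasure \<sigma> I"
    by (intro emeasure_mono open_arc_sets assms)
  moreover have "emeasure \<sigma> (cis ` {s'<..<t'}) = ennreal ((t' - s') / (2 * pi))"
    by (rule emeasure_cis_image) (use s' lt in \<open>auto simp: t'_def\<close>)
  moreover have "0 < ennreal ((t' - s') / (2 * pi))"
    using lt by simp
  ultimately show ?thesis by (metis order_less_le_trans)
qed

lemma emeasure_circle_singleton: "emeasure \<sigma> {z} = 0"
proof (cases "z \<in> sphere 0 1")
  case True
  have "finite (cis -` {z} \<inter> {0..<2 * pi})"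
    by (rule finite_vimage_IntI) (auto intro: inj_on_cis)
  then have "emeasure lborel ({0..<2 * pi} \<inter> cis -` {z}) = 0"
    by (intro emeasure_lborel_countable countable_finite) (simp add: Int_commute)
  then show ?thesis
    using True by (subst emeasure_circle_measure) (auto simp: sets_circle_iff)
next
  case False
  then show ?thesis by (intro emeasure_notin_sets) (auto simp: sets_circle_iff)
qed

lemma AE_circle_neq: "AE z in \<sigma>. z \<noteq> a"
proof (cases "a \<in> sphere 0 1")
  case True
  then have "{a} \<in> null_sets \<sigma>"
    by (auto simp: null_sets_def emeasure_circle_singleton sets_circle_iff)
  then show ?thesis by (rule AE_I'[of _ _ ]) auto
next
  case False
  then show ?thesis by (intro AE_I2) auto
qed

section \<open>Uniform approximation on the circle by real parts of polynomials\<close>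

lemma mult_cnj_eq_1: "cmod z = 1 \<Longrightarrow> z * cnj z = 1"
  using complex_norm_square[of z] by simp

text \<open>Induction on \<open>q\<close>: since \<open>z * cnj z = 1\<close>, a factor
  \<open>z\<close> of \<open>p\<close> cancels a factor \<open>cnj z\<close> of
  \<open>cnj q\<close>, and the terms left over are analytic or have an analytic conjugate. This
  closes the real parts of polynomials under products, as Stone--Weierstrass demands.\<close>

lemma Re_mult_cnj_poly_on_sphere:
  "\<exists>r. \<forall>z\<in>sphere 0 1. Re (poly p z * cnj (poly q z)) = Re (poly r z)"
proof (induction q arbitrary: p)
  case 0
  show ?case by (intro exI[of _ 0]) simp
next
  case (pCons a q)
  obtain c p' where p: "p = pCons c p'" by (cases p)
  obtain r where r: "\<And>z. z \<in> sphere 0 1 \<Longrightarrow> Re (poly p' z * cnj (poly q z)) = Re (poly r z)"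
    using pCons.IH by blast
  show ?case
  proof (intro exI[of _ "smult (cnj a) p + smult (cnj c) (pCons 0 q) + r"] ballI)
    fix z :: complex assume z: "z \<in> sphere 0 1"
    then have zz: "z * cnj z = 1" by (simp add: mult_cnj_eq_1)
    have "poly p z * cnj (poly (pCons a q) z) =
        cnj a * poly p z + cnj (cnj c * (z * poly q z)) + (z * cnj z) * (poly p' z * cnj (poly q z))"
      by (simp add: p algebra_simps)
    then have "Re (poly p z * cnj (poly (pCons a q) z)) =
        Re (cnj a * poly p z) + Re (cnj c * (z * poly q z)) + Re (poly p' z * cnj (poly q z))"
      by (simp only: zz mult_1 plus_complex.sel cnj.sel)
    also have "\<dots> = Re (poly (smult (cnj a) p + smult (cnj c) (pCons 0 q) + r) z)"
      using r[OF z] by (simp add: algebra_simps)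
    finally show "Re (poly p z * cnj (poly (pCons a q) z)) = Re (poly (smult (cnj a) p + smult (cnj c) (pCons 0 q) + r) z)" .
  qed
qed

lemma circle_Re_poly_dense:
  fixes f :: "complex \<Rightarrow> real"
  assumes "continuous_on (sphere 0 1) f" "0 < e"
  obtains p where "\<And>z. z \<in> sphere 0 1 \<Longrightarrow> \<bar>f z - Re (poly p z)\<bar> < e"
proof -
  define P where "P g \<longleftrightarrow> (\<exists>p. \<forall>z\<in>sphere 0 1. g z = Re (poly p z))" for g :: "complex \<Rightarrow> real"
  have "\<exists>g. P g \<and> (\<forall>x \<in> sphere 0 1. \<bar>f x - g x\<bar> < e)"
  proof (rule Stone_Weierstrass_HOL[where P=P, OF _ _ _ _ _ _ assms])
    show "P (\<lambda>x. c)" for c unfolding P_def by (intro exI[of _ "[:of_real c:]"]) simp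
    show "continuous_on (sphere 0 1) g" if "P g" for g
    proof -
      obtain p where "\<forall>z\<in>sphere 0 1. g z = Re (poly p z)" using \<open>P g\<close> by (auto simp: P_def)
      then show ?thesis by (subst continuous_on_cong[OF refl, of _ _ "\<lambda>z. Re (poly p z)"]) (auto intro!: continuous_intros)
    qed
    show "P (\<lambda>x. f x + g x)" if PP: "P f \<and> P g" for f g
    proof -
      obtain p q where "\<forall>z\<in>sphere 0 1. f z = Re (poly p z)" "\<forall>z\<in>sphere 0 1. g z = Re (poly q z)"
        using PP unfolding P_def by blast
      then show ?thesis unfolding P_def by (intro exI[of _ "p + q"]) simp
    qed
    show "P (\<lambda>x. f x * g x)" if PP: "P f \<and> P g" for f g
    proof -
      obtain p q where pq: "\<forall>z\<in>sphere 0 1. f z = Re (poly p z)" "\<forall>z\<in>sphere 0 1. g z = Re (poly q z)"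
        using PP unfolding P_def by blast
      obtain r where r: "\<forall>z\<in>sphere 0 1. Re (poly p z * cnj (poly q z)) = Re (poly r z)"
        using Re_mult_cnj_poly_on_sphere by blast
      show ?thesis unfolding P_def
      \<comment> \<open>The product formula is
        \<open>Re a * Re c = Re (a * c + a * cnj c) / 2\<close>, with the second term rewritten by
        \<open>r\<close>.\<close>
      proof (intro exI[of _ "smult (1/2) (p * q + r)"] ballI)
        fix z :: complex assume z: "z \<in> sphere 0 1"
        have "Re (poly (smult (1/2) (p * q + r)) z) = (Re (poly p z * poly q z) + Re (poly r z)) / 2"
          by simp
        also have "Re (poly r z) = Re (poly p z * cnj (poly q z))" using r z by auto
        finally show "f z * g z = Re (poly (smult (1/2) (p * q + r)) z)"
          using pq z by simp
      qed
    qed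
    show "\<exists>f. P f \<and> f x \<noteq> f y" if "x \<in> sphere 0 1 \<and> y \<in> sphere 0 1 \<and> x \<noteq> y" for x y
    proof -
      have "P Re" unfolding P_def by (intro exI[of _ "[:0, 1:]"]) simp
      moreover have "P Im" unfolding P_def by (intro exI[of _ "[:0, -\<i>:]"]) simp
      moreover have "Re x \<noteq> Re y \<or> Im x \<noteq> Im y" using that by (auto simp: complex_eq_iff)
      ultimately show ?thesis by blast
    qed
  qed auto
  then obtain g p where "\<And>x. x \<in> sphere 0 1 \<Longrightarrow> \<bar>f x - g x\<bar> < e" "\<And>z. z \<in> sphere 0 1 \<Longrightarrow> g z = Re (poly p z)"
    unfolding P_def by blast
  then show ?thesis using that[of p] by auto
qed

text \<open>The automorphism of the disk that sends \<open>0\<close> to \<open>w\<close>. On the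
  circle it carries \<sigma> to the measure with density \<open>poisson w\<close>.\<close>

definition mob :: "complex \<Rightarrow> complex \<Rightarrow> complex" where
  "mob w x = (x + w) / (1 + cnj w * x)"

lemma mob_denominator_nonzero:
  assumes "cmod w < 1" "cmod z \<le> 1"
  shows "1 + cnj w * z \<noteq> 0"
  using szego_denominator_nonzero[of "- w" z] assms by simp

lemma mob_sphere:
  assumes w: "cmod w < 1" and x: "cmod x = 1"
  shows "cmod (mob w x) = 1"
proof -
  have xx: "x * cnj x = 1" using x by (simp add: mult_cnj_eq_1)
  have "x * cnj (1 + cnj w * x) = x + w * (x * cnj x)" by (simp add: algebra_simps)
  then have "cmod (x + w) = cmod (x * cnj (1 + cnj w * x))" by (simp only: xx mult_1_right)
  also have "\<dots> = cmod (1 + cnj w * x)" by (simp only: norm_mult complex_mod_cnj x mult_1)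
  finally show ?thesis
    using mob_denominator_nonzero[of w x] w x by (simp add: mob_def norm_divide)
qed

lemma continuous_on_mob: "cmod w < 1 \<Longrightarrow> continuous_on (cball 0 1) (mob w)"
  unfolding mob_def by (intro continuous_intros) (auto simp: mob_denominator_nonzero)

lemma holomorphic_on_mob: "cmod w < 1 \<Longrightarrow> mob w holomorphic_on ball 0 1"
  unfolding mob_def by (intro holomorphic_intros) (auto simp: mob_denominator_nonzero)

lemma abs_integral_circle_le:
  fixes f :: "complex \<Rightarrow> real"
  assumes "integrable \<sigma> g" "\<And>x. x \<in> sphere 0 1 \<Longrightarrow> \<bar>f x\<bar> \<le> g x"
  shows "\<bar>\<integral>x. f x \<partial>\<sigma>\<bar> \<le> (\<integral>x. g x \<partial>\<sigma>)"
proof (cases "integrable \<sigma> f")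
  case True
  have "\<bar>\<integral>x. f x \<partial>\<sigma>\<bar> \<le> (\<integral>x. \<bar>f x\<bar> \<partial>\<sigma>)"
    by (rule integral_abs_bound)
  also have "\<dots> \<le> (\<integral>x. g x \<partial>\<sigma>)"
    using True assms by (intro Bochner_Integration.integral_mono) auto
  finally show ?thesis .
next
  \<comment> \<open>A non-integrable function has integral \<open>0\<close> by convention, so only
    the sign of the right-hand side matters here.\<close>
  case False
  have "0 \<le> (\<integral>x. g x \<partial>\<sigma>)"
    using assms(2) by (intro Bochner_Integration.integral_nonneg) (auto intro: order_trans[OF abs_ge_zero])
  then show ?thesis using False by (simp add: not_integrable_integral_eq)
qed

text \<open>For the real part of a polynomial \<open>p\<close> both sides are
  \<open>Re (poly p w)\<close>: the left one by the Poisson formula, the right one by the mean value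
  property of \<open>p\<close> composed with \<open>mob w\<close>, as \<open>mob w 0 = w\<close>.
  Both sides are averages of total mass \<open>1\<close>, so uniform approximation carries the
  identity to continuous \<open>f\<close>.\<close>

lemma integral_poisson_mob:
  fixes f :: "complex \<Rightarrow> real"
  assumes f: "continuous_on (sphere 0 1) f" and w: "cmod w < 1"
  shows "(\<integral>z. f z * poisson w z \<partial>\<sigma>) = (\<integral>x. f (mob w x) \<partial>\<sigma>)"
proof -
  have mobc: "continuous_on (sphere 0 1) (\<lambda>x. g (mob w x))" if "continuous_on (sphere 0 1) g" for g :: "complex \<Rightarrow> real"
    by (rule continuous_on_compose2[OF that])
       (use w in \<open>auto intro: continuous_on_subset[OF continuous_on_mob] simp: mob_sphere\<close>)
  have "\<bar>(\<integral>z. f z * poisson w z \<partial>\<sigma>) - (\<integral>x. f (mob w x) \<partial>\<sigma>)\<bar> \<le> e"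
    if "0 < e" for e
  proof -
    obtain p where p: "\<And>z. z \<in> sphere 0 1 \<Longrightarrow> \<bar>f z - Re (poly p z)\<bar> < e / 2"
      using circle_Re_poly_dense[OF f, of "e / 2"] \<open>0 < e\<close> by auto
    define g where "g z = Re (poly p z)" for z
    have gc: "continuous_on S g" for S unfolding g_def by (intro continuous_intros)
    have i: "integrable \<sigma> (\<lambda>z. g z * poisson w z)" "integrable \<sigma> (\<lambda>z. f z * poisson w z)"
      "integrable \<sigma> (\<lambda>x. g (mob w x))" "integrable \<sigma> (\<lambda>x. f (mob w x))"
      "integrable \<sigma> (\<lambda>x. e / 2 * poisson w x)"
      by (intro integrable_circleI continuous_intros continuous_on_poisson mobc gc f w)+
    have "(\<integral>z. poly p z * of_real (poisson w z) \<partial>\<sigma>) = poly p w"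
      by (rule circle_Poisson_integral) (use w in \<open>auto intro!: continuous_intros holomorphic_intros\<close>)
    moreover have "integrable \<sigma> (\<lambda>z. poly p z * complex_of_real (poisson w z))"
      by (intro integrable_circleI continuous_intros continuous_on_poisson w)
    ultimately have 1: "(\<integral>z. g z * poisson w z \<partial>\<sigma>) = Re (poly p w)"
      using integral_bounded_linear[OF bounded_linear_Re, of \<sigma> "\<lambda>z. poly p z * complex_of_real (poisson w z)"]
      by (simp add: g_def)
    have pm: "continuous_on (cball 0 1) (\<lambda>x. poly p (mob w x))"
      by (intro continuous_intros continuous_on_mob w)
    have "(\<integral>x. poly p (mob w x) \<partial>\<sigma>) = poly p (mob w 0)"
      by (rule circle_mean_value[OF pm]) (intro holomorphic_intros holomorphic_on_mob w)
    moreover have "integrable \<sigma> (\<lambda>x. poly p (mob w x))"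
      by (intro integrable_circleI continuous_on_subset[OF pm]) auto
    ultimately have 2: "(\<integral>x. g (mob w x) \<partial>\<sigma>) = Re (poly p w)"
      using integral_bounded_linear[OF bounded_linear_Re, of \<sigma> "\<lambda>x. poly p (mob w x)"]
      by (simp add: g_def mob_def)
    have "\<bar>(\<integral>z. f z * poisson w z \<partial>\<sigma>) - (\<integral>z. g z * poisson w z \<partial>\<sigma>)\<bar> =
        \<bar>\<integral>z. (f z - g z) * poisson w z \<partial>\<sigma>\<bar>"
      by (simp add: left_diff_distrib i)
    also have "\<dots> \<le> (\<integral>z. e / 2 * poisson w z \<partial>\<sigma>)"
    proof (rule abs_integral_circle_le[OF i(5)])
      show "\<bar>(f x - g x) * poisson w x\<bar> \<le> e / 2 * poisson w x" if "x \<in> sphere 0 1" for x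
        unfolding abs_mult using p[OF that] poisson_nonneg[of w x] w
        using \<open>0 < e\<close> by (intro mult_mono) (auto simp: g_def)
    qed
    also have "\<dots> = e / 2" by (simp add: integral_poisson w)
    finally have 3: "\<bar>(\<integral>z. f z * poisson w z \<partial>\<sigma>) - (\<integral>z. g z * poisson w z \<partial>\<sigma>)\<bar> \<le> e / 2" .
    have "\<bar>(\<integral>x. f (mob w x) \<partial>\<sigma>) - (\<integral>x. g (mob w x) \<partial>\<sigma>)\<bar> =
        \<bar>\<integral>x. f (mob w x) - g (mob w x) \<partial>\<sigma>\<bar>"
      by (simp add: i)
    also have "\<dots> \<le> (\<integral>z. e / 2 \<partial>\<sigma>)"
    proof (rule abs_integral_circle_le)
      show "\<bar>f (mob w x) - g (mob w x)\<bar> \<le> e / 2" if "x \<in> sphere 0 1" for x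
        using p[of "mob w x"] mob_sphere[OF w, of x] that by (simp add: g_def)
    qed simp
    also have "\<dots> = e / 2" by simp
    finally show ?thesis using 1 2 3 by linarith
  qed
  then show ?thesis
    by (meson abs_le_zero_iff dense_ge eq_iff_diff_eq_0)
qed

text \<open>For fixed \<open>\<xi> \<noteq> - z\<close> the points \<open>r\<^sub>n * mob (r\<^sub>n * z) \<xi>\<close> stay in one Stolz angle at \<open>z\<close>; the change of
  variables therefore turns the non-tangential hypothesis into pointwise convergence.\<close>

lemma poisson_average_tendsto:
  fixes g :: "nat \<Rightarrow> complex \<Rightarrow> real" and r :: "nat \<Rightarrow> real"
  assumes z: "cmod z = 1" and r: "\<And>n. 0 \<le> r n" "\<And>n. r n < 1" "r \<longlonglongrightarrow> 1"
    and g: "\<And>n. continuous_on (sphere 0 1) (g n)"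
    and M: "\<And>n x. x \<in> sphere 0 1 \<Longrightarrow> \<bar>g n x\<bar> \<le> M"
    and lim: "\<And>\<alpha> x. 1 < \<alpha> \<Longrightarrow> (\<And>n. x n \<in> sphere 0 1) \<Longrightarrow> (\<And>n. of_real (r n) * x n \<in> stolz \<alpha> z) \<Longrightarrow>
        (\<lambda>n. g n (x n)) \<longlonglongrightarrow> L"
  shows "(\<lambda>n. \<integral>x. g n x * poisson (of_real (r n) * z) x \<partial>\<sigma>) \<longlonglongrightarrow> L"
proof -
  define w where "w n = of_real (r n) * z" for n
  have w: "cmod (w n) < 1" for n using r z by (simp add: w_def norm_mult)
  have "(\<lambda>n. \<integral>x. g n (mob (w n) x) \<partial>\<sigma>) \<longlonglongrightarrow> (\<integral>x. L \<partial>\<sigma>)"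
  proof (rule integral_dominated_convergence[where w = "\<lambda>_. M"])
    show "(\<lambda>x. g n (mob (w n) x)) \<in> borel_measurable \<sigma>" for n
      by (intro borel_measurable_circleI continuous_on_compose2[OF g])
         (use w in \<open>auto intro: continuous_on_subset[OF continuous_on_mob] simp: mob_sphere\<close>)
    show "AE x in \<sigma>. norm (g n (mob (w n) x)) \<le> M" for n
      by (intro AE_I2) (use M mob_sphere[OF w] in auto)
    have "(\<lambda>n. g n (mob (w n) x)) \<longlonglongrightarrow> L" if x: "x \<in> sphere 0 1" "x \<noteq> - z" for x
    proof -
      have nz: "1 + cnj z * x \<noteq> 0"
      proof
        assume "1 + cnj z * x = 0"
        then have "z * (1 + cnj z * x) = 0" by simp
        moreover have "z * (1 + cnj z * x) = z + (z * cnj z) * x" by (simp add: algebra_simps)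
        moreover have "z * cnj z = 1" using z by (simp add: mult_cnj_eq_1)
        ultimately show False using x by (simp add: eq_neg_iff_add_eq_0 add.commute)
      qed
      have nzw: "1 + cnj (w n) * x \<noteq> 0" for n using mob_denominator_nonzero[OF w] x by auto
      have "(\<lambda>n. 1 / cmod (1 + cnj (w n) * x)) \<longlonglongrightarrow> 1 / cmod (1 + cnj (of_real 1 * z) * x)"
        unfolding w_def using nz by (intro tendsto_intros r(3)) auto
      \<comment> \<open>The excluded point \<open>x = - z\<close> is the only one at which the limit
        of the denominators vanishes; elsewhere their reciprocals stay bounded. It depends on
        \<open>z\<close> alone and is null.\<close>
      then have "Bseq (\<lambda>n. 1 / cmod (1 + cnj (w n) * x))"
        by (intro convergent_imp_Bseq convergentI)
      then obtain B where B: "0 < B" "\<And>n. 1 / cmod (1 + cnj (w n) * x) \<le> B"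
        by (auto elim!: BseqE)
      \<comment> \<open>The aperture: \<open>|mob (w n) x - z|\<close> is at most
        \<open>2 * B * (1 - r n)\<close> because \<open>|x - z| \<le> 2\<close>, and pulling the
        point to radius \<open>r n\<close> costs another \<open>1 - r n\<close>. Taking
        \<open>2 + 2 * B\<close> instead of \<open>1 + 2 * B\<close> makes the inequality
        strict.\<close>
      have "of_real (r n) * mob (w n) x \<in> stolz (2 + 2 * B) z" for n
      proof -
        have m1: "cmod (mob (w n) x) = 1" using mob_sphere[OF w] x by auto
        have "mob (w n) x - z = ((x + w n) - z * (1 + cnj (w n) * x)) / (1 + cnj (w n) * x)"
          using nzw[of n] by (simp add: mob_def field_simps)
        also have "z * (1 + cnj (w n) * x) = z + of_real (r n) * ((z * cnj z) * x)"
          by (simp add: w_def algebra_simps)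
        also have "z * cnj z = 1" using z by (simp add: mult_cnj_eq_1)
        also have "x + w n - (z + of_real (r n) * (1 * x)) = of_real (1 - r n) * (x - z)"
          by (simp add: w_def algebra_simps)
        finally have "cmod (mob (w n) x - z) = cmod (of_real (1 - r n) * (x - z)) * (1 / cmod (1 + cnj (w n) * x))"
          by (simp add: norm_divide)
        also have "\<dots> \<le> ((1 - r n) * 2) * B"
        proof (intro mult_mono B)
          have "cmod (x - z) \<le> 2" using norm_triangle_ineq4[of x z] x z by simp
          then show "cmod (of_real (1 - r n) * (x - z)) \<le> (1 - r n) * 2"
            unfolding norm_mult norm_of_real using r(2)[of n] by (intro mult_mono) auto
        qed (use r(2)[of n] in auto)
        finally have 1: "cmod (mob (w n) x - z) \<le> 2 * B * (1 - r n)" by (simp add: algebra_simps)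
        have "of_real (r n) * mob (w n) x - z = (mob (w n) x - z) - of_real (1 - r n) * mob (w n) x"
          by (simp add: algebra_simps)
        then have "cmod (of_real (r n) * mob (w n) x - z) \<le> cmod (mob (w n) x - z) + cmod (of_real (1 - r n) * mob (w n) x)"
          by (metis norm_triangle_ineq4)
        also have "cmod (of_real (1 - r n) * mob (w n) x) = 1 - r n"
          unfolding norm_mult norm_of_real m1 using r(2)[of n] by simp
        finally have "cmod (of_real (r n) * mob (w n) x - z) \<le> (1 + 2 * B) * (1 - r n)"
          using 1 by (simp add: algebra_simps)
        also have "\<dots> < (2 + 2 * B) * (1 - r n)" using r(2)[of n] by (intro mult_strict_right_mono) auto
        finally show ?thesis using r(1)[of n] r(2)[of n] m1 by (simp add: stolz_def norm_mult)
      qed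
      then show ?thesis
        by (intro lim[of "2 + 2 * B"]) (use B mob_sphere[OF w] x in auto)
    qed
    then show "AE x in \<sigma>. (\<lambda>n. g n (mob (w n) x)) \<longlonglongrightarrow> L"
    proof -
      assume *: "\<And>x. x \<in> sphere 0 1 \<Longrightarrow> x \<noteq> - z \<Longrightarrow> (\<lambda>n. g n (mob (w n) x)) \<longlonglongrightarrow> L"
      show ?thesis
        using AE_circle_neq[of "- z"] AE_space[of \<sigma>]
        by eventually_elim (rule *, auto)
    qed
  qed auto
  then show ?thesis
    by (simp add: integral_poisson_mob[OF g w] flip: w_def)
qed

section \<open>Boundary uniqueness and non-extreme functions\<close>

text \<open>A continuous approximation from above to the indicator of a closed set. For empty
  \<open>K\<close> the convention \<open>infdist x {} = 0\<close> makes it constantly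
  \<open>1\<close>, hence the separate treatment of that case wherever \<open>j\<close> tends to
  infinity.\<close>

definition bump :: "'a::metric_space set \<Rightarrow> nat \<Rightarrow> 'a \<Rightarrow> real" where
  "bump K j x = max 0 (1 - real j * infdist x K)"

lemma continuous_on_bump [continuous_intros]: "continuous_on S (bump K j)"
  unfolding bump_def by (intro continuous_intros)

lemma bump_nonneg: "0 \<le> bump K j x"
  by (simp add: bump_def)

lemma bump_le_1: "bump K j x \<le> 1"
  by (simp add: bump_def infdist_nonneg)

lemma bump_eq_1: "x \<in> K \<Longrightarrow> bump K j x = 1"
  by (simp add: bump_def)

lemma bump_tendsto:
  assumes "closed K" "K \<noteq> {}"
  shows "(\<lambda>j. bump K j x) \<longlonglongrightarrow> indicator K x"
proof (cases "x \<in> K")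
  case True
  then show ?thesis by (simp add: bump_eq_1)
next
  case False
  then have d: "0 < infdist x K" using assms by (rule infdist_pos_not_in_closed[rotated 2])
  have "eventually (\<lambda>j. bump K j x = 0) sequentially"
  proof -
    obtain j0 where j0: "1 / infdist x K < real j0" using reals_Archimedean2 by blast
    have "bump K j x = 0" if "j \<ge> j0" for j
    proof -
      have "1 / infdist x K \<le> real j" using j0 that by linarith
      then have "1 \<le> real j * infdist x K" using d by (simp add: field_simps)
      then show ?thesis by (simp add: bump_def)
    qed
    then show ?thesis by (auto simp: eventually_sequentially)
  qed
  then show ?thesis using False by (simp add: tendsto_eventually)
qed

lemma bump_integral_tendsto:
  assumes K: "compact K" "K \<subseteq> sphere 0 1" "K \<noteq> {}"
  shows "(\<lambda>j. \<integral>x. bump K j x \<partial>\<sigma>) \<longlonglongrightarrow> measure \<sigma> K"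
proof -
  have Ks: "K \<in> sets \<sigma>"
    using K by (auto simp: sets_circle_iff intro: borel_closed compact_imp_closed)
  have "(\<lambda>j. \<integral>x. bump K j x \<partial>\<sigma>) \<longlonglongrightarrow> (\<integral>x. indicator K x \<partial>\<sigma>)"
  proof (rule integral_dominated_convergence[where w = "\<lambda>_. 1"])
    show "AE x in \<sigma>. (\<lambda>j. bump K j x) \<longlonglongrightarrow> indicator K x"
      using K by (intro AE_I2 bump_tendsto compact_imp_closed)
    show "bump K j \<in> borel_measurable \<sigma>" for j
      by (intro borel_measurable_circleI continuous_intros)
    show "indicat_real K \<in> borel_measurable \<sigma>"
      using Ks by simp
    show "AE x in \<sigma>. norm (bump K j x) \<le> 1" for j
      by (intro AE_I2) (simp add: bump_nonneg bump_le_1)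
  qed simp
  then show ?thesis using K(2) by (simp add: Int_absorb2)
qed

lemma dilate_in_ball:
  assumes "0 \<le> r" "r < 1" "cmod z \<le> 1"
  shows "complex_of_real r * z \<in> ball 0 1"
proof -
  have "r * cmod z \<le> r * 1" using assms by (intro mult_left_mono) auto
  then show ?thesis using assms by (simp add: norm_mult)
qed

lemma continuous_on_dilate:
  assumes "u holomorphic_on ball 0 1" "0 \<le> r" "r < 1"
  shows "continuous_on (cball 0 1) (\<lambda>z. u (of_real r * z))"
  by (rule continuous_on_compose2[OF holomorphic_on_imp_continuous_on[OF assms(1)]])
     (use dilate_in_ball[OF assms(2,3)] in \<open>auto intro!: continuous_intros\<close>)

lemma holomorphic_on_dilate:
  assumes "u holomorphic_on ball 0 1" "0 \<le> r" "r < 1"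
  shows "(\<lambda>z. u (of_real r * z)) holomorphic_on ball 0 1"
  by (rule holomorphic_on_compose_gen[OF _ assms(1), unfolded o_def])
     (use dilate_in_ball[OF assms(2,3)] in \<open>auto intro!: holomorphic_intros\<close>)

lemma exp_le_convex_bound:
  fixes a t :: real
  assumes "0 \<le> t" "t \<le> 1"
  shows "exp (a * t) \<le> (1 - t) + t * exp a"
  using convex_onD[OF exp_convex, of t 0 a] assms by (simp add: mult.commute)

text \<open>A zero-free exponential that is large near \<open>K\<close> makes the means of \<open>u\<close> outside \<open>K\<close> negligible;
  this replaces the logarithmic integrability of boundary functions.\<close>

lemma vanishing_means_imp_zero:
  fixes r :: "nat \<Rightarrow> real"
  assumes u: "u holomorphic_on ball 0 1" and M: "\<And>z. z \<in> ball 0 1 \<Longrightarrow> cmod (u z) \<le> M"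
    and K: "compact K" "K \<subseteq> sphere 0 1" and pos: "0 < measure \<sigma> K"
    and r: "\<And>n. 0 \<le> r n" "\<And>n. r n < 1" "r \<longlonglongrightarrow> 1"
    and lim: "(\<lambda>n. \<integral>x. indicator K x * cmod (u (of_real (r n) * x)) \<partial>\<sigma>) \<longlonglongrightarrow> 0"
    and w: "cmod w < 1"
  shows "u w = 0"
proof -
  have K0: "K \<noteq> {}" using pos by auto
  have [simp]: "K \<inter> sphere 0 1 = K" using K by auto
  have Ks: "K \<in> sets \<sigma>"
    using K by (auto simp: sets_circle_iff intro: borel_closed compact_imp_closed)
  have M0: "0 \<le> M" using M[of 0] by (auto intro: order_trans[OF norm_ge_zero])
  \<comment> \<open>Bounds for \<open>poisson w\<close> on the circle, below by \<open>c\<close> and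
    above by \<open>Q\<close>, from \<open>1 - |w| \<le> |1 - cnj w * x| \<le> 2\<close>.\<close>
  define c where "c = (1 - (cmod w)\<^sup>2) / 4"
  define Q where "Q = 1 / (1 - cmod w)\<^sup>2"
  have w2: "(cmod w)\<^sup>2 < 1" using w by (simp add: abs_square_less_1)
  have c: "0 < c" using w2 by (simp add: c_def)
  have Q: "0 < Q" using w by (simp add: Q_def)
  have Pc: "c \<le> poisson w x" if "x \<in> sphere 0 1" for x
  proof -
    have "cmod (1 - cnj w * x) \<le> cmod 1 + cmod (cnj w * x)" by (rule norm_triangle_ineq4)
    also have "\<dots> \<le> 2" using w that by (simp add: norm_mult)
    finally have "(cmod (1 - cnj w * x))\<^sup>2 \<le> 2\<^sup>2" by (intro power_mono) auto
    moreover have "0 < (cmod (1 - cnj w * x))\<^sup>2" using szego_denominator_nonzero[of w x] w that by simp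
    ultimately have "1 / 4 \<le> 1 / (cmod (1 - cnj w * x))\<^sup>2" by (intro divide_left_mono) auto
    then have "(1 - (cmod w)\<^sup>2) * (1 / 4) \<le> (1 - (cmod w)\<^sup>2) * (1 / (cmod (1 - cnj w * x))\<^sup>2)"
      using w2 by (intro mult_left_mono) auto
    then show ?thesis by (simp add: c_def poisson_def szego_def norm_divide power_divide)
  qed
  have PQ: "poisson w x \<le> Q" if "x \<in> sphere 0 1" for x
  proof -
    have "1 - cmod w \<le> cmod (1 - cnj w * x)"
      using norm_triangle_ineq2[of 1 "cnj w * x"] that by (simp add: norm_mult)
    then have "(1 - cmod w)\<^sup>2 \<le> (cmod (1 - cnj w * x))\<^sup>2" using w by (intro power_mono) auto
    then have "1 / (cmod (1 - cnj w * x))\<^sup>2 \<le> Q" unfolding Q_def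
      using w szego_denominator_nonzero[of w x] that by (intro divide_left_mono) auto
    then have "(1 - (cmod w)\<^sup>2) * (1 / (cmod (1 - cnj w * x))\<^sup>2) \<le> 1 * Q"
      using w2 by (intro mult_mono) auto
    then show ?thesis by (simp add: poisson_def szego_def norm_divide power_divide)
  qed
  \<comment> \<open>The left side grows exponentially in \<open>N\<close> unless
    \<open>u w = 0\<close>, while the right side does not depend on \<open>N\<close>. The choices of
    \<open>j\<close> and \<open>p\<close> are made for fixed \<open>N\<close>, before
    \<open>n\<close> tends to infinity.\<close>
  have main: "cmod (u w) * exp (N * (c * measure \<sigma> K)) \<le> 2 * exp 2 * Q * M" if N: "N \<ge> 1" for N :: nat
  proof -
    \<comment> \<open>The excess of the bump over the indicator of \<open>K\<close> is made at most
      \<open>exp (- N)\<close> in mean, so that it stays bounded after multiplication by the factor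
      \<open>exp N\<close> below.\<close>
    have "\<exists>j. \<bar>(\<integral>x. bump K j x \<partial>\<sigma>) - measure \<sigma> K\<bar> < exp (- real N)"
      using LIMSEQ_D[OF bump_integral_tendsto[OF K K0], of "exp (- real N)"] by auto
    then obtain j where j: "\<bar>(\<integral>x. bump K j x \<partial>\<sigma>) - measure \<sigma> K\<bar> < exp (- real N)" ..
    define f where "f = bump K j"
    have f: "continuous_on S f" "0 \<le> f x" "f x \<le> 1" "x \<in> K \<Longrightarrow> f x = 1" for x S
      by (auto simp: f_def bump_nonneg bump_le_1 bump_eq_1 intro: continuous_intros)
    have fi: "integrable \<sigma> f" by (intro integrable_circleI f)
    have iK: "integrable \<sigma> (indicat_real K)"
      by (intro integrable_real_indicator Ks) (simp add: circle.emeasure_finite less_top[symmetric])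
    have fK: "(\<integral>x. f x - indicator K x \<partial>\<sigma>) \<le> exp (- real N)"
      using j Ks fi iK by (simp add: f_def)
    \<comment> \<open>Precision \<open>1 / N\<close> keeps \<open>N * Re (poly p x)\<close> within
      \<open>1\<close> of \<open>N * f x\<close>. This costs one factor \<open>exp 1\<close> on the
      circle and another one at \<open>w\<close>, which together are the \<open>exp 2\<close> of
      \<open>main\<close>.\<close>
    obtain p where p: "\<And>x. x \<in> sphere 0 1 \<Longrightarrow> \<bar>f x - Re (poly p x)\<bar> < 1 / N"
      using circle_Re_poly_dense[OF f(1), of "1 / N"] N by auto
    have pi: "integrable \<sigma> (\<lambda>z. poly p z * of_real (poisson w z))"
      by (intro integrable_circleI continuous_intros continuous_on_poisson w)
    have pw: "poly p w = (\<integral>z. poly p z * of_real (poisson w z) \<partial>\<sigma>)"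
      by (rule circle_Poisson_integral[symmetric]) (use w in \<open>auto intro!: continuous_intros holomorphic_intros\<close>)
    have pI: "integrable \<sigma> (poisson w)"
      by (intro integrable_circleI continuous_on_poisson w)
    have "c * measure \<sigma> K = (\<integral>x. c * indicator K x \<partial>\<sigma>)"
      using Ks by simp
    also have "\<dots> \<le> (\<integral>x. f x * poisson w x \<partial>\<sigma>)"
    proof (intro Bochner_Integration.integral_mono)
      show "integrable \<sigma> (\<lambda>x. f x * poisson w x)"
        by (intro integrable_circleI continuous_intros continuous_on_poisson w f)
      show "c * indicator K x \<le> f x * poisson w x" if "x \<in> space \<sigma>" for x
        using Pc[of x] that c f(2)[of x] f(4)[of x] poisson_nonneg[of w x] w
        by (auto simp: indicator_def)
    qed (use iK in simp)
    also have "\<dots> \<le> (\<integral>x. Re (poly p x * of_real (poisson w x)) + poisson w x / N \<partial>\<sigma>)"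
    proof (intro Bochner_Integration.integral_mono)
      show "integrable \<sigma> (\<lambda>x. f x * poisson w x)"
        by (intro integrable_circleI continuous_intros continuous_on_poisson w f)
      show "f x * poisson w x \<le> Re (poly p x * of_real (poisson w x)) + poisson w x / N"
        if "x \<in> space \<sigma>" for x
      proof -
        have "f x \<le> Re (poly p x) + 1 / N" using p[of x] that by (simp add: abs_less_iff)
        then have "f x * poisson w x \<le> (Re (poly p x) + 1 / N) * poisson w x"
          using w by (intro mult_right_mono poisson_nonneg) auto
        then show ?thesis by (simp add: algebra_simps)
      qed
    qed (intro Bochner_Integration.integrable_add integrable_divide integrable_Re pi pI)
    also have "\<dots> = Re (poly p w) + 1 / N"
    proof -
      have "(\<integral>x. Re (poly p x * of_real (poisson w x)) + poisson w x / N \<partial>\<sigma>) =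
          (\<integral>x. Re (poly p x * of_real (poisson w x)) \<partial>\<sigma>) + (\<integral>x. poisson w x / N \<partial>\<sigma>)"
        by (intro Bochner_Integration.integral_add integrable_divide integrable_Re pi pI)
      also have "(\<integral>x. Re (poly p x * of_real (poisson w x)) \<partial>\<sigma>) = Re (poly p w)"
        unfolding pw by (rule integral_bounded_linear[OF bounded_linear_Re pi])
      finally show ?thesis by (simp add: integral_poisson w)
    qed
    finally have "N * (c * measure \<sigma> K) \<le> N * (Re (poly p w) + 1 / N)"
      by (intro mult_left_mono) auto
    then have low: "N * (c * measure \<sigma> K) \<le> N * Re (poly p w) + 1"
      using N by (simp add: algebra_simps)
    have step: "cmod (u (of_real (r n) * w)) * exp (N * Re (poly p w)) \<le>
      exp 1 * Q * (exp N * (\<integral>x. indicator K x * cmod (u (of_real (r n) * x)) \<partial>\<sigma>) + 2 * M)" for n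
    proof -
      \<comment> \<open>The exponential factor has modulus \<open>exp (N * Re (poly p z))\<close>,
        which is about \<open>exp N\<close> on \<open>K\<close> and about \<open>1\<close> well away
        from it on the circle. Analyticity is kept, so the Poisson formula at \<open>w\<close>
        applies to the product.\<close>
      define v where "v z = u (of_real (r n) * z) * exp (of_nat N * poly p z)" for z
      have vc: "continuous_on (cball 0 1) v" unfolding v_def
        by (intro continuous_intros continuous_on_dilate u r)
      have vh: "v holomorphic_on ball 0 1" unfolding v_def
        by (intro holomorphic_intros holomorphic_on_dilate u r)
      have uc: "continuous_on (sphere 0 1) (\<lambda>x. u (of_real (r n) * x))"
        by (rule continuous_on_subset[OF continuous_on_dilate[OF u r(1,2)]]) auto
      have iKu: "integrable \<sigma> (\<lambda>x. indicator K x * cmod (u (of_real (r n) * x)))"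
        using integrable_mult_indicator[OF Ks, of "\<lambda>x. cmod (u (of_real (r n) * x))"]
        by (simp add: integrable_circleI[OF continuous_on_norm[OF uc]])
      have "cmod (v w) = cmod (\<integral>z. v z * of_real (poisson w z) \<partial>\<sigma>)"
        by (simp add: circle_Poisson_integral[OF vc vh w])
      also have "\<dots> \<le> (\<integral>z. cmod (v z * of_real (poisson w z)) \<partial>\<sigma>)"
        by (rule integral_norm_bound)
      also have "\<dots> \<le> (\<integral>x. exp 1 * Q * (exp N * (indicator K x * cmod (u (of_real (r n) * x)))
          + M * (1 + exp N * (f x - indicator K x))) \<partial>\<sigma>)"
      proof (intro Bochner_Integration.integral_mono)
        show "integrable \<sigma> (\<lambda>z. cmod (v z * of_real (poisson w z)))"
          by (intro integrable_circleI continuous_intros continuous_on_poisson w continuous_on_subset[OF vc]) auto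
        show "cmod (v x * of_real (poisson w x)) \<le> exp 1 * Q * (exp N * (indicator K x * cmod (u (of_real (r n) * x)))
          + M * (1 + exp N * (f x - indicator K x)))" if "x \<in> space \<sigma>" for x
        proof -
          have x: "x \<in> sphere 0 1" using that by simp
          have uM: "cmod (u (of_real (r n) * x)) \<le> M"
            using x by (intro M dilate_in_ball r) auto
          have "Re (poly p x) \<le> f x + 1 / N" using p[OF x] by (simp add: abs_less_iff)
          then have "N * Re (poly p x) \<le> N * (f x + 1 / N)" by (intro mult_left_mono) auto
          also have "\<dots> = 1 + N * f x" using N by (simp add: algebra_simps)
          finally have "exp (N * Re (poly p x)) \<le> exp 1 * exp (N * f x)"
            by (simp flip: exp_add)
          then have e: "cmod (exp (of_nat N * poly p x)) \<le> exp 1 * exp (N * f x)" by simp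
          \<comment> \<open>On \<open>K\<close> the factor \<open>exp N\<close> meets the means that
            tend to \<open>0\<close>. Off \<open>K\<close> the chord bound
            \<open>exp (N * f x) \<le> 1 + exp N * f x\<close> makes the estimate linear in
            \<open>f\<close>, so that only the mean of \<open>f\<close> off \<open>K\<close>
            matters.\<close>
          have "cmod (u (of_real (r n) * x)) * exp (N * f x) \<le>
            exp N * (indicator K x * cmod (u (of_real (r n) * x))) + M * (1 + exp N * (f x - indicator K x))"
          proof (cases "x \<in> K")
            case True
            then show ?thesis using M0 f(4)[OF True] by simp
          next
            case False
            have "exp (N * f x) \<le> 1 + exp N * f x"
              using exp_le_convex_bound[of "f x" "real N"] f(2,3)[of x] by (simp add: mult.commute)
            then have "cmod (u (of_real (r n) * x)) * exp (N * f x) \<le> M * (1 + exp N * f x)"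
              using uM M0 by (intro mult_mono) auto
            then show ?thesis using False by simp
          qed
          then have "exp 1 * Q * (cmod (u (of_real (r n) * x)) * exp (N * f x)) \<le> exp 1 * Q *
            (exp N * (indicator K x * cmod (u (of_real (r n) * x))) + M * (1 + exp N * (f x - indicator K x)))"
            using Q by (intro mult_left_mono) auto
          moreover have "cmod (v x * of_real (poisson w x)) \<le> (cmod (u (of_real (r n) * x)) * (exp 1 * exp (N * f x))) * Q"
            unfolding v_def norm_mult norm_of_real
            using e PQ[OF x] poisson_nonneg[of w x] w
            by (intro mult_mono order_refl) auto
          ultimately show ?thesis by (simp add: algebra_simps)
        qed
      qed (use iKu fi iK in simp)
      also have "\<dots> = exp 1 * Q * (exp N * (\<integral>x. indicator K x * cmod (u (of_real (r n) * x)) \<partial>\<sigma>)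
          + M * (1 + exp N * (\<integral>x. f x - indicator K x \<partial>\<sigma>)))"
        using iKu fi iK by simp
      also have "\<dots> \<le> exp 1 * Q * (exp N * (\<integral>x. indicator K x * cmod (u (of_real (r n) * x)) \<partial>\<sigma>)
          + M * (1 + exp N * exp (- real N)))"
        using Q M0 fK by (intro mult_left_mono add_left_mono) auto
      also have "exp N * exp (- real N) = 1" by (simp flip: exp_add)
      finally show ?thesis by (simp add: v_def norm_mult mult.commute)
    qed
    have "(\<lambda>n. u (of_real (r n) * w)) \<longlonglongrightarrow> u (of_real 1 * w)"
    proof (rule isCont_tendsto_compose[where g = u])
      show "isCont u (of_real 1 * w)"
        using holomorphic_on_imp_continuous_on[OF u] w by (simp add: continuous_on_eq_continuous_at)
    qed (intro tendsto_intros r)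
    then have "(\<lambda>n. cmod (u (of_real (r n) * w)) * exp (N * Re (poly p w))) \<longlonglongrightarrow> cmod (u (of_real 1 * w)) * exp (N * Re (poly p w))"
      by (intro tendsto_intros)
    moreover have "(\<lambda>n. exp 1 * Q * (exp N * (\<integral>x. indicator K x * cmod (u (of_real (r n) * x)) \<partial>\<sigma>) + 2 * M))
      \<longlonglongrightarrow> exp 1 * Q * (exp N * 0 + 2 * M)"
      by (intro tendsto_intros lim)
    ultimately have "cmod (u (of_real 1 * w)) * exp (N * Re (poly p w)) \<le> exp 1 * Q * (exp N * 0 + 2 * M)"
      by (rule LIMSEQ_le) (use step in blast)
    then have 1: "cmod (u w) * exp (N * Re (poly p w)) \<le> exp 1 * (Q * 2 * M)" by simp
    have "cmod (u w) * exp (N * (c * measure \<sigma> K)) \<le> cmod (u w) * exp (N * Re (poly p w) + 1)"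
      using low by (intro mult_left_mono) auto
    also have "\<dots> = exp 1 * (cmod (u w) * exp (N * Re (poly p w)))" by (simp add: exp_add)
    also have "\<dots> \<le> exp 1 * (exp 1 * (Q * 2 * M))" using 1 by (intro mult_left_mono) auto
    also have "\<dots> = 2 * exp 2 * Q * M" using exp_add[of 1 "1::real"] by simp
    finally show ?thesis .
  qed
  show ?thesis
  proof (rule ccontr)
    assume "u w \<noteq> 0"
    then have uw: "0 < cmod (u w)" by simp
    define d where "d = c * measure \<sigma> K"
    have d: "0 < d" using c pos by (simp add: d_def)
    \<comment> \<open>Since \<open>exp x > x\<close>, it is enough that \<open>N * d\<close> exceeds
      the bound of \<open>main\<close> divided by \<open>|u w|\<close>.\<close>
    obtain N :: nat where N: "2 * exp 2 * Q * M / cmod (u w) / d < N"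
      using reals_Archimedean2 by blast
    have N1: "N \<ge> 1"
    proof (rule ccontr)
      assume "\<not> N \<ge> 1"
      then have "N = 0" by simp
      moreover have "0 \<le> 2 * exp 2 * Q * M / cmod (u w) / d" using Q M0 d by simp
      ultimately show False using N by simp
    qed
    have "2 * exp 2 * Q * M / cmod (u w) < N * d" using N by (simp only: pos_divide_less_eq[OF d])
    also have "\<dots> \<le> exp (N * d)" using exp_ge_add_one_self[of "N * d"] by linarith
    finally have "2 * exp 2 * Q * M < cmod (u w) * exp (N * d)" using uw by (simp add: field_simps)
    then show False using main[OF N1] by (simp add: d_def)
  qed
qed

text \<open>Quantitative strict convexity of the squared modulus: the left-hand side is exactly the
  difference between \<open>(1 - t) * |a|^2 + t * |b|^2\<close>, which is at most \<open>1\<close>,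
  and the squared modulus of the combination.\<close>

lemma convex_combination_norm_gap:
  assumes "0 < t" "t < 1" "cmod a \<le> 1" "cmod b \<le> 1"
  shows "t * (1 - t) * (cmod (a - b))\<^sup>2 \<le> 1 - (cmod (of_real (1 - t) * a + of_real t * b))\<^sup>2"
proof -
  have "(cmod (of_real (1 - t) * a + of_real t * b))\<^sup>2 =
      (1 - t) * (cmod a)\<^sup>2 + t * (cmod b)\<^sup>2 - t * (1 - t) * (cmod (a - b))\<^sup>2"
    unfolding cmod_power2 by (simp add: power2_eq_square algebra_simps)
  moreover have "(1 - t) * (cmod a)\<^sup>2 + t * (cmod b)\<^sup>2 \<le> (1 - t) * 1 + t * 1"
    using assms by (intro add_mono mult_left_mono) (auto simp: power_le_one)
  ultimately show ?thesis by simp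
qed

text \<open>If \<open>b\<close> is a proper convex combination of \<open>f\<close> and
  \<open>g\<close>, then \<open>1 - |b|^2\<close> dominates \<open>t * (1 - t) * |f - g|^2\<close>
  in the disk, so vanishing means of the former over \<open>K\<close> pass to
  \<open>(f - g)^2\<close>. The radii are left arbitrary because the application supplies a
  subsequence.\<close>

lemma Hinf_nonextreme_defect:
  fixes r :: "nat \<Rightarrow> real"
  assumes b: "Hinf_nonextreme b"
    and K: "compact K" "K \<subseteq> sphere 0 1" and pos: "0 < measure \<sigma> K"
    and r: "\<And>n. 0 \<le> r n" "\<And>n. r n < 1" "r \<longlonglongrightarrow> 1"
    and lim: "(\<lambda>n. \<integral>x. indicator K x * (1 - (cmod (b (of_real (r n) * x)))\<^sup>2) \<partial>\<sigma>) \<longlonglongrightarrow> 0"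
  shows False
proof -
  obtain f g t z where f: "f \<in> Hinf_ball" and g: "g \<in> Hinf_ball" and t: "0 < t" "t < (1::real)"
    and bfg: "\<And>z. z \<in> ball 0 1 \<Longrightarrow> b z = of_real (1 - t) * f z + of_real t * g z"
    and z: "z \<in> ball 0 1" "f z \<noteq> g z"
    using b unfolding Hinf_nonextreme_def Hinf_extreme_def by blast
  have bh: "b holomorphic_on ball 0 1" using b by (auto simp: Hinf_nonextreme_def Hinf_ball_def)
  \<comment> \<open>The square is holomorphic and its modulus is exactly \<open>|f - g|^2\<close>,
    the quantity controlled by the defect of \<open>b\<close>.\<close>
  define u where "u x = (f x - g x)\<^sup>2" for x
  have uh: "u holomorphic_on ball 0 1"
    using f g unfolding u_def by (intro holomorphic_intros) (auto simp: Hinf_ball_def)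
  have ub: "t * (1 - t) * cmod (u x) \<le> 1 - (cmod (b x))\<^sup>2" if "x \<in> ball 0 1" for x
    using convex_combination_norm_gap[OF t, of "f x" "g x"] f g that bfg[OF that]
    by (auto simp: Hinf_ball_def u_def norm_power)
  have uM: "cmod (u x) \<le> 1 / (t * (1 - t))" if "x \<in> ball 0 1" for x
  proof -
    have "t * (1 - t) * cmod (u x) \<le> 1" using ub[OF that] zero_le_power2[of "cmod (b x)"] by linarith
    then show ?thesis using t by (simp add: field_simps)
  qed
  have Ks: "K \<in> sets \<sigma>"
    using K by (auto simp: sets_circle_iff intro: borel_closed compact_imp_closed)
  have I: "integrable \<sigma> (\<lambda>x. indicator K x * G x)" if "continuous_on (sphere 0 1) G" for G :: "complex \<Rightarrow> real"
    using integrable_mult_indicator[OF Ks integrable_circleI[OF that]] by simp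
  have dc: "continuous_on (sphere 0 1) (\<lambda>x. h (of_real (r n) * x))" if "h holomorphic_on ball 0 1" for h n
    by (rule continuous_on_subset[OF continuous_on_dilate[OF that r(1,2)]]) auto
  have "u z = 0"
  proof (rule vanishing_means_imp_zero[OF uh uM K pos r])
    show "(\<lambda>n. \<integral>x. indicator K x * cmod (u (of_real (r n) * x)) \<partial>\<sigma>) \<longlonglongrightarrow> 0"
    proof (rule real_tendsto_sandwich)
      show "\<forall>\<^sub>F n in sequentially. 0 \<le> (\<integral>x. indicator K x * cmod (u (of_real (r n) * x)) \<partial>\<sigma>)"
        by (intro always_eventually allI Bochner_Integration.integral_nonneg) auto
      show "\<forall>\<^sub>F n in sequentially. (\<integral>x. indicator K x * cmod (u (of_real (r n) * x)) \<partial>\<sigma>) \<le>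
        (1 / (t * (1 - t))) * (\<integral>x. indicator K x * (1 - (cmod (b (of_real (r n) * x)))\<^sup>2) \<partial>\<sigma>)"
      proof (intro always_eventually allI)
        fix n
        have "(\<integral>x. indicator K x * cmod (u (of_real (r n) * x)) \<partial>\<sigma>) \<le>
          (\<integral>x. (1 / (t * (1 - t))) * (indicator K x * (1 - (cmod (b (of_real (r n) * x)))\<^sup>2)) \<partial>\<sigma>)"
        proof (intro Bochner_Integration.integral_mono integrable_mult_right I continuous_intros dc uh bh)
          fix x assume "x \<in> space \<sigma>"
          then have "t * (1 - t) * cmod (u (of_real (r n) * x)) \<le> 1 - (cmod (b (of_real (r n) * x)))\<^sup>2"
            by (intro ub dilate_in_ball r) auto
          then have "cmod (u (of_real (r n) * x)) \<le> (1 / (t * (1 - t))) * (1 - (cmod (b (of_real (r n) * x)))\<^sup>2)"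
            using t by (simp add: field_simps)
          then show "indicat_real K x * cmod (u (of_real (r n) * x)) \<le> (1 / (t * (1 - t))) * (indicator K x * (1 - (cmod (b (of_real (r n) * x)))\<^sup>2))"
            by (auto simp: indicator_def)
        qed
        then show "(\<integral>x. indicator K x * cmod (u (of_real (r n) * x)) \<partial>\<sigma>) \<le>
          (1 / (t * (1 - t))) * (\<integral>x. indicator K x * (1 - (cmod (b (of_real (r n) * x)))\<^sup>2) \<partial>\<sigma>)"
          by simp
      qed
      show "(\<lambda>n. (1 / (t * (1 - t))) * (\<integral>x. indicator K x * (1 - (cmod (b (of_real (r n) * x)))\<^sup>2) \<partial>\<sigma>)) \<longlonglongrightarrow> 0"
        using tendsto_mult_left[OF lim, of "1 / (t * (1 - t))"] by simp
    qed simp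
  qed (use z in auto)
  then show False using z by (simp add: u_def)
qed

section \<open>Non-tangential limits\<close>

lemma stolz_mono: "\<alpha> \<le> \<beta> \<Longrightarrow> stolz \<alpha> \<zeta> \<subseteq> stolz \<beta> \<zeta>"
  unfolding stolz_def
  by (auto elim!: order_less_le_trans intro!: mult_right_mono)

text \<open>Stolz regions grow with the aperture, so countably many apertures suffice; the shift by
  \<open>2\<close> keeps all of them above \<open>1\<close>.\<close>

lemma has_nt_limit_nat:
  "has_nt_limit f \<zeta> L \<longleftrightarrow> (\<forall>k::nat. (f \<longlongrightarrow> L) (at \<zeta> within stolz (2 + real k) \<zeta>))"
proof
  assume *: "\<forall>k::nat. (f \<longlongrightarrow> L) (at \<zeta> within stolz (2 + real k) \<zeta>)"
  show "has_nt_limit f \<zeta> L"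
    unfolding has_nt_limit_def
  proof (intro allI impI)
    fix \<alpha> :: real
    obtain k :: nat where "\<alpha> < k" using reals_Archimedean2 by blast
    then have "stolz \<alpha> \<zeta> \<subseteq> stolz (2 + real k) \<zeta>" by (intro stolz_mono) simp
    then show "(f \<longlongrightarrow> L) (at \<zeta> within stolz \<alpha> \<zeta>)"
      by (rule tendsto_within_subset[OF spec[OF *, of k]])
  qed
qed (auto simp: has_nt_limit_def)

text \<open>Failure of the Cauchy criterion at a given scale is an open condition on \<open>\<zeta>\<close>; this is why the set
  of points with a non-tangential limit is Borel.\<close>

definition nt_osc :: "(complex \<Rightarrow> complex) \<Rightarrow> nat \<Rightarrow> nat \<Rightarrow> nat \<Rightarrow> complex set" where
  "nt_osc f k i j = {\<zeta>. \<exists>z z'. z \<in> stolz (2 + real k) \<zeta> \<and> z' \<in> stolz (2 + real k) \<zeta> \<and>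
      dist z \<zeta> < 1 / Suc j \<and> dist z' \<zeta> < 1 / Suc j \<and> 1 / Suc i < dist (f z) (f z')}"

text \<open>For fixed \<open>z\<close> and \<open>z'\<close> the point \<zeta> enters only through
  strict inequalities between continuous functions, and a union of open sets over any family of
  pairs is open.\<close>

lemma open_nt_osc: "open (nt_osc f k i j)"
proof -
  have o: "open {\<zeta>. z \<in> stolz (2 + real k) \<zeta>}" for z
    by (cases "z \<in> ball 0 1") (auto simp: stolz_def intro!: open_Collect_less continuous_intros)
  have d: "open {\<zeta>. dist z \<zeta> < 1 / Suc j}" for z
    by (intro open_Collect_less continuous_intros)
  have "nt_osc f k i j = (\<Union>(z, z') \<in> {(z, z'). 1 / Suc i < dist (f z) (f z')}.
      {\<zeta>. z \<in> stolz (2 + real k) \<zeta>} \<inter> {\<zeta>. z' \<in> stolz (2 + real k) \<zeta>} \<inter> {\<zeta>. dist z \<zeta> < 1 / Suc j} \<inter> {\<zeta>. dist z' \<zeta> < 1 / Suc j})"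
    unfolding nt_osc_def by auto
  also have "open \<dots>" unfolding case_prod_unfold by (intro open_UN ballI open_Int o d)
  finally show ?thesis .
qed

definition nt_points :: "(complex \<Rightarrow> complex) \<Rightarrow> complex set" where
  "nt_points f = {\<zeta> \<in> sphere 0 1. \<exists>L. has_nt_limit f \<zeta> L}"

lemma nt_radial_seq:
  assumes "cmod \<zeta> = 1"
  shows "of_real (1 - 1 / Suc (Suc n)) * \<zeta> \<in> stolz (2 + real k) \<zeta>"
    and "of_real (1 - 1 / Suc (Suc n)) * \<zeta> \<noteq> \<zeta>"
    and "dist (of_real (1 - 1 / Suc (Suc n)) * \<zeta>) \<zeta> = 1 / Suc (Suc n)"
proof -
  define e where "e = 1 / real (Suc (Suc n))"
  have e: "0 < e" "e < 1" by (auto simp: e_def)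
  have "of_real (1 - e) * \<zeta> - \<zeta> = - of_real e * \<zeta>" by (simp add: algebra_simps)
  then have d: "cmod (of_real (1 - e) * \<zeta> - \<zeta>) = e" using assms e by (simp add: norm_mult)
  have n: "cmod (of_real (1 - e) * \<zeta>) = 1 - e" using assms e unfolding norm_mult norm_of_real by simp
  have "e < (2 + real k) * (1 - (1 - e))" using e by (simp add: algebra_simps add_pos_nonneg)
  then show "of_real (1 - 1 / Suc (Suc n)) * \<zeta> \<in> stolz (2 + real k) \<zeta>"
    using d n e unfolding stolz_def e_def[symmetric] mem_Collect_eq d n by (simp add: n[simplified])
  show "of_real (1 - 1 / Suc (Suc n)) * \<zeta> \<noteq> \<zeta>" using d e unfolding e_def[symmetric] by auto
  show "dist (of_real (1 - 1 / Suc (Suc n)) * \<zeta>) \<zeta> = 1 / Suc (Suc n)"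
    using d unfolding e_def[symmetric] dist_norm .
qed

lemma nt_radial_filterlim:
  assumes "cmod \<zeta> = 1"
  shows "filterlim (\<lambda>n. of_real (1 - 1 / Suc (Suc n)) * \<zeta>) (at \<zeta> within stolz (2 + real k) \<zeta>) sequentially"
  unfolding filterlim_at
proof (intro conjI)
  have "(\<lambda>n. 1 / real (Suc (Suc n))) \<longlonglongrightarrow> 0"
    using LIMSEQ_Suc[OF LIMSEQ_Suc[OF lim_inverse_n']] by (simp add: inverse_eq_divide)
  then have "(\<lambda>n. of_real (1 - 1 / Suc (Suc n)) * \<zeta>) \<longlonglongrightarrow> of_real (1 - 0) * \<zeta>"
    by (intro tendsto_intros)
  then show "((\<lambda>n. of_real (1 - 1 / Suc (Suc n)) * \<zeta>) \<longlongrightarrow> \<zeta>) sequentially" by simp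
qed (use nt_radial_seq[OF assms] in auto)

lemma nt_points_eq:
  "nt_points f = {\<zeta> \<in> sphere 0 1. \<forall>k i. \<exists>j. \<zeta> \<notin> nt_osc f k i j}"
proof (intro set_eqI iffI)
  fix \<zeta> assume z: "\<zeta> \<in> nt_points f"
  then obtain L where L: "has_nt_limit f \<zeta> L" and \<zeta>: "\<zeta> \<in> sphere 0 1" by (auto simp: nt_points_def)
  have "\<exists>j. \<zeta> \<notin> nt_osc f k i j" for k i
  proof -
    have "(f \<longlongrightarrow> L) (at \<zeta> within stolz (2 + real k) \<zeta>)" using L by (simp add: has_nt_limit_nat)
    then obtain d where d: "0 < d" "\<And>x. x \<in> stolz (2 + real k) \<zeta> \<Longrightarrow> x \<noteq> \<zeta> \<Longrightarrow> dist x \<zeta> < d \<Longrightarrow> dist (f x) L < 1 / Suc i / 2"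
      unfolding Lim_within by (metis dist_pos_lt half_gt_zero zero_less_divide_1_iff of_nat_0_less_iff zero_less_Suc dist_eq_0_iff)
    obtain j where j: "1 / Suc j < d" using nat_approx_posE[OF d(1)] by blast
    have ne: "x \<noteq> \<zeta>" if "x \<in> stolz (2 + real k) \<zeta>" for x using that \<zeta> by (auto simp: stolz_def)
    have "\<zeta> \<notin> nt_osc f k i j"
    proof
      assume "\<zeta> \<in> nt_osc f k i j"
      then obtain z z' where zz: "z \<in> stolz (2 + real k) \<zeta>" "z' \<in> stolz (2 + real k) \<zeta>"
          "dist z \<zeta> < 1 / Suc j" "dist z' \<zeta> < 1 / Suc j" "1 / Suc i < dist (f z) (f z')"
        by (auto simp: nt_osc_def)
      then have "dist (f z) L < 1 / Suc i / 2" "dist (f z') L < 1 / Suc i / 2"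
        using d(2)[of z] d(2)[of z'] ne j by auto
      then have "dist (f z) (f z') < 1 / Suc i" by (rule dist_triangle_half_l)
      then show False using zz by simp
    qed
    then show ?thesis ..
  qed
  then show "\<zeta> \<in> {\<zeta> \<in> sphere 0 1. \<forall>k i. \<exists>j. \<zeta> \<notin> nt_osc f k i j}" using \<zeta> by simp
next
  fix \<zeta> assume "\<zeta> \<in> {\<zeta> \<in> sphere 0 1. \<forall>k i. \<exists>j. \<zeta> \<notin> nt_osc f k i j}"
  then have \<zeta>: "cmod \<zeta> = 1" and osc: "\<And>k i. \<exists>j. \<zeta> \<notin> nt_osc f k i j" by auto
  \<comment> \<open>The radius ends in every Stolz region, so the limit along it serves for all
    apertures at once.\<close>
  define s where "s n = of_real (1 - 1 / Suc (Suc n)) * \<zeta>" for n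
  have cau: "\<exists>d>0. \<forall>z\<in>stolz (2 + real k) \<zeta>. \<forall>z'\<in>stolz (2 + real k) \<zeta>. dist z \<zeta> < d \<longrightarrow> dist z' \<zeta> < d \<longrightarrow> dist (f z) (f z') < e"
    if e0: "0 < e" for e and k :: nat
  proof -
    obtain i where i: "1 / Suc i < e" using nat_approx_posE[OF e0] by blast
    obtain j where j: "\<zeta> \<notin> nt_osc f k i j" using osc by blast
    have "dist (f z) (f z') < e" if "z \<in> stolz (2 + real k) \<zeta>" "z' \<in> stolz (2 + real k) \<zeta>" "dist z \<zeta> < 1 / Suc j" "dist z' \<zeta> < 1 / Suc j" for z z'
    proof -
      have "\<not> 1 / Suc i < dist (f z) (f z')" using that j unfolding nt_osc_def by blast
      then show ?thesis using i by linarith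
    qed
    then show ?thesis by (intro exI[of _ "1 / Suc j"]) auto
  qed
  have sd: "\<exists>N. \<forall>n\<ge>N. dist (s n) \<zeta> < d" if "0 < d" for d
  proof -
    have "s \<longlonglongrightarrow> \<zeta>" using nt_radial_filterlim[OF \<zeta>, of 0] unfolding s_def filterlim_at by blast
    then show ?thesis using that by (auto simp: lim_sequentially)
  qed
  have sst: "s n \<in> stolz (2 + real k) \<zeta>" for n k unfolding s_def by (rule nt_radial_seq[OF \<zeta>])
  have "Cauchy (\<lambda>n. f (s n))"
    unfolding Cauchy_def
  proof (intro allI impI)
    fix e :: real assume "0 < e"
    then obtain d where d: "0 < d" "\<And>z z'. z\<in>stolz (2 + real 0) \<zeta> \<Longrightarrow> z'\<in>stolz (2 + real 0) \<zeta> \<Longrightarrow> dist z \<zeta> < d \<Longrightarrow> dist z' \<zeta> < d \<Longrightarrow> dist (f z) (f z') < e"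
      using cau[of e 0] by (auto simp del: add_0_right of_nat_0)
    obtain N where "\<forall>n\<ge>N. dist (s n) \<zeta> < d" using sd d(1) by blast
    then show "\<exists>N. \<forall>m\<ge>N. \<forall>n\<ge>N. dist (f (s m)) (f (s n)) < e"
      using d(2) sst[of _ 0] by (intro exI[of _ N]) auto
  qed
  then obtain L where L: "(\<lambda>n. f (s n)) \<longlonglongrightarrow> L" by (auto simp: Cauchy_convergent_iff convergent_def)
  have "(f \<longlongrightarrow> L) (at \<zeta> within stolz (2 + real k) \<zeta>)" for k
    unfolding Lim_within
  proof (intro allI impI)
    fix e :: real assume e: "0 < e"
    then obtain d where d: "0 < d" "\<And>z z'. z\<in>stolz (2 + real k) \<zeta> \<Longrightarrow> z'\<in>stolz (2 + real k) \<zeta> \<Longrightarrow> dist z \<zeta> < d \<Longrightarrow> dist z' \<zeta> < d \<Longrightarrow> dist (f z) (f z') < e / 2"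
      using cau[of "e / 2" k] by (auto simp del: add_0_right of_nat_0)
    obtain N where N: "\<forall>n\<ge>N. dist (s n) \<zeta> < d" using sd d(1) by blast
    obtain N' where N': "\<forall>n\<ge>N'. dist (f (s n)) L < e / 2" using L e by (auto simp: lim_sequentially dest: spec[of _ "e / 2"])
    show "\<exists>d>0. \<forall>x\<in>stolz (2 + real k) \<zeta>. 0 < dist x \<zeta> \<and> dist x \<zeta> < d \<longrightarrow> dist (f x) L < e"
    proof (intro exI[of _ d] conjI ballI impI d(1))
      fix x assume x: "x \<in> stolz (2 + real k) \<zeta>" "0 < dist x \<zeta> \<and> dist x \<zeta> < d"
      have "dist (f x) (f (s (max N N'))) < e / 2" using d(2)[OF x(1) sst] x N by auto
      moreover have "dist (f (s (max N N'))) L < e / 2" using N' by auto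
      ultimately show "dist (f x) L < e" using dist_triangle_half_r[of "f (s (max N N'))" "f x" e L]
        by (simp add: dist_commute)
    qed
  qed
  then show "\<zeta> \<in> nt_points f" using \<zeta> unfolding nt_points_def has_nt_limit_nat by auto
qed

lemma nt_points_borel [measurable]: "nt_points f \<in> sets borel"
proof -
  have "nt_points f = sphere 0 1 \<inter> (\<Inter>k. \<Inter>i. \<Union>j. - nt_osc f k i j)"
    unfolding nt_points_eq by auto
  also have "\<dots> \<in> sets borel"
    by (intro sets.Int sets.countable_INT'' sets.countable_UN' borel_closed)
       (auto intro!: borel_closed simp: open_nt_osc)
  finally show ?thesis .
qed

section \<open>The boundary extension: values, measurability and bounds\<close>

lemma nt_ext_eq:
  assumes "cmod \<zeta> = 1" "has_nt_limit f \<zeta> L"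
  shows "nt_ext f \<zeta> = L"
proof -
  have "(THE L. has_nt_limit f \<zeta> L) = L"
    using assms has_nt_limit_unique by blast
  then show ?thesis using assms by (auto simp: nt_ext_def)
qed

lemma has_nt_limit_nt_ext:
  assumes "\<zeta> \<in> nt_points f"
  shows "has_nt_limit f \<zeta> (nt_ext f \<zeta>)"
  using assms nt_ext_eq by (auto simp: nt_points_def)

lemma nt_ext_radial:
  assumes "\<zeta> \<in> nt_points f"
  shows "(\<lambda>n. f (of_real (1 - 1 / Suc (Suc n)) * \<zeta>)) \<longlonglongrightarrow> nt_ext f \<zeta>"
proof -
  have "(f \<longlongrightarrow> nt_ext f \<zeta>) (at \<zeta> within stolz (2 + real 0) \<zeta>)"
    using has_nt_limit_nt_ext[OF assms] unfolding has_nt_limit_nat by blast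
  then show ?thesis
    by (rule filterlim_compose[OF _ nt_radial_filterlim]) (use assms in \<open>auto simp: nt_points_def\<close>)
qed

lemma nt_ext_seq:
  assumes "\<zeta> \<in> nt_points f" "1 < \<alpha>" "\<And>n. s n \<in> stolz \<alpha> \<zeta>" "s \<longlonglongrightarrow> \<zeta>"
  shows "(\<lambda>n. f (s n)) \<longlonglongrightarrow> nt_ext f \<zeta>"
proof -
  have "s n \<noteq> \<zeta>" for n using assms(1) assms(3)[of n] by (auto simp: nt_points_def stolz_def)
  then have "filterlim s (at \<zeta> within stolz \<alpha> \<zeta>) sequentially"
    using assms by (auto simp: filterlim_at)
  moreover have "(f \<longlongrightarrow> nt_ext f \<zeta>) (at \<zeta> within stolz \<alpha> \<zeta>)"
    using has_nt_limit_nt_ext[OF assms(1)] assms(2) unfolding has_nt_limit_def by blast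
  ultimately show ?thesis by (rule filterlim_compose[rotated])
qed

text \<open>On the Borel set \<open>nt_points f\<close> the extension is the pointwise limit of
  dilates, which are continuous there; on the rest of the circle it has the default value
  \<open>0\<close>.\<close>

lemma nt_ext_measurable:
  assumes f: "f holomorphic_on ball 0 1"
  shows "nt_ext f \<in> borel_measurable (restrict_space borel (cball 0 1))"
proof -
  define c where "c n z = (if z \<in> ball 0 1 then f z else
     if z \<in> nt_points f then f (of_real (1 - 1 / Suc (Suc n)) * z) else 0)" for n z
  have c: "c n \<in> borel_measurable borel" for n
    unfolding c_def
  proof (rule measurable_If_restrict_space_iff[THEN iffD2, OF _ conjI])
    show "f \<in> borel_measurable (restrict_space borel {x. x \<in> ball 0 1})"
      unfolding Collect_mem_eq
      by (intro borel_measurable_continuous_on_restrict holomorphic_on_imp_continuous_on f)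
    have p: "{x. x \<in> nt_points f} = nt_points f" by simp
    have "(\<lambda>x. if x \<in> nt_points f then f (of_real (1 - 1 / Suc (Suc n)) * x) else 0) \<in> borel_measurable borel"
    proof (rule measurable_If_restrict_space_iff[THEN iffD2, OF _ conjI])
      have "continuous_on (nt_points f) (\<lambda>x. f (of_real (1 - 1 / Suc (Suc n)) * x))"
        by (rule continuous_on_subset[OF continuous_on_dilate[OF f]]) (auto simp: nt_points_def)
      then show "(\<lambda>x. f (of_real (1 - 1 / Suc (Suc n)) * x)) \<in> borel_measurable (restrict_space borel {x. x \<in> nt_points f})"
        unfolding p by (rule borel_measurable_continuous_on_restrict)
    qed (simp_all add: p)
    then show "(\<lambda>x. if x \<in> nt_points f then f (of_real (1 - 1 / Suc (Suc n)) * x) else 0) \<in> borel_measurable (restrict_space borel {x. x \<notin> ball 0 1})"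
      by (rule measurable_restrict_space1)
  qed simp
  have z0: "nt_ext f z = 0" if "cmod z = 1" "z \<notin> nt_points f" for z
    using that by (auto simp: nt_ext_def nt_points_def)
  have lim: "(\<lambda>n. c n z) \<longlonglongrightarrow> nt_ext f z" if "z \<in> cball 0 1" for z
  proof -
    consider "z \<in> ball 0 1" | "z \<in> nt_points f" "z \<notin> ball 0 1" | "z \<notin> nt_points f" "z \<notin> ball 0 1" by blast
    then show ?thesis
    proof cases
      case 1
      then show ?thesis unfolding c_def by (simp add: nt_ext_def)
    next
      case 2
      then show ?thesis unfolding c_def using nt_ext_radial[OF 2(1)] by (simp only: if_False if_True)
    next
      case 3
      then show ?thesis unfolding c_def using z0[of z] that by simp
    qed
  qed
  show ?thesis
    by (rule borel_measurable_LIMSEQ_metric[where f = c])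
       (use c lim in \<open>auto intro: measurable_restrict_space1\<close>)
qed

lemma cmod_nt_ext_le_1:
  assumes "f \<in> Hinf_ball" "cmod z \<le> 1"
  shows "cmod (nt_ext f z) \<le> 1"
proof (cases "z \<in> ball 0 1 \<or> z \<notin> nt_points f")
  case True
  then show ?thesis using assms by (auto simp: nt_ext_def Hinf_ball_def nt_points_def)
next
  case False
  then have z: "z \<in> nt_points f" "cmod z = 1" using assms by auto
  show ?thesis
  proof (rule LIMSEQ_le_const2[OF tendsto_norm[OF nt_ext_radial[OF z(1)]]])
    have "cmod (f (of_real (1 - 1 / Suc (Suc n)) * z)) \<le> 1" for n
      using assms(1) dilate_in_ball[of "1 - 1 / Suc (Suc n)" z] z(2) by (auto simp: Hinf_ball_def)
    then show "\<exists>N. \<forall>n\<ge>N. cmod (f (of_real (1 - 1 / Suc (Suc n)) * z)) \<le> 1" by blast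
  qed
qed

lemma nt_points_kb:
  assumes w: "cmod w < 1" and \<zeta>: "\<zeta> \<in> nt_points b"
  shows "has_nt_limit (kb b w) \<zeta> ((1 - cnj (b w) * nt_ext b \<zeta>) / (1 - cnj w * \<zeta>))"
  unfolding has_nt_limit_def
proof (intro allI impI)
  fix \<alpha> :: real assume \<alpha>: "1 < \<alpha>"
  have z1: "cmod \<zeta> = 1" using \<zeta> by (simp add: nt_points_def)
  have "(b \<longlongrightarrow> nt_ext b \<zeta>) (at \<zeta> within stolz \<alpha> \<zeta>)"
    using has_nt_limit_nt_ext[OF \<zeta>] \<alpha> unfolding has_nt_limit_def by blast
  then have "((\<lambda>z. (1 - cnj (b w) * b z) / (1 - cnj w * z)) \<longlongrightarrow> (1 - cnj (b w) * nt_ext b \<zeta>) / (1 - cnj w * \<zeta>)) (at \<zeta> within stolz \<alpha> \<zeta>)"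
    using szego_denominator_nonzero[OF w, of \<zeta>] z1 by (intro tendsto_intros) auto
  moreover have "eventually (\<lambda>z. (1 - cnj (b w) * b z) / (1 - cnj w * z) = kb b w z) (at \<zeta> within stolz \<alpha> \<zeta>)"
    unfolding eventually_at by (intro exI[of _ 1]) (auto simp: kb_def stolz_def)
  ultimately show "(kb b w \<longlongrightarrow> (1 - cnj (b w) * nt_ext b \<zeta>) / (1 - cnj w * \<zeta>)) (at \<zeta> within stolz \<alpha> \<zeta>)"
    by (rule Lim_transform_eventually)
qed

section \<open>Density of the kernel functions\<close>

context rkhs
begin

definition nrm :: "('a \<Rightarrow> complex) \<Rightarrow> real" where
  "nrm f = sqrt (Re (ip f f))"

definition kz :: "'a \<Rightarrow> 'a \<Rightarrow> complex" where
  "kz w = (\<lambda>z. if z \<in> X then K w z else 0)"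

definition kcomb :: "'a set \<Rightarrow> ('a \<Rightarrow> complex) \<Rightarrow> 'a \<Rightarrow> complex" where
  "kcomb S c = (\<lambda>z. \<Sum>w\<in>S. c w * kz w z)"

lemma kz_mem: "w \<in> X \<Longrightarrow> kz w \<in> H"
  unfolding kz_def by (rule kernel_mem)

lemma ip_kz: "w \<in> X \<Longrightarrow> f \<in> H \<Longrightarrow> ip f (kz w) = f w"
  unfolding kz_def by (rule reproducing[symmetric])

lemma diff_mem: "f \<in> H \<Longrightarrow> g \<in> H \<Longrightarrow> (\<lambda>z. f z - g z) \<in> H"
  using add_mem[OF _ scale_mem[of g "-1"]] by simp

lemma ip_diff: "f \<in> H \<Longrightarrow> g \<in> H \<Longrightarrow> k \<in> H \<Longrightarrow> ip (\<lambda>z. f z - g z) k = ip f k - ip g k"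
  using ip_add[OF _ scale_mem[of g "-1"], of f k] ip_scale[of g k "-1"] by simp

lemma ip_diff_right: "f \<in> H \<Longrightarrow> g \<in> H \<Longrightarrow> k \<in> H \<Longrightarrow> ip k (\<lambda>z. f z - g z) = ip k f - ip k g"
  using ip_cnj[of "\<lambda>z. f z - g z" k] ip_cnj[of f k] ip_cnj[of g k] diff_mem ip_diff by simp

lemma ip_add_right: "f \<in> H \<Longrightarrow> g \<in> H \<Longrightarrow> k \<in> H \<Longrightarrow> ip k (\<lambda>z. f z + g z) = ip k f + ip k g"
  using ip_cnj[of "\<lambda>z. f z + g z" k] ip_cnj[of f k] ip_cnj[of g k] add_mem ip_add by simp

lemma ip_scale_right: "f \<in> H \<Longrightarrow> g \<in> H \<Longrightarrow> ip f (\<lambda>z. c * g z) = cnj c * ip f g"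
  using ip_cnj[of "\<lambda>z. c * g z" f] ip_cnj[of g f] scale_mem ip_scale by simp

lemma ip_real: "f \<in> H \<Longrightarrow> ip f f = of_real (Re (ip f f))"
  using ip_cnj[of f f] by (simp add: complex_eq_iff)

lemma nrm_nonneg: "f \<in> H \<Longrightarrow> 0 \<le> nrm f"
  by (simp add: nrm_def ip_nonneg)

lemma nrm_power2: "f \<in> H \<Longrightarrow> (nrm f)\<^sup>2 = Re (ip f f)"
  by (simp add: nrm_def ip_nonneg)

lemma nrm_diff_scale_power2:
  assumes "a \<in> H" "v \<in> H"
  shows "(nrm (\<lambda>z. a z - t * v z))\<^sup>2 = (nrm a)\<^sup>2 - 2 * Re (cnj t * ip a v) + (cmod t)\<^sup>2 * (nrm v)\<^sup>2"
proof -
  have tv: "(\<lambda>z. t * v z) \<in> H" by (rule scale_mem[OF assms(2)])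
  have "ip (\<lambda>z. a z - t * v z) (\<lambda>z. a z - t * v z) =
      ip a a - cnj t * ip a v - (t * ip v a - (t * cnj t) * ip v v)"
    using assms tv
    by (simp add: ip_diff ip_diff_right diff_mem ip_scale ip_scale_right algebra_simps)
  also have "t * ip v a = cnj (cnj t * ip a v)" using ip_cnj[OF assms] by simp
  also have "t * cnj t = of_real ((cmod t)\<^sup>2)" by (rule complex_norm_square[symmetric])
  finally have "ip (\<lambda>z. a z - t * v z) (\<lambda>z. a z - t * v z) =
     ip a a - cnj t * ip a v - (cnj (cnj t * ip a v) - of_real ((cmod t)\<^sup>2) * ip v v)" .
  then show ?thesis
    using assms tv by (simp add: nrm_power2 diff_mem del: of_real_power)
qed

text \<open>The best choice is \<open>t = ip a v / (nrm v)^2\<close>. With \<open>d = 0\<close> the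
  result is the Cauchy--Schwarz inequality; with \<open>d\<close> the infimum of squared distances
  to a subspace, it says that the difference to a nearly closest element is nearly orthogonal to
  that subspace.\<close>

lemma ip_bound_of_distance_bound:
  assumes "a \<in> H" "v \<in> H" "\<And>t. d \<le> (nrm (\<lambda>z. a z - t * v z))\<^sup>2"
  shows "(cmod (ip a v))\<^sup>2 \<le> (nrm v)\<^sup>2 * ((nrm a)\<^sup>2 - d)"
proof (cases "(nrm v)\<^sup>2 = 0")
  case True
  then have "ip v v = 0" using ip_real[of v] assms by (simp add: nrm_power2)
  then have "v = (\<lambda>z. 0)" using ip_definite assms by blast
  then have "ip a v = 0" using ip_scale_right[of a v 0] assms by simp
  then show ?thesis using True by simp
next
  case False
  then have n: "0 < (nrm v)\<^sup>2" by (simp add: zero_less_power2)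
  define t where "t = ip a v / of_real ((nrm v)\<^sup>2)"
  have "cnj t * ip a v = of_real ((cmod (ip a v))\<^sup>2 / (nrm v)\<^sup>2)"
    unfolding t_def of_real_divide complex_norm_square by (simp add: mult.commute)
  moreover have "(cmod t)\<^sup>2 * (nrm v)\<^sup>2 = (cmod (ip a v))\<^sup>2 / (nrm v)\<^sup>2"
    using n unfolding t_def norm_divide norm_of_real by (simp add: power_divide power2_eq_square)
  ultimately have "d \<le> (nrm a)\<^sup>2 - (cmod (ip a v))\<^sup>2 / (nrm v)\<^sup>2"
    using assms(3)[of t] unfolding nrm_diff_scale_power2[OF assms(1,2)] by simp
  then show ?thesis using n by (simp add: field_simps)
qed

lemma ip_Cauchy_Schwarz:
  assumes "a \<in> H" "v \<in> H"
  shows "cmod (ip a v) \<le> nrm a * nrm v"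
proof -
  have "(cmod (ip a v))\<^sup>2 \<le> (nrm v)\<^sup>2 * ((nrm a)\<^sup>2 - 0)"
    by (rule ip_bound_of_distance_bound) (use assms in auto)
  then have "(cmod (ip a v))\<^sup>2 \<le> (nrm a * nrm v)\<^sup>2" by (simp add: power_mult_distrib mult.commute)
  then show ?thesis by (rule power2_le_imp_le) (use assms nrm_nonneg in auto)
qed

lemma parallelogram:
  assumes "a \<in> H" "c \<in> H"
  shows "(nrm (\<lambda>z. a z - c z))\<^sup>2 = 2 * (nrm a)\<^sup>2 + 2 * (nrm c)\<^sup>2 - (nrm (\<lambda>z. a z + c z))\<^sup>2"
  using nrm_diff_scale_power2[OF assms, of 1] nrm_diff_scale_power2[OF assms, of "-1"] by simp

lemma nrm_scale: "f \<in> H \<Longrightarrow> nrm (\<lambda>z. c * f z) = cmod c * nrm f"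
proof -
  assume f: "f \<in> H"
  have "ip (\<lambda>z. c * f z) (\<lambda>z. c * f z) = (c * cnj c) * ip f f"
    using f scale_mem[of f c] by (simp add: ip_scale ip_scale_right)
  also have "c * cnj c = of_real ((cmod c)\<^sup>2)" by (rule complex_norm_square[symmetric])
  finally show ?thesis by (simp add: nrm_def real_sqrt_mult del: of_real_power)
qed

lemma kcomb_mem: "finite S \<Longrightarrow> S \<subseteq> X \<Longrightarrow> kcomb S c \<in> H"
proof (induction S rule: finite_induct)
  case empty
  then show ?case by (simp add: kcomb_def zero_mem)
next
  case (insert w S)
  then show ?case
    using add_mem[OF scale_mem[OF kz_mem[of w], of "c w"], of "kcomb S c"] by (simp add: kcomb_def)
qed

lemma ip_kcomb:
  assumes "finite S" "S \<subseteq> X" "f \<in> H"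
  shows "ip f (kcomb S c) = (\<Sum>w\<in>S. cnj (c w) * f w)"
  using assms(1,2)
proof (induction S rule: finite_induct)
  case empty
  then show ?case using ip_scale_right[OF assms(3) zero_mem, of 0] by (simp add: kcomb_def)
next
  case (insert w S)
  have "ip f (\<lambda>z. c w * kz w z + kcomb S c z) = ip f (\<lambda>z. c w * kz w z) + ip f (kcomb S c)"
    using insert assms by (intro ip_add_right scale_mem kz_mem kcomb_mem) auto
  then show ?case
    using insert assms by (simp add: kcomb_def ip_scale_right kz_mem ip_kz)
qed

lemma nrm_kcomb:
  assumes "finite S" "S \<subseteq> X"
  shows "(nrm (kcomb S c))\<^sup>2 = Re (\<Sum>v\<in>S. \<Sum>w\<in>S. cnj (c v) * c w * K w v)"
proof -
  have "ip (kcomb S c) (kcomb S c) = (\<Sum>v\<in>S. cnj (c v) * kcomb S c v)"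
    by (rule ip_kcomb[OF assms kcomb_mem[OF assms]])
  also have "\<dots> = (\<Sum>v\<in>S. \<Sum>w\<in>S. cnj (c v) * c w * K w v)"
    using assms(2) by (auto simp: kcomb_def kz_def sum_distrib_left mult.assoc intro!: sum.cong)
  finally show ?thesis using assms by (simp add: nrm_power2 kcomb_mem)
qed

lemma kcomb_add:
  assumes "finite S" "finite T"
  shows "\<exists>e. (\<lambda>z. kcomb S c z + a * kcomb T d z) = kcomb (S \<union> T) e"
proof -
  define e where "e w = (if w \<in> S then c w else 0) + (if w \<in> T then a * d w else 0)" for w
  have "kcomb (S \<union> T) e z = kcomb S c z + a * kcomb T d z" for z
  proof -
    have "kcomb S c z = (\<Sum>w\<in>S \<union> T. (if w \<in> S then c w else 0) * kz w z)"
      unfolding kcomb_def using assms by (intro sum.mono_neutral_cong_left) auto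
    moreover have "a * kcomb T d z = (\<Sum>w\<in>S \<union> T. (if w \<in> T then a * d w else 0) * kz w z)"
      unfolding kcomb_def sum_distrib_left using assms by (intro sum.mono_neutral_cong_left) auto
    ultimately show ?thesis
      by (simp add: kcomb_def e_def sum.distrib distrib_right)
  qed
  then show ?thesis by (intro exI[of _ e]) auto
qed

definition kspan :: "('a \<Rightarrow> complex) set" where
  "kspan = {kcomb S c |S c. finite S \<and> S \<subseteq> X}"

lemma kspan_H: "g \<in> kspan \<Longrightarrow> g \<in> H"
  by (auto simp: kspan_def kcomb_mem)

lemma kspan_add: "g \<in> kspan \<Longrightarrow> k \<in> kspan \<Longrightarrow> (\<lambda>z. g z + a * k z) \<in> kspan"
proof -
  assume "g \<in> kspan" "k \<in> kspan"
  then obtain S c T d where "g = kcomb S c" "k = kcomb T d" "finite S" "S \<subseteq> X" "finite T" "T \<subseteq> X"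
    by (auto simp: kspan_def)
  then show ?thesis using kcomb_add[of S T c a d] by (auto simp: kspan_def)
qed

lemma kspan_zero: "(\<lambda>z. 0) \<in> kspan"
  unfolding kspan_def by (auto simp: kcomb_def intro!: exI[of _ "{}"])

lemma kspan_kz: "w \<in> X \<Longrightarrow> kz w \<in> kspan"
  unfolding kspan_def by (auto simp: kcomb_def intro!: exI[of _ "{w}"] exI[of _ "\<lambda>_. 1"])

lemma cmod_le_nrm:
  assumes "f \<in> H" "w \<in> X"
  shows "cmod (f w) \<le> nrm f * nrm (kz w)"
  using ip_Cauchy_Schwarz[OF assms(1) kz_mem[OF assms(2)]] ip_kz[OF assms(2,1)] by simp

lemma nrm_le_add_diff:
  assumes f: "f \<in> H" and g: "g \<in> H"
  shows "nrm g \<le> nrm f + nrm (\<lambda>z. f z - g z)"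
proof (rule power2_le_imp_le)
  have fg: "(\<lambda>z. f z - g z) \<in> H" by (rule diff_mem[OF f g])
  define e where "e = nrm (\<lambda>z. f z - g z)"
  have 1: "cmod (ip f (\<lambda>z. f z - g z)) \<le> nrm f * e"
    unfolding e_def by (rule ip_Cauchy_Schwarz[OF f fg])
  have "(nrm (\<lambda>z. f z - 1 * (f z - g z)))\<^sup>2 = (nrm f)\<^sup>2 - 2 * Re (cnj 1 * ip f (\<lambda>z. f z - g z)) + (cmod 1)\<^sup>2 * e\<^sup>2"
    unfolding e_def by (rule nrm_diff_scale_power2[OF f fg])
  then have "(nrm g)\<^sup>2 = (nrm f)\<^sup>2 - 2 * Re (ip f (\<lambda>z. f z - g z)) + e\<^sup>2" by simp
  moreover have "- Re (ip f (\<lambda>z. f z - g z)) \<le> nrm f * e"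
    using 1 abs_Re_le_cmod[of "ip f (\<lambda>z. f z - g z)"] by linarith
  ultimately show "(nrm g)\<^sup>2 \<le> (nrm f + nrm (\<lambda>z. f z - g z))\<^sup>2"
    unfolding power2_sum e_def by linarith
  show "0 \<le> nrm f + nrm (\<lambda>z. f z - g z)" by (intro add_nonneg_nonneg nrm_nonneg f fg)
qed

text \<open>A minimising sequence \<open>g\<close> in the span is Cauchy by the parallelogram law
  and has a limit \<open>p\<close> by completeness. As \<open>f - g n\<close> is nearly orthogonal
  to every kernel function, its values tend to \<open>0\<close>; hence \<open>p = f\<close>, and the
  convergence to \<open>f\<close> is in norm.\<close>

theorem kspan_dense_seq:
  assumes f: "f \<in> H"
  obtains g where "\<And>n. g n \<in> kspan" "(\<lambda>n. nrm (\<lambda>z. f z - g n z)) \<longlonglongrightarrow> 0"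
proof -
  define D where "D = (\<lambda>g. (nrm (\<lambda>z. f z - g z))\<^sup>2) ` kspan"
  define d where "d = Inf D"
  have bd: "bdd_below D" unfolding D_def by (rule bdd_belowI[of _ 0]) auto
  have ne: "D \<noteq> {}" using kspan_zero by (auto simp: D_def)
  have le: "d \<le> (nrm (\<lambda>z. f z - g z))\<^sup>2" if "g \<in> kspan" for g
    unfolding d_def using bd that by (intro cInf_lower) (auto simp: D_def)
  have "\<exists>g\<in>kspan. (nrm (\<lambda>z. f z - g z))\<^sup>2 < d + 1 / Suc n" for n
  proof -
    have "Inf D < d + 1 / Suc n" unfolding d_def by simp
    then show ?thesis using cInf_lessD[OF ne] by (auto simp: D_def)
  qed
  then obtain g where g: "\<And>n. g n \<in> kspan" "\<And>n. (nrm (\<lambda>z. f z - g n z))\<^sup>2 < d + 1 / Suc n"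
    by metis
  have fg: "(\<lambda>z. f z - g n z) \<in> H" for n using f g(1) kspan_H diff_mem by blast
  have gg: "(\<lambda>z. g m z - g n z) \<in> H" for m n using g(1) kspan_H diff_mem by blast
  have close: "(nrm (\<lambda>z. g m z - g n z))\<^sup>2 \<le> 2 / Suc m + 2 / Suc n" for m n
  proof -
    have "(nrm (\<lambda>z. g m z - g n z))\<^sup>2 = (nrm (\<lambda>z. (f z - g n z) - (f z - g m z)))\<^sup>2" by simp
    also have "\<dots> = 2 * (nrm (\<lambda>z. f z - g n z))\<^sup>2 + 2 * (nrm (\<lambda>z. f z - g m z))\<^sup>2
        - (nrm (\<lambda>z. (f z - g n z) + (f z - g m z)))\<^sup>2"
      by (rule parallelogram[OF fg fg])
    \<comment> \<open>The midpoint of \<open>g n\<close> and \<open>g m\<close> lies in the span, so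
      its squared distance to \<open>f\<close> is at least \<open>d\<close>. The leading
      \<open>0\<close> only brings it into the shape of \<open>kspan_add\<close>.\<close>
    also have "(\<lambda>z. (f z - g n z) + (f z - g m z)) =
        (\<lambda>z. 2 * (f z - ((0 + (1/2) * g n z) + (1/2) * g m z)))"
      by (simp add: algebra_simps)
    also have "(nrm \<dots>)\<^sup>2 = 4 * (nrm (\<lambda>z. f z - ((0 + (1/2) * g n z) + (1/2) * g m z)))\<^sup>2"
      using diff_mem[OF f kspan_H[OF kspan_add[OF kspan_add[OF kspan_zero g(1)[of n]] g(1)[of m], of "1/2" "1/2"]]]
      by (subst nrm_scale) (auto simp: power_mult_distrib)
    finally show ?thesis
      using g(2)[of m] g(2)[of n] le[OF kspan_add[OF kspan_add[OF kspan_zero g(1)[of n]] g(1)[of m], of "1/2" "1/2"]]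
      by simp
  qed
  have "\<exists>p\<in>H. (\<lambda>n. sqrt (Re (ip (\<lambda>z. g n z - p z) (\<lambda>z. g n z - p z)))) \<longlonglongrightarrow> 0"
  proof (rule complete)
    show "g n \<in> H" for n using g(1) kspan_H by blast
    fix e :: real assume e: "0 < e"
    obtain N where N: "1 / Suc N < e\<^sup>2 / 4" using nat_approx_posE[of "e\<^sup>2 / 4"] e by auto
    show "\<exists>N. \<forall>m\<ge>N. \<forall>n\<ge>N. sqrt (Re (ip (\<lambda>z. g m z - g n z) (\<lambda>z. g m z - g n z))) < e"
    proof (intro exI[of _ N] allI impI)
      fix m n assume mn: "N \<le> m" "N \<le> n"
      have "2 / real (Suc m) \<le> 2 * (1 / Suc N)" "2 / real (Suc n) \<le> 2 * (1 / Suc N)"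
        using mn by (auto intro!: divide_left_mono)
      then have "(nrm (\<lambda>z. g m z - g n z))\<^sup>2 < e\<^sup>2" using close[of m n] N by linarith
      then have "nrm (\<lambda>z. g m z - g n z) < e" using e by (intro power2_less_imp_less[of _ e]) auto
      then show "sqrt (Re (ip (\<lambda>z. g m z - g n z) (\<lambda>z. g m z - g n z))) < e" by (simp add: nrm_def)
    qed
  qed
  then obtain p where p: "p \<in> H" "(\<lambda>n. nrm (\<lambda>z. g n z - p z)) \<longlonglongrightarrow> 0"
    unfolding nrm_def by blast
  have gp: "(\<lambda>z. g n z - p z) \<in> H" for n using p(1) g(1) kspan_H diff_mem by blast
  have "f w = p w" for w
  proof (cases "w \<in> X")
    case False
    then show ?thesis using supported[OF f False] supported[OF p(1) False] by simp
  next
    case w: True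
    have b1: "(cmod (f w - g n w))\<^sup>2 \<le> (nrm (kz w))\<^sup>2 * (1 / Suc n)" for n
    proof -
      have "(cmod (ip (\<lambda>z. f z - g n z) (kz w)))\<^sup>2 \<le> (nrm (kz w))\<^sup>2 * ((nrm (\<lambda>z. f z - g n z))\<^sup>2 - d)"
      proof (rule ip_bound_of_distance_bound[OF fg kz_mem[OF w]])
        fix t
        show "d \<le> (nrm (\<lambda>z. f z - g n z - t * kz w z))\<^sup>2"
          using le[OF kspan_add[OF g(1) kspan_kz[OF w], of n t]] by (simp add: diff_diff_eq)
      qed
      also have "\<dots> \<le> (nrm (kz w))\<^sup>2 * (1 / Suc n)"
        using g(2)[of n] by (intro mult_left_mono) auto
      finally show ?thesis using ip_kz[OF w fg] by simp
    qed
    have "(\<lambda>n. 1 / real (Suc n)) \<longlonglongrightarrow> 0"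
      using LIMSEQ_inverse_real_of_nat by (simp only: inverse_eq_divide)
    from tendsto_mult_left[OF this, of "(nrm (kz w))\<^sup>2"]
    have lim0: "(\<lambda>n. (nrm (kz w))\<^sup>2 * (1 / real (Suc n))) \<longlonglongrightarrow> 0" by (simp only: mult_zero_right)
    have "(\<lambda>n. (cmod (f w - g n w))\<^sup>2) \<longlonglongrightarrow> 0"
      by (rule Lim_null_comparison[OF always_eventually lim0]) (use b1 in simp)
    then have "(\<lambda>n. sqrt ((cmod (f w - g n w))\<^sup>2)) \<longlonglongrightarrow> sqrt 0" by (rule tendsto_real_sqrt)
    then have l1: "(\<lambda>n. cmod (f w - g n w)) \<longlonglongrightarrow> 0" by simp
    have lim1: "(\<lambda>n. nrm (\<lambda>z. g n z - p z) * nrm (kz w)) \<longlonglongrightarrow> 0"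
      using tendsto_mult_right[OF p(2), of "nrm (kz w)"] by simp
    have l2: "(\<lambda>n. cmod (g n w - p w)) \<longlonglongrightarrow> 0"
      by (rule Lim_null_comparison[OF always_eventually lim1]) (use cmod_le_nrm[OF gp w] in simp)
    have "cmod (f w - p w) \<le> 0 + 0"
    proof (rule LIMSEQ_le_const[OF tendsto_add[OF l1 l2]])
      have "cmod (f w - p w) \<le> cmod (f w - g n w) + cmod (g n w - p w)" for n
        using norm_triangle_ineq[of "f w - g n w" "g n w - p w"] by simp
      then show "\<exists>N. \<forall>n\<ge>N. cmod (f w - p w) \<le> cmod (f w - g n w) + cmod (g n w - p w)" by blast
    qed
    then show ?thesis by simp
  qed
  then have "f = p" by blast
  moreover have "nrm (\<lambda>z. g n z - p z) = nrm (\<lambda>z. p z - g n z)" for n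
    using nrm_scale[OF gp, of "-1" n] by simp
  ultimately show ?thesis using that[of g] g(1) p(2) by simp
qed

text \<open>The bound is applied to a sequence in the span that tends to \<open>f\<close>; the limit
  is \<open>(nrm f)^2 \<le> C * nrm f\<close>.\<close>

lemma nrm_le_of_kspan_pairing:
  assumes f: "f \<in> H" and C: "0 \<le> C" and pair: "\<And>g. g \<in> kspan \<Longrightarrow> cmod (ip f g) \<le> C * nrm g"
  shows "nrm f \<le> C"
proof (cases "nrm f = 0")
  case False
  then have n: "0 < nrm f" using nrm_nonneg[OF f] by simp
  obtain g where g: "\<And>n. g n \<in> kspan" "(\<lambda>n. nrm (\<lambda>z. f z - g n z)) \<longlonglongrightarrow> 0"
    using kspan_dense_seq[OF f] by blast
  have gH: "g n \<in> H" for n using g kspan_H by blast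
  have fg: "(\<lambda>z. f z - g n z) \<in> H" for n using f gH diff_mem by blast
  have bound: "(nrm f)\<^sup>2 \<le> C * nrm f + (nrm f + C) * nrm (\<lambda>z. f z - g n z)" for n
  proof -
    define e where "e = nrm (\<lambda>z. f z - g n z)"
    have e: "0 \<le> e" unfolding e_def by (rule nrm_nonneg[OF fg])
    have 1: "cmod (ip f (\<lambda>z. f z - g n z)) \<le> nrm f * e"
      unfolding e_def by (rule ip_Cauchy_Schwarz[OF f fg])
    have tri: "nrm (g n) \<le> nrm f + e"
      unfolding e_def by (rule nrm_le_add_diff[OF f gH])
    have "(nrm f)\<^sup>2 = Re (ip f f)" by (rule nrm_power2[OF f])
    also have "ip f f = ip f (g n) + ip f (\<lambda>z. f z - g n z)" using f gH by (simp add: ip_diff_right)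
    also have "Re \<dots> \<le> cmod (ip f (g n)) + cmod (ip f (\<lambda>z. f z - g n z))"
      using complex_Re_le_cmod[of "ip f (g n)"] complex_Re_le_cmod[of "ip f (\<lambda>z. f z - g n z)"] by simp
    also have "\<dots> \<le> C * (nrm f + e) + nrm f * e"
      using pair[OF g(1)[of n]] 1 mult_left_mono[OF tri C] by linarith
    finally show ?thesis by (simp add: e_def algebra_simps)
  qed
  have "(\<lambda>n. C * nrm f + (nrm f + C) * nrm (\<lambda>z. f z - g n z)) \<longlonglongrightarrow> C * nrm f + (nrm f + C) * 0"
    by (intro tendsto_intros g)
  then have "(nrm f)\<^sup>2 \<le> C * nrm f + (nrm f + C) * 0"
    by (rule LIMSEQ_le_const) (use bound in blast)
  then have "nrm f * nrm f \<le> C * nrm f" by (simp add: power2_eq_square)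
  then show ?thesis using n by simp
qed (use C in simp)

end

section \<open>Square means of analytic functions\<close>

text \<open>Fatou's lemma with converging bounds for the integrals; it is the device by which
  estimates for dilates reach boundary values.\<close>

lemma nn_integral_le_limit:
  fixes f :: "nat \<Rightarrow> 'a \<Rightarrow> real"
  assumes f: "\<And>n. f n \<in> borel_measurable M" and lim: "AE x in M. (\<lambda>n. f n x) \<longlonglongrightarrow> g x"
    and le: "\<And>n. (\<integral>\<^sup>+x. ennreal (f n x) \<partial>M) \<le> ennreal (a n)" and a: "a \<longlonglongrightarrow> A"
  shows "(\<integral>\<^sup>+x. ennreal (g x) \<partial>M) \<le> ennreal A"
proof -
  have "(\<integral>\<^sup>+x. ennreal (g x) \<partial>M) = (\<integral>\<^sup>+x. liminf (\<lambda>n. ennreal (f n x)) \<partial>M)"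
  proof (rule nn_integral_cong_AE)
    show "AE x in M. ennreal (g x) = liminf (\<lambda>n. ennreal (f n x))"
      using lim by eventually_elim (intro lim_imp_Liminf[symmetric] tendsto_ennrealI, auto)
  qed
  also have "\<dots> \<le> liminf (\<lambda>n. \<integral>\<^sup>+x. ennreal (f n x) \<partial>M)"
    by (rule nn_integral_liminf) (use f in measurable)
  also have "\<dots> \<le> liminf (\<lambda>n. ennreal (a n))"
    by (intro Liminf_mono always_eventually allI le)
  also have "\<dots> = ennreal A"
    using a by (intro lim_imp_Liminf tendsto_ennrealI) auto
  finally show ?thesis .
qed

lemma nn_integral_circle_eq_integral:
  fixes f :: "complex \<Rightarrow> real"
  assumes "continuous_on (sphere 0 1) f" "\<And>x. x \<in> sphere 0 1 \<Longrightarrow> 0 \<le> f x"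
  shows "(\<integral>\<^sup>+x. ennreal (f x) \<partial>\<sigma>) = ennreal (\<integral>x. f x \<partial>\<sigma>)"
  using assms by (intro nn_integral_eq_integral integrable_circleI AE_I2) auto

lemma borel_measurable_cnj [measurable]: "cnj \<in> borel_measurable borel"
  by (intro borel_measurable_continuous_onI continuous_intros)

lemma measurable_ident_circle: "(\<lambda>x. x) \<in> borel_measurable \<sigma>"
  by (intro borel_measurable_circleI continuous_intros)

lemma poisson_symmetric:
  assumes "cmod x = 1" "cmod y = 1"
  shows "poisson (of_real r * x) y = poisson (of_real r * y) x"
proof -
  have "cnj (1 - cnj (of_real r * x) * y) = 1 - cnj (of_real r * y) * x"
    by (simp add: algebra_simps)
  then have "cmod (1 - cnj (of_real r * x) * y) = cmod (1 - cnj (of_real r * y) * x)"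
    by (metis complex_mod_cnj)
  then show ?thesis using assms by (simp add: poisson_def szego_def norm_mult norm_divide)
qed

text \<open>The variance of \<open>u\<close> under the probability density \<open>poisson w\<close>
  is non-negative, and the mean of \<open>u\<close> under it is \<open>u w\<close>.\<close>

lemma cmod_power2_le_poisson_integral:
  assumes c: "continuous_on (cball 0 1) u" and h: "u holomorphic_on ball 0 1" and w: "cmod w < 1"
  shows "(cmod (u w))\<^sup>2 \<le> (\<integral>x. (cmod (u x))\<^sup>2 * poisson w x \<partial>\<sigma>)"
proof -
  have uc: "continuous_on (sphere 0 1) u" by (rule continuous_on_subset[OF c]) auto
  have i1: "integrable \<sigma> (\<lambda>x. (cmod (u x))\<^sup>2 * poisson w x)"
    by (intro integrable_circleI continuous_intros continuous_on_poisson w uc)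
  have i2: "integrable \<sigma> (\<lambda>x. u x * of_real (poisson w x))"
    by (intro integrable_circleI continuous_intros continuous_on_poisson w uc)
  have i3: "integrable \<sigma> (poisson w)"
    by (intro integrable_circleI continuous_on_poisson w)
  have eq: "(cmod (u x - u w))\<^sup>2 * poisson w x =
     (cmod (u x))\<^sup>2 * poisson w x - 2 * Re (cnj (u w) * (u x * of_real (poisson w x))) + (cmod (u w))\<^sup>2 * poisson w x" for x
    unfolding cmod_power2 by (simp add: power2_eq_square algebra_simps)
  have "0 \<le> (\<integral>x. (cmod (u x - u w))\<^sup>2 * poisson w x \<partial>\<sigma>)"
    using w by (intro Bochner_Integration.integral_nonneg mult_nonneg_nonneg poisson_nonneg) auto
  also have "\<dots> = (\<integral>x. (cmod (u x))\<^sup>2 * poisson w x \<partial>\<sigma>)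
      - 2 * (\<integral>x. Re (cnj (u w) * (u x * of_real (poisson w x))) \<partial>\<sigma>) + (cmod (u w))\<^sup>2 * (\<integral>x. poisson w x \<partial>\<sigma>)"
  proof -
    define R where "R x = Re (cnj (u w) * (u x * of_real (poisson w x)))" for x
    have "integrable \<sigma> R"
      unfolding R_def by (intro integrable_Re integrable_mult_right i2)
    then show ?thesis
      unfolding eq R_def[symmetric] using i1 i3 by simp
  qed
  also have "(\<integral>x. Re (cnj (u w) * (u x * of_real (poisson w x))) \<partial>\<sigma>) = Re (cnj (u w) * u w)"
    using integral_bounded_linear[OF bounded_linear_Re integrable_mult_right[OF i2, of "cnj (u w)"]]
    by (simp add: circle_Poisson_integral[OF c h w] del: times_complex.sel)
  also have "Re (cnj (u w) * u w) = (cmod (u w))\<^sup>2"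
    unfolding cmod_power2 by (simp add: power2_eq_square)
  finally show ?thesis by (simp add: integral_poisson w)
qed

text \<open>The bound of \<open>|u|^2\<close> by its Poisson average is integrated over the circle.
  After exchanging the integrals, the symmetry of the Poisson kernel leaves a kernel of mass
  \<open>1\<close>.\<close>

lemma L2_mean_dilate_le:
  assumes c: "continuous_on (cball 0 1) u" and h: "u holomorphic_on ball 0 1" and r: "0 \<le> r" "r < 1"
  shows "(\<integral>\<^sup>+x. ennreal ((cmod (u (of_real r * x)))\<^sup>2) \<partial>\<sigma>) \<le>
         (\<integral>\<^sup>+x. ennreal ((cmod (u x))\<^sup>2) \<partial>\<sigma>)"
proof -
  interpret pair_sigma_finite \<sigma> \<sigma> ..
  have uc: "continuous_on (sphere 0 1) u" by (rule continuous_on_subset[OF c]) auto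
  have rx: "cmod (of_real r * x) < 1" if "x \<in> sphere 0 1" for x
    using dilate_in_ball[OF r, of x] that by simp
  have m: "(\<lambda>(x, y). ennreal ((cmod (u y))\<^sup>2 * poisson (of_real r * x) y)) \<in> borel_measurable (\<sigma> \<Otimes>\<^sub>M \<sigma>)"
  proof -
    have [measurable]: "(\<lambda>p. u (snd p)) \<in> borel_measurable (\<sigma> \<Otimes>\<^sub>M \<sigma>)"
      "(\<lambda>p. fst p) \<in> borel_measurable (\<sigma> \<Otimes>\<^sub>M \<sigma>)"
      "(\<lambda>p. snd p) \<in> borel_measurable (\<sigma> \<Otimes>\<^sub>M \<sigma>)"
      by (rule measurable_compose[OF measurable_snd borel_measurable_circleI[OF uc]]
          measurable_compose[OF measurable_fst measurable_ident_circle]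
          measurable_compose[OF measurable_snd measurable_ident_circle])+
    show ?thesis
      unfolding poisson_def szego_def case_prod_unfold
      by (intro measurable_compose[OF _ measurable_ennreal] borel_measurable_times borel_measurable_diff
          borel_measurable_power borel_measurable_const borel_measurable_norm borel_measurable_divide)
         measurable
  qed
  have "(\<integral>\<^sup>+x. ennreal ((cmod (u (of_real r * x)))\<^sup>2) \<partial>\<sigma>) \<le>
      (\<integral>\<^sup>+x. \<integral>\<^sup>+y. ennreal ((cmod (u y))\<^sup>2 * poisson (of_real r * x) y) \<partial>\<sigma> \<partial>\<sigma>)"
  proof (rule nn_integral_mono)
    fix x assume "x \<in> space \<sigma>"
    then have x: "x \<in> sphere 0 1" by simp
    have "ennreal ((cmod (u (of_real r * x)))\<^sup>2) \<le> ennreal (\<integral>y. (cmod (u y))\<^sup>2 * poisson (of_real r * x) y \<partial>\<sigma>)"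
      by (intro ennreal_leI cmod_power2_le_poisson_integral c h rx x)
    also have "\<dots> = (\<integral>\<^sup>+y. ennreal ((cmod (u y))\<^sup>2 * poisson (of_real r * x) y) \<partial>\<sigma>)"
      using rx[OF x]
      by (intro nn_integral_circle_eq_integral[symmetric] continuous_intros continuous_on_poisson uc mult_nonneg_nonneg poisson_nonneg) auto
    finally show "ennreal ((cmod (u (of_real r * x)))\<^sup>2) \<le> (\<integral>\<^sup>+y. ennreal ((cmod (u y))\<^sup>2 * poisson (of_real r * x) y) \<partial>\<sigma>)" .
  qed
  also have "\<dots> = (\<integral>\<^sup>+y. \<integral>\<^sup>+x. ennreal ((cmod (u y))\<^sup>2 * poisson (of_real r * x) y) \<partial>\<sigma> \<partial>\<sigma>)"
    using Fubini'[OF m] by simp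
  also have "\<dots> = (\<integral>\<^sup>+y. ennreal ((cmod (u y))\<^sup>2) \<partial>\<sigma>)"
  proof (rule nn_integral_cong)
    fix y assume "y \<in> space \<sigma>"
    then have y: "y \<in> sphere 0 1" by simp
    have "(\<integral>\<^sup>+x. ennreal ((cmod (u y))\<^sup>2 * poisson (of_real r * x) y) \<partial>\<sigma>) =
        (\<integral>\<^sup>+x. ennreal ((cmod (u y))\<^sup>2 * poisson (of_real r * y) x) \<partial>\<sigma>)"
      using y by (intro nn_integral_cong) (simp add: poisson_symmetric)
    also have "\<dots> = ennreal (\<integral>x. (cmod (u y))\<^sup>2 * poisson (of_real r * y) x \<partial>\<sigma>)"
      using rx[OF y]
      by (intro nn_integral_circle_eq_integral continuous_intros continuous_on_poisson mult_nonneg_nonneg poisson_nonneg) auto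
    also have "(\<integral>x. (cmod (u y))\<^sup>2 * poisson (of_real r * y) x \<partial>\<sigma>) = (cmod (u y))\<^sup>2"
      by (simp add: integral_poisson[OF rx[OF y]])
    finally show "(\<integral>\<^sup>+x. ennreal ((cmod (u y))\<^sup>2 * poisson (of_real r * x) y) \<partial>\<sigma>) = ennreal ((cmod (u y))\<^sup>2)" .
  qed
  finally show ?thesis .
qed

lemma le_1_plus_power2: "x \<le> 1 + x\<^sup>2" for x :: real
proof -
  have "2 * x \<le> x\<^sup>2 + 1" using zero_le_power2[of "x - 1"] by (simp add: power2_diff)
  then show ?thesis using zero_le_power2[of x] by linarith
qed

text \<open>Bounded square means give uniform integrability; together with convergence almost
  everywhere this yields convergence in \<open>L^1\<close>, and a bounded factor \<open>g\<close>
  can be multiplied in. This replaces dominated convergence for the dilates of a function for which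
  no majorant is at hand.\<close>

lemma tendsto_integral_mult_of_L2_bounded:
  fixes f :: "nat \<Rightarrow> 'a \<Rightarrow> complex"
  assumes M: "finite_measure M" and f: "\<And>n. f n \<in> borel_measurable M" and F: "F \<in> borel_measurable M"
    and lim: "AE x in M. (\<lambda>n. f n x) \<longlonglongrightarrow> F x"
    and bnd: "\<And>n. (\<integral>\<^sup>+x. ennreal ((cmod (f n x))\<^sup>2) \<partial>M) \<le> ennreal A"
    and g: "g \<in> borel_measurable M" "\<And>x. x \<in> space M \<Longrightarrow> cmod (g x) \<le> B"
  shows "(\<lambda>n. \<integral>x. f n x * g x \<partial>M) \<longlonglongrightarrow> (\<integral>x. F x * g x \<partial>M)"
proof -
  interpret finite_measure M by fact
  note [measurable] = f F g(1)
  \<comment> \<open>The maximum appears because \<open>ennreal A\<close> is \<open>0\<close> for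
    negative \<open>A\<close>.\<close>
  have L2: "integrable M (\<lambda>x. (cmod (h x))\<^sup>2)" "(\<integral>x. (cmod (h x))\<^sup>2 \<partial>M) \<le> max A 0"
    if "h \<in> borel_measurable M" "(\<integral>\<^sup>+x. ennreal ((cmod (h x))\<^sup>2) \<partial>M) \<le> ennreal A" for h
  proof -
    note [measurable] = that(1)
    show i: "integrable M (\<lambda>x. (cmod (h x))\<^sup>2)"
      by (rule integrableI_nonneg) (use that(2) in \<open>auto intro: le_less_trans\<close>)
    have "ennreal (\<integral>x. (cmod (h x))\<^sup>2 \<partial>M) = (\<integral>\<^sup>+x. ennreal ((cmod (h x))\<^sup>2) \<partial>M)"
      by (rule nn_integral_eq_integral[OF i, symmetric]) simp
    also have "\<dots> \<le> ennreal A" by (rule that(2))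
    also have "\<dots> \<le> ennreal (max A 0)" by (rule ennreal_leI) simp
    finally have "ennreal (\<integral>x. (cmod (h x))\<^sup>2 \<partial>M) \<le> ennreal (max A 0)" .
    then show "(\<integral>x. (cmod (h x))\<^sup>2 \<partial>M) \<le> max A 0" by (simp add: ennreal_le_iff)
  qed
  have FA: "(\<integral>\<^sup>+x. ennreal ((cmod (F x))\<^sup>2) \<partial>M) \<le> ennreal A"
    by (rule nn_integral_le_limit[where f = "\<lambda>n x. (cmod (f n x))\<^sup>2" and a = "\<lambda>_. A"])
       (use lim bnd in \<open>auto intro!: tendsto_intros elim!: eventually_mono\<close>)
  define d where "d n x = cmod (f n x - F x)" for n x
  have [measurable]: "d n \<in> borel_measurable M" for n unfolding d_def by measurable
  have d2le: "(d n x)\<^sup>2 \<le> 2 * (cmod (f n x))\<^sup>2 + 2 * (cmod (F x))\<^sup>2" for n x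
  proof -
    have "d n x \<le> cmod (f n x) + cmod (F x)" unfolding d_def by (rule norm_triangle_ineq4)
    then have "(d n x)\<^sup>2 \<le> (cmod (f n x) + cmod (F x))\<^sup>2" by (intro power_mono) (auto simp: d_def)
    also have "\<dots> \<le> 2 * (cmod (f n x))\<^sup>2 + 2 * (cmod (F x))\<^sup>2"
      using zero_le_power2[of "cmod (f n x) - cmod (F x)"] by (simp add: power2_sum power2_diff)
    finally show ?thesis .
  qed
  have d2i: "integrable M (\<lambda>x. (d n x)\<^sup>2)" for n
    by (rule Bochner_Integration.integrable_bound[of M "\<lambda>x. 2 * (cmod (f n x))\<^sup>2 + 2 * (cmod (F x))\<^sup>2"])
       (use L2(1)[OF f bnd] L2(1)[OF F FA] d2le in auto)
  have d2: "(\<integral>x. (d n x)\<^sup>2 \<partial>M) \<le> 4 * max A 0" for n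
  proof -
    have "(\<integral>x. (d n x)\<^sup>2 \<partial>M) \<le> (\<integral>x. 2 * (cmod (f n x))\<^sup>2 + 2 * (cmod (F x))\<^sup>2 \<partial>M)"
      by (intro Bochner_Integration.integral_mono d2i d2le) (use L2(1)[OF f bnd] L2(1)[OF F FA] in auto)
    also have "\<dots> \<le> 4 * max A 0" using L2[OF f bnd, of n] L2[OF F FA] by simp
    finally show ?thesis .
  qed
  have mini: "integrable M (\<lambda>x. min (d n x) k)" if "0 \<le> k" for n k
    using that by (intro integrable_const_bound[of _ k]) (auto simp: d_def min_def)
  have di: "integrable M (d n)" for n
  proof (rule Bochner_Integration.integrable_bound[of M "\<lambda>x. 1 + (d n x)\<^sup>2"])
    have "0 \<le> d n x" "0 \<le> (d n x)\<^sup>2" for x by (simp_all add: d_def)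
    then show "AE x in M. norm (d n x) \<le> norm (1 + (d n x)\<^sup>2)"
      by (intro AE_I2) (simp add: le_1_plus_power2)
  qed (use d2i in auto)
  have dlim: "(\<lambda>n. \<integral>x. d n x \<partial>M) \<longlonglongrightarrow> 0"
  proof (rule LIMSEQ_I)
    fix e :: real assume e: "0 < e"
    \<comment> \<open>With this truncation level the tail \<open>4 * max A 0 / k\<close> is at most
      \<open>e / 2\<close>; the summand \<open>1\<close> keeps \<open>k\<close> positive. Dominated
      convergence handles the truncated part.\<close>
    define k where "k = 8 * (max A 0 + 1) / e"
    have k: "0 < k" using e by (simp add: k_def add_nonneg_pos)
    have "(\<lambda>n. \<integral>x. min (d n x) k \<partial>M) \<longlonglongrightarrow> (\<integral>x. 0 \<partial>M)"
    proof (rule integral_dominated_convergence[where w = "\<lambda>_. k"])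
      show "AE x in M. (\<lambda>n. min (d n x) k) \<longlonglongrightarrow> 0"
        using lim
      proof eventually_elim
        case (elim x)
        then have "(\<lambda>n. d n x) \<longlonglongrightarrow> cmod (F x - F x)" unfolding d_def by (intro tendsto_intros)
        then have "(\<lambda>n. min (d n x) k) \<longlonglongrightarrow> min 0 k" by (intro tendsto_min) auto
        then show ?case using k by simp
      qed
      show "AE x in M. norm (min (d n x) k) \<le> k" for n using k by (auto simp: d_def min_def)
    qed auto
    then have "\<exists>N. \<forall>n\<ge>N. norm ((\<integral>x. min (d n x) k \<partial>M) - (\<integral>x. 0 \<partial>M)) < e / 2"
      by (rule LIMSEQ_D) (use e in simp)
    then obtain N where N: "\<And>n. n \<ge> N \<Longrightarrow> \<bar>\<integral>x. min (d n x) k \<partial>M\<bar> < e / 2"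
      by auto
    show "\<exists>N. \<forall>n\<ge>N. norm ((\<integral>x. d n x \<partial>M) - 0) < e"
    proof (intro exI[of _ N] allI impI)
      fix n assume n: "n \<ge> N"
      have "(\<integral>x. d n x \<partial>M) \<le> (\<integral>x. min (d n x) k + (d n x)\<^sup>2 / k \<partial>M)"
      proof (intro Bochner_Integration.integral_mono di Bochner_Integration.integrable_add mini integrable_divide d2i)
        fix x
        show "d n x \<le> min (d n x) k + (d n x)\<^sup>2 / k"
        proof (cases "d n x \<le> k")
          case False
          then have "d n x * k \<le> d n x * d n x" using k by (intro mult_left_mono) auto
          then have "d n x \<le> (d n x)\<^sup>2 / k" using k by (simp add: field_simps power2_eq_square)
          then show ?thesis using False k by simp
        qed (use k in \<open>simp add: min_def\<close>)
      qed (use k in auto)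
      also have "\<dots> = (\<integral>x. min (d n x) k \<partial>M) + (\<integral>x. (d n x)\<^sup>2 \<partial>M) / k"
        using mini[of k n] k d2i by simp
      also have "\<dots> < e / 2 + e / 2"
      proof (intro add_less_le_mono)
        show "(\<integral>x. min (d n x) k \<partial>M) < e / 2" using N[OF n] by linarith
        have "(\<integral>x. (d n x)\<^sup>2 \<partial>M) / k \<le> 4 * (max A 0 + 1) / k"
          using d2[of n] k by (intro divide_right_mono) auto
        also have "\<dots> = e / 2" using e by (simp add: k_def field_simps add_nonneg_pos less_imp_neq[THEN not_sym])
        finally show "(\<integral>x. (d n x)\<^sup>2 \<partial>M) / k \<le> e / 2" .
      qed
      finally have "(\<integral>x. d n x \<partial>M) < e" by simp
      moreover have "0 \<le> (\<integral>x. d n x \<partial>M)" by (intro Bochner_Integration.integral_nonneg) (simp add: d_def)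
      ultimately show "norm ((\<integral>x. d n x \<partial>M) - 0) < e" by simp
    qed
  qed
  have L1: "integrable M (\<lambda>x. h x * g x)" if h: "h \<in> borel_measurable M" "integrable M (\<lambda>x. (cmod (h x))\<^sup>2)" for h
  proof (rule Bochner_Integration.integrable_bound[of M "\<lambda>x. (1 + (cmod (h x))\<^sup>2) * \<bar>B\<bar>"])
    show "AE x in M. norm (h x * g x) \<le> norm ((1 + (cmod (h x))\<^sup>2) * \<bar>B\<bar>)"
    proof (intro AE_I2)
      fix x assume x: "x \<in> space M"
      have "cmod (h x) \<le> 1 + (cmod (h x))\<^sup>2"
        by (rule le_1_plus_power2)
      then have "cmod (h x) * cmod (g x) \<le> (1 + (cmod (h x))\<^sup>2) * \<bar>B\<bar>"
        using g(2)[OF x] by (intro mult_mono) auto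
      then show "norm (h x * g x) \<le> norm ((1 + (cmod (h x))\<^sup>2) * \<bar>B\<bar>)" by (simp add: norm_mult abs_mult)
    qed
  qed (use h in auto)
  have diff: "cmod ((\<integral>x. f n x * g x \<partial>M) - (\<integral>x. F x * g x \<partial>M)) \<le> (\<integral>x. d n x \<partial>M) * \<bar>B\<bar>" for n
  proof -
    have i: "integrable M (\<lambda>x. f n x * g x)" "integrable M (\<lambda>x. F x * g x)"
      by (intro L1 L2(1) f F bnd FA)+
    have "cmod ((\<integral>x. f n x * g x \<partial>M) - (\<integral>x. F x * g x \<partial>M)) = cmod (\<integral>x. f n x * g x - F x * g x \<partial>M)"
      using i by simp
    also have "\<dots> \<le> (\<integral>x. cmod (f n x * g x - F x * g x) \<partial>M)" by (rule integral_norm_bound)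
    also have "\<dots> \<le> (\<integral>x. d n x * \<bar>B\<bar> \<partial>M)"
    proof (intro Bochner_Integration.integral_mono)
      fix x assume x: "x \<in> space M"
      have "cmod (f n x * g x - F x * g x) = d n x * cmod (g x)"
        unfolding d_def norm_mult[symmetric] by (simp add: algebra_simps)
      also have "\<dots> \<le> d n x * \<bar>B\<bar>" using g(2)[OF x] by (intro mult_left_mono) (auto simp: d_def)
      finally show "cmod (f n x * g x - F x * g x) \<le> d n x * \<bar>B\<bar>" .
    qed (use i di in auto)
    finally show ?thesis by simp
  qed
  have lim0: "(\<lambda>n. (\<integral>x. d n x \<partial>M) * \<bar>B\<bar>) \<longlonglongrightarrow> 0"
    using tendsto_mult_right[OF dlim, of "\<bar>B\<bar>"] by simp
  have "(\<lambda>n. cmod ((\<integral>x. f n x * g x \<partial>M) - (\<integral>x. F x * g x \<partial>M))) \<longlonglongrightarrow> 0"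
    by (rule Lim_null_comparison[OF always_eventually lim0]) (use diff in simp)
  then show ?thesis by (rule LIM_zero_cancel[OF tendsto_norm_zero_cancel])
qed

section \<open>The space \<open>\<H>(b)\<close>\<close>

text \<open>The \<open>H^2\<close> counterpart of \<open>kcomb\<close>, not cut off outside the open
  disk because it is integrated over the circle.\<close>

definition szego_comb :: "complex set \<Rightarrow> (complex \<Rightarrow> complex) \<Rightarrow> complex \<Rightarrow> complex" where
  "szego_comb S c z = (\<Sum>w\<in>S. c w * szego w z)"

lemma continuous_on_szego_comb:
  assumes "S \<subseteq> ball 0 1" "A \<subseteq> cball 0 1"
  shows "continuous_on A (szego_comb S c)"
  unfolding szego_comb_def by (intro continuous_intros) (use assms in auto)

lemma holomorphic_on_szego_comb:
  assumes "S \<subseteq> ball 0 1"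
  shows "szego_comb S c holomorphic_on ball 0 1"
  unfolding szego_comb_def by (intro holomorphic_intros holomorphic_on_szego) (use assms in auto)

lemma integral_cnj_szego_comb:
  assumes u: "continuous_on (cball 0 1) u" "u holomorphic_on ball 0 1" and S: "S \<subseteq> ball 0 1"
  shows "(\<integral>z. u z * cnj (szego_comb S c z) \<partial>\<sigma>) = (\<Sum>w\<in>S. cnj (c w) * u w)"
proof -
  have uc: "continuous_on (sphere 0 1) u" by (rule continuous_on_subset[OF u(1)]) auto
  have i: "integrable \<sigma> (\<lambda>z. u z * cnj (szego w z))" if "w \<in> S" for w
    using that S by (intro integrable_circleI continuous_intros uc) auto
  have "(\<integral>z. u z * cnj (szego_comb S c z) \<partial>\<sigma>) =
      (\<integral>z. (\<Sum>w\<in>S. cnj (c w) * (u z * cnj (szego w z))) \<partial>\<sigma>)"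
    by (simp add: szego_comb_def sum_distrib_left mult_ac)
  also have "\<dots> = (\<Sum>w\<in>S. \<integral>z. cnj (c w) * (u z * cnj (szego w z)) \<partial>\<sigma>)"
    by (intro Bochner_Integration.integral_sum integrable_mult_right i)
  also have "\<dots> = (\<Sum>w\<in>S. cnj (c w) * u w)"
    using S by (intro sum.cong refl) (auto simp: circle_Cauchy_integral[OF u])
  finally show ?thesis .
qed

text \<open>The squared norm of \<open>\<Sum>w\<in>S. c w * kb f w\<close> in \<open>\<H>(f)\<close>.\<close>

definition kb_form :: "(complex \<Rightarrow> complex) \<Rightarrow> complex set \<Rightarrow> (complex \<Rightarrow> complex) \<Rightarrow> real" where
  "kb_form f S c = Re (\<Sum>v\<in>S. \<Sum>w\<in>S. cnj (c v) * c w * ((1 - cnj (f w) * f v) * szego w v))"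

context
  fixes f :: "complex \<Rightarrow> complex" and S :: "complex set" and c :: "complex \<Rightarrow> complex"
  assumes fc: "continuous_on (cball 0 1) f" and fh: "f holomorphic_on ball 0 1"
    and f1: "\<And>z. z \<in> cball 0 1 \<Longrightarrow> cmod (f z) \<le> 1" and S: "S \<subseteq> ball 0 1"
begin

private definition "G = szego_comb S c"
text \<open>The adjoint of multiplication by \<open>f\<close> on \<open>H^2\<close> takes
  \<open>szego w\<close> to \<open>cnj (f w) * szego w\<close>; hence the changed
  coefficients.\<close>

private definition "G2 = szego_comb S (\<lambda>w. c w * cnj (f w))"

private lemma Gc: "A \<subseteq> cball 0 1 \<Longrightarrow> continuous_on A G"
  unfolding G_def by (rule continuous_on_szego_comb[OF S])

private lemma G2c: "A \<subseteq> cball 0 1 \<Longrightarrow> continuous_on A G2"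
  unfolding G2_def by (rule continuous_on_szego_comb[OF S])

private lemma Gs: "continuous_on (sphere 0 1) G" "continuous_on (sphere 0 1) G2" "continuous_on (sphere 0 1) f"
  by (rule Gc G2c continuous_on_subset[OF fc], force)+

private lemma Gh: "G holomorphic_on ball 0 1" "G2 holomorphic_on ball 0 1"
  unfolding G_def G2_def by (rule holomorphic_on_szego_comb[OF S])+

private lemma int_Re:
  assumes "continuous_on (sphere 0 1) u"
  shows "(\<integral>z. Re (u z) \<partial>\<sigma>) = Re (\<integral>z. u z \<partial>\<sigma>)"
  by (rule integral_bounded_linear[OF bounded_linear_Re integrable_circleI[OF assms]])

private lemma norm_G: "(\<integral>z. (cmod (G z))\<^sup>2 \<partial>\<sigma>) = Re (\<Sum>v\<in>S. \<Sum>w\<in>S. cnj (c v) * c w * szego w v)"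
proof -
  have "(\<integral>z. (cmod (G z))\<^sup>2 \<partial>\<sigma>) = (\<integral>z. Re (G z * cnj (G z)) \<partial>\<sigma>)"
    by (simp add: complex_norm_square[symmetric])
  also have "\<dots> = Re (\<integral>z. G z * cnj (szego_comb S c z) \<partial>\<sigma>)"
    unfolding G_def[symmetric] by (intro int_Re continuous_intros Gs)
  also have "(\<integral>z. G z * cnj (szego_comb S c z) \<partial>\<sigma>) = (\<Sum>v\<in>S. cnj (c v) * G v)"
    by (intro integral_cnj_szego_comb Gc Gh S order_refl)
  finally show ?thesis by (simp add: G_def szego_comb_def sum_distrib_left mult.assoc)
qed

private lemma cross_G2: "(\<integral>z. f z * G2 z * cnj (G z) \<partial>\<sigma>) =
    (\<Sum>v\<in>S. \<Sum>w\<in>S. cnj (c v) * c w * (cnj (f w) * f v * szego w v))"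
proof -
  have "(\<integral>z. f z * G2 z * cnj (szego_comb S c z) \<partial>\<sigma>) = (\<Sum>v\<in>S. cnj (c v) * (f v * G2 v))"
    by (intro integral_cnj_szego_comb continuous_intros holomorphic_intros fc fh G2c Gh S order_refl)
  then show ?thesis
    by (simp add: G_def G2_def szego_comb_def sum_distrib_left mult_ac)
qed

text \<open>This is the adjoint relation between \<open>G\<close> and \<open>G2\<close>, paired with
  \<open>G2\<close>. The Cauchy formula reduces both sides to the same double sum, so no operator on
  \<open>H^2\<close> has to be constructed.\<close>

private lemma norm_G2: "(\<integral>z. (cmod (G2 z))\<^sup>2 \<partial>\<sigma>) = Re (\<integral>z. f z * G2 z * cnj (G z) \<partial>\<sigma>)"
proof -
  have "(\<integral>z. (cmod (G2 z))\<^sup>2 \<partial>\<sigma>) = (\<integral>z. Re (G2 z * cnj (G2 z)) \<partial>\<sigma>)"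
    by (simp add: complex_norm_square[symmetric])
  also have "\<dots> = Re (\<integral>z. G2 z * cnj (szego_comb S (\<lambda>w. c w * cnj (f w)) z) \<partial>\<sigma>)"
    unfolding G2_def[symmetric] by (intro int_Re continuous_intros Gs)
  also have "(\<integral>z. G2 z * cnj (szego_comb S (\<lambda>w. c w * cnj (f w)) z) \<partial>\<sigma>) = (\<Sum>v\<in>S. cnj (c v * cnj (f v)) * G2 v)"
    by (intro integral_cnj_szego_comb G2c Gh S order_refl)
  also have "\<dots> = (\<integral>z. f z * G2 z * cnj (G z) \<partial>\<sigma>)"
    unfolding cross_G2 by (simp add: G2_def szego_comb_def sum_distrib_left mult_ac)
  finally show ?thesis .
qed

private lemma form_eq: "kb_form f S c = (\<integral>z. (cmod (G z))\<^sup>2 \<partial>\<sigma>) - (\<integral>z. (cmod (G2 z))\<^sup>2 \<partial>\<sigma>)"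
  unfolding norm_G norm_G2 cross_G2 kb_form_def minus_complex.sel(1)[symmetric] sum_subtractf[symmetric]
  by (simp add: algebra_simps del: minus_complex.sel)

text \<open>\<open>G2\<close> is the image of \<open>G\<close> under the adjoint of multiplication by \<open>f\<close>, so \<^const>\<open>kb_form\<close> is
  \<open>\<parallel>G\<parallel>\<^sup>2 - \<parallel>G2\<parallel>\<^sup>2\<close> in \<open>H\<^sup>2\<close>.\<close>

lemma weighted_norm_le_kb_form:
  "(\<integral>z. (1 - (cmod (f z))\<^sup>2) * (cmod (szego_comb S c z))\<^sup>2 \<partial>\<sigma>) \<le> kb_form f S c"
proof -
  have i: "integrable \<sigma> (\<lambda>z. (cmod (G z))\<^sup>2)" "integrable \<sigma> (\<lambda>z. (cmod (G2 z))\<^sup>2)"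
    "integrable \<sigma> (\<lambda>z. (cmod (f z))\<^sup>2 * (cmod (G z))\<^sup>2)"
    "integrable \<sigma> (\<lambda>z. Re (f z * G2 z * cnj (G z)))"
    by (intro integrable_circleI continuous_intros Gs)+
  \<comment> \<open>The contractivity of the projection, in elementary form:
    \<open>2 * \<parallel>G2\<parallel>^2\<close> equals the integral of
    \<open>2 * Re (f * G2 * cnj G)\<close>, which is at most
    \<open>\<parallel>G2\<parallel>^2 + \<parallel>f * G\<parallel>^2\<close>; hence
    \<open>\<parallel>G2\<parallel> \<le> \<parallel>f * G\<parallel>\<close>.\<close>
  have "2 * (\<integral>z. (cmod (G2 z))\<^sup>2 \<partial>\<sigma>) = (\<integral>z. 2 * Re (f z * G2 z * cnj (G z)) \<partial>\<sigma>)"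
    unfolding norm_G2 using int_Re[of "\<lambda>z. f z * G2 z * cnj (G z)"]
    by (simp add: Gs continuous_intros del: times_complex.sel)
  also have "\<dots> \<le> (\<integral>z. (cmod (G2 z))\<^sup>2 + (cmod (f z))\<^sup>2 * (cmod (G z))\<^sup>2 \<partial>\<sigma>)"
  proof (intro Bochner_Integration.integral_mono Bochner_Integration.integrable_add integrable_mult_right i)
    fix z
    have "Re (f z * G2 z * cnj (G z)) \<le> cmod (f z * G2 z * cnj (G z))" by (rule complex_Re_le_cmod)
    also have "\<dots> = cmod (G2 z) * (cmod (f z) * cmod (G z))" by (simp add: norm_mult)
    finally have "2 * Re (f z * G2 z * cnj (G z)) \<le> 2 * cmod (G2 z) * (cmod (f z) * cmod (G z))" by simp
    also have "\<dots> \<le> (cmod (G2 z))\<^sup>2 + (cmod (f z) * cmod (G z))\<^sup>2" by (rule sum_squares_bound)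
    finally show "2 * Re (f z * G2 z * cnj (G z)) \<le> (cmod (G2 z))\<^sup>2 + (cmod (f z))\<^sup>2 * (cmod (G z))\<^sup>2"
      by (simp add: power_mult_distrib)
  qed
  also have "\<dots> = (\<integral>z. (cmod (G2 z))\<^sup>2 \<partial>\<sigma>) + (\<integral>z. (cmod (f z))\<^sup>2 * (cmod (G z))\<^sup>2 \<partial>\<sigma>)"
    by (intro Bochner_Integration.integral_add i)
  finally have "(\<integral>z. (cmod (G z))\<^sup>2 \<partial>\<sigma>) - (\<integral>z. (cmod (f z))\<^sup>2 * (cmod (G z))\<^sup>2 \<partial>\<sigma>) \<le> kb_form f S c"
    unfolding form_eq by simp
  then show ?thesis
    unfolding G_def[symmetric] using i by (simp add: left_diff_distrib)
qed

text \<open>The integrand is the kernel sum for \<open>f\<close>, continued to the circle. Expanding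
  the square and using \<open>|f| \<le> 1\<close> leaves \<open>\<parallel>G\<parallel>^2 - 2 *
  \<parallel>G2\<parallel>^2 + \<parallel>G2\<parallel>^2\<close>, which is the form. This is the
  source of the contractive inclusion in \<open>H^2\<close>.\<close>

lemma norm_kb_comb_le_kb_form:
  "(\<integral>z. (cmod (szego_comb S c z - f z * szego_comb S (\<lambda>w. c w * cnj (f w)) z))\<^sup>2 \<partial>\<sigma>) \<le> kb_form f S c"
proof -
  have i: "integrable \<sigma> (\<lambda>z. (cmod (G z))\<^sup>2)" "integrable \<sigma> (\<lambda>z. (cmod (G2 z))\<^sup>2)"
    "integrable \<sigma> (\<lambda>z. (cmod (G z - f z * G2 z))\<^sup>2)"
    "integrable \<sigma> (\<lambda>z. 2 * Re (f z * G2 z * cnj (G z)))"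
    by (intro integrable_circleI continuous_intros Gs)+
  have "(\<integral>z. (cmod (G z - f z * G2 z))\<^sup>2 \<partial>\<sigma>) \<le>
      (\<integral>z. (cmod (G z))\<^sup>2 - 2 * Re (f z * G2 z * cnj (G z)) + (cmod (G2 z))\<^sup>2 \<partial>\<sigma>)"
  proof (intro Bochner_Integration.integral_mono Bochner_Integration.integrable_add Bochner_Integration.integrable_diff i)
    fix z assume "z \<in> space \<sigma>"
    then have "cmod (f z) * cmod (G2 z) \<le> 1 * cmod (G2 z)" by (intro mult_right_mono f1) auto
    then have "(cmod (f z * G2 z))\<^sup>2 \<le> (cmod (G2 z))\<^sup>2" by (intro power_mono) (auto simp: norm_mult)
    moreover have "(cmod (a - x))\<^sup>2 = (cmod a)\<^sup>2 - 2 * Re (x * cnj a) + (cmod x)\<^sup>2" for a x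
      unfolding cmod_power2 by (simp add: power2_eq_square algebra_simps)
    ultimately show "(cmod (G z - f z * G2 z))\<^sup>2 \<le> (cmod (G z))\<^sup>2 - 2 * Re (f z * G2 z * cnj (G z)) + (cmod (G2 z))\<^sup>2"
      by simp
  qed
  also have "\<dots> = (\<integral>z. (cmod (G z))\<^sup>2 - 2 * Re (f z * G2 z * cnj (G z)) \<partial>\<sigma>) + (\<integral>z. (cmod (G2 z))\<^sup>2 \<partial>\<sigma>)"
    by (intro Bochner_Integration.integral_add Bochner_Integration.integrable_diff i)
  also have "(\<integral>z. (cmod (G z))\<^sup>2 - 2 * Re (f z * G2 z * cnj (G z)) \<partial>\<sigma>) =
      (\<integral>z. (cmod (G z))\<^sup>2 \<partial>\<sigma>) - (\<integral>z. 2 * Re (f z * G2 z * cnj (G z)) \<partial>\<sigma>)"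
    by (intro Bochner_Integration.integral_diff i)
  also have "(\<integral>z. 2 * Re (f z * G2 z * cnj (G z)) \<partial>\<sigma>) = 2 * (\<integral>z. (cmod (G2 z))\<^sup>2 \<partial>\<sigma>)"
    unfolding norm_G2 using int_Re[of "\<lambda>z. f z * G2 z * cnj (G z)"]
    by (simp add: Gs continuous_intros del: times_complex.sel)
  finally have "(\<integral>z. (cmod (G z - f z * G2 z))\<^sup>2 \<partial>\<sigma>) \<le> kb_form f S c"
    unfolding form_eq by simp
  then show ?thesis by (simp only: G_def G2_def)
qed

end

section \<open>Passage from dilates of \<open>b\<close> to \<open>b\<close> itself\<close>

definition rad :: "nat \<Rightarrow> real" where
  "rad n = 1 - 1 / Suc (Suc n)"

lemma rad: "0 \<le> rad n" "rad n < 1" "rad \<longlonglongrightarrow> 1"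
proof -
  have "(\<lambda>n. 1 / real (Suc n)) \<longlonglongrightarrow> 0"
    using LIMSEQ_inverse_real_of_nat by (simp only: inverse_eq_divide)
  then have "(\<lambda>n. 1 / real (Suc (Suc n))) \<longlonglongrightarrow> 0" by (rule LIMSEQ_Suc)
  then have "(\<lambda>n. 1 - 1 / real (Suc (Suc n))) \<longlonglongrightarrow> 1 - 0" by (rule tendsto_diff[OF tendsto_const])
  then show "rad \<longlonglongrightarrow> 1" unfolding rad_def[abs_def] diff_0_right .
qed (auto simp: rad_def)

lemma nt_ext_rad: "\<zeta> \<in> nt_points f \<Longrightarrow> (\<lambda>n. f (of_real (rad n) * \<zeta>)) \<longlonglongrightarrow> nt_ext f \<zeta>"
  unfolding rad_def by (rule nt_ext_radial)

lemma holomorphic_rad_tendsto: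
  assumes "f holomorphic_on ball 0 1" "cmod z < 1"
  shows "(\<lambda>n. f (of_real (rad n) * z)) \<longlonglongrightarrow> f z"
proof (rule isCont_tendsto_compose[where g = f])
  show "isCont f z"
    using holomorphic_on_imp_continuous_on[OF assms(1)] assms(2) by (simp add: continuous_on_eq_continuous_at)
  have "(\<lambda>n. of_real (rad n) * z) \<longlonglongrightarrow> of_real 1 * z" by (intro tendsto_intros rad)
  then show "(\<lambda>n. of_real (rad n) * z) \<longlonglongrightarrow> z" by simp
qed

locale dBR = rkhs "ball 0 1" "kb b" H ip
  for b :: "complex \<Rightarrow> complex" and H :: "(complex \<Rightarrow> complex) set"
    and ip :: "(complex \<Rightarrow> complex) \<Rightarrow> (complex \<Rightarrow> complex) \<Rightarrow> complex" +
  assumes b: "b \<in> Hinf_ball" and hol: "f \<in> H \<Longrightarrow> f holomorphic_on ball 0 1"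
begin

lemma bh: "b holomorphic_on ball 0 1" and b1: "z \<in> ball 0 1 \<Longrightarrow> cmod (b z) \<le> 1"
  using b by (auto simp: Hinf_ball_def)

lemma kz_eq: "kz w = kb b w"
  by (auto simp: kz_def kb_def)

lemma nrm_eq: "nrm f = ip_norm ip f"
  by (simp add: nrm_def ip_norm_def)

lemma dil: "continuous_on (cball 0 1) (\<lambda>z. b (of_real (rad n) * z))"
  "(\<lambda>z. b (of_real (rad n) * z)) holomorphic_on ball 0 1"
  "z \<in> cball 0 1 \<Longrightarrow> cmod (b (of_real (rad n) * z)) \<le> 1"
  using rad(1,2)[of n] by (auto intro: continuous_on_dilate holomorphic_on_dilate bh b1 dilate_in_ball)

lemma kb_form_eq: "finite S \<Longrightarrow> S \<subseteq> ball 0 1 \<Longrightarrow> kb_form b S c = (nrm (kcomb S c))\<^sup>2"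
  unfolding nrm_kcomb kb_form_def
  by (intro arg_cong[where f = Re] sum.cong refl) (auto simp: kb_def szego_def)

text \<open>Only the values of \<open>b\<close> at the finitely many interior points of
  \<open>S\<close> enter the form, so the limit does not involve the boundary behaviour of
  \<open>b\<close>.\<close>

lemma kb_form_rad_tendsto:
  assumes "finite S" "S \<subseteq> ball 0 1"
  shows "(\<lambda>n. kb_form (\<lambda>z. b (of_real (rad n) * z)) S c) \<longlonglongrightarrow> (nrm (kcomb S c))\<^sup>2"
  unfolding kb_form_eq[OF assms, symmetric] kb_form_def
  by (intro tendsto_intros holomorphic_rad_tendsto bh) (use assms in auto)

lemma weighted_norm_le:
  assumes S: "finite S" "S \<subseteq> ball 0 1" and ae: "AE \<zeta> in \<sigma>. \<zeta> \<in> nt_points b"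
  shows "(\<integral>\<^sup>+z. ennreal ((1 - (cmod (nt_ext b z))\<^sup>2) * (cmod (szego_comb S c z))\<^sup>2) \<partial>\<sigma>)
      \<le> ennreal ((nrm (kcomb S c))\<^sup>2)"
proof (rule nn_integral_le_limit[OF _ _ _ kb_form_rad_tendsto[OF S]])
  fix n
  have co: "continuous_on (sphere 0 1) (\<lambda>z. (1 - (cmod (b (of_real (rad n) * z)))\<^sup>2) * (cmod (szego_comb S c z))\<^sup>2)"
    by (intro continuous_intros continuous_on_szego_comb S continuous_on_subset[OF dil(1)]) auto
  then show "(\<lambda>z. (1 - (cmod (b (of_real (rad n) * z)))\<^sup>2) * (cmod (szego_comb S c z))\<^sup>2) \<in> borel_measurable \<sigma>"
    by (rule borel_measurable_circleI)
  have "(\<integral>\<^sup>+z. ennreal ((1 - (cmod (b (of_real (rad n) * z)))\<^sup>2) * (cmod (szego_comb S c z))\<^sup>2) \<partial>\<sigma>) =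
      ennreal (\<integral>z. (1 - (cmod (b (of_real (rad n) * z)))\<^sup>2) * (cmod (szego_comb S c z))\<^sup>2 \<partial>\<sigma>)"
    using co by (rule nn_integral_circle_eq_integral) (use dil(3) in \<open>auto intro!: mult_nonneg_nonneg simp: power_le_one\<close>)
  also have "\<dots> \<le> ennreal (kb_form (\<lambda>z. b (of_real (rad n) * z)) S c)"
    by (intro ennreal_leI weighted_norm_le_kb_form dil S)
  finally show "(\<integral>\<^sup>+z. ennreal ((1 - (cmod (b (of_real (rad n) * z)))\<^sup>2) * (cmod (szego_comb S c z))\<^sup>2) \<partial>\<sigma>)
      \<le> ennreal (kb_form (\<lambda>z. b (of_real (rad n) * z)) S c)" .
next
  show "AE z in \<sigma>. (\<lambda>n. (1 - (cmod (b (of_real (rad n) * z)))\<^sup>2) * (cmod (szego_comb S c z))\<^sup>2)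
      \<longlonglongrightarrow> (1 - (cmod (nt_ext b z))\<^sup>2) * (cmod (szego_comb S c z))\<^sup>2"
    using ae by eventually_elim (intro tendsto_intros nt_ext_rad)
qed

text \<open>Two radii are in play: \<open>rad n\<close> dilates \<open>b\<close> and makes
  \<open>F n\<close> continuous on the closed disk, while \<open>r\<close> dilates the argument. The
  second dilation does not increase square means, and at interior points \<open>F n\<close>
  converges to the kernel sum of \<open>b\<close>, so \<open>n\<close> can tend to infinity with
  \<open>r\<close> fixed.\<close>

lemma L2_mean_le_kcomb:
  assumes S: "finite S" "S \<subseteq> ball 0 1" and r: "0 \<le> r" "r < 1"
  shows "(\<integral>\<^sup>+z. ennreal ((cmod (kcomb S c (of_real r * z)))\<^sup>2) \<partial>\<sigma>) \<le> ennreal ((nrm (kcomb S c))\<^sup>2)"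
proof (rule nn_integral_le_limit[OF _ _ _ kb_form_rad_tendsto[OF S]])
  define F where "F n z = szego_comb S c z - b (of_real (rad n) * z) * szego_comb S (\<lambda>w. c w * cnj (b (of_real (rad n) * w))) z" for n z
  have Fc: "continuous_on A (F n)" if "A \<subseteq> cball 0 1" for A n
    unfolding F_def by (intro continuous_intros continuous_on_szego_comb S that continuous_on_subset[OF dil(1) that])
  have Fh: "F n holomorphic_on ball 0 1" for n
    unfolding F_def by (intro holomorphic_intros holomorphic_on_szego_comb S dil)
  fix n
  show "(\<lambda>z. (cmod (F n (of_real r * z)))\<^sup>2) \<in> borel_measurable \<sigma>"
    by (intro borel_measurable_circleI continuous_intros continuous_on_subset[OF continuous_on_dilate[OF Fh r]]) auto
  have "(\<integral>\<^sup>+z. ennreal ((cmod (F n (of_real r * z)))\<^sup>2) \<partial>\<sigma>) \<le> (\<integral>\<^sup>+z. ennreal ((cmod (F n z))\<^sup>2) \<partial>\<sigma>)"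
    by (intro L2_mean_dilate_le Fc Fh r order_refl)
  also have "\<dots> = ennreal (\<integral>z. (cmod (F n z))\<^sup>2 \<partial>\<sigma>)"
    by (intro nn_integral_circle_eq_integral continuous_intros Fc) auto
  also have "\<dots> \<le> ennreal (kb_form (\<lambda>z. b (of_real (rad n) * z)) S c)"
    unfolding F_def by (intro ennreal_leI norm_kb_comb_le_kb_form dil S)
  finally show "(\<integral>\<^sup>+z. ennreal ((cmod (F n (of_real r * z)))\<^sup>2) \<partial>\<sigma>) \<le> ennreal (kb_form (\<lambda>z. b (of_real (rad n) * z)) S c)" .
  show "AE z in \<sigma>. (\<lambda>n. (cmod (F n (of_real r * z)))\<^sup>2) \<longlonglongrightarrow> (cmod (kcomb S c (of_real r * z)))\<^sup>2"
  proof (rule AE_I2)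
    fix z assume "z \<in> space \<sigma>"
    then have z: "cmod (of_real r * z) < 1" using dilate_in_ball[OF r, of z] by simp
    define y where "y = of_real r * z"
    have "(\<lambda>n. F n y) \<longlonglongrightarrow> szego_comb S c y - b y * szego_comb S (\<lambda>w. c w * cnj (b w)) y"
      using z S(2) unfolding F_def szego_comb_def y_def by (intro tendsto_intros holomorphic_rad_tendsto bh) auto
    also have "szego_comb S c y - b y * szego_comb S (\<lambda>w. c w * cnj (b w)) y = kcomb S c y"
      using z unfolding szego_comb_def kcomb_def kz_eq y_def[symmetric] sum_distrib_left sum_subtractf[symmetric]
      by (intro sum.cong refl) (simp add: kb_def szego_def algebra_simps diff_divide_distrib)
    finally show "(\<lambda>n. (cmod (F n (of_real r * z)))\<^sup>2) \<longlonglongrightarrow> (cmod (kcomb S c (of_real r * z)))\<^sup>2"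
      unfolding y_def by (intro tendsto_intros)
  qed
qed

text \<open>Norm approximation by kernel sums is also pointwise on the disk, since point evaluations
  are bounded; Fatou's lemma then extends the bound from the span to \<open>H\<close>.\<close>

lemma L2_mean_le:
  assumes f: "f \<in> H" and r: "0 \<le> r" "r < 1"
  shows "(\<integral>\<^sup>+z. ennreal ((cmod (f (of_real r * z)))\<^sup>2) \<partial>\<sigma>) \<le> ennreal ((nrm f)\<^sup>2)"
proof -
  obtain g where g: "\<And>n. g n \<in> kspan" "(\<lambda>n. nrm (\<lambda>z. f z - g n z)) \<longlonglongrightarrow> 0"
    using kspan_dense_seq[OF f] by blast
  have gH: "g n \<in> H" for n using g kspan_H by blast
  have fg: "(\<lambda>z. f z - g n z) \<in> H" for n using f gH diff_mem by blast
  have tri: "nrm (g n) \<le> nrm f + nrm (\<lambda>z. f z - g n z)" for n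
    by (rule nrm_le_add_diff[OF f gH])
  have "(\<lambda>n. (nrm f + nrm (\<lambda>z. f z - g n z))\<^sup>2) \<longlonglongrightarrow> (nrm f + 0)\<^sup>2"
    by (intro tendsto_intros g)
  then have lim: "(\<lambda>n. (nrm f + nrm (\<lambda>z. f z - g n z))\<^sup>2) \<longlonglongrightarrow> (nrm f)\<^sup>2" by simp
  show ?thesis
  proof (rule nn_integral_le_limit[OF _ _ _ lim])
    fix n
    show "(\<lambda>z. (cmod (g n (of_real r * z)))\<^sup>2) \<in> borel_measurable \<sigma>"
      by (intro borel_measurable_circleI continuous_intros continuous_on_subset[OF continuous_on_dilate[OF hol[OF gH] r]]) auto
    obtain S c where S: "g n = kcomb S c" "finite S" "S \<subseteq> ball 0 1" using g(1)[of n] by (auto simp: kspan_def)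
    have "(\<integral>\<^sup>+z. ennreal ((cmod (g n (of_real r * z)))\<^sup>2) \<partial>\<sigma>) \<le> ennreal ((nrm (g n))\<^sup>2)"
      unfolding S(1) by (rule L2_mean_le_kcomb[OF S(2,3) r])
    also have "\<dots> \<le> ennreal ((nrm f + nrm (\<lambda>z. f z - g n z))\<^sup>2)"
      by (intro ennreal_leI power_mono tri nrm_nonneg gH)
    finally show "(\<integral>\<^sup>+z. ennreal ((cmod (g n (of_real r * z)))\<^sup>2) \<partial>\<sigma>) \<le> ennreal ((nrm f + nrm (\<lambda>z. f z - g n z))\<^sup>2)" .
  next
    show "AE z in \<sigma>. (\<lambda>n. (cmod (g n (of_real r * z)))\<^sup>2) \<longlonglongrightarrow> (cmod (f (of_real r * z)))\<^sup>2"
    proof (rule AE_I2)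
      fix z assume "z \<in> space \<sigma>"
      then have z: "of_real r * z \<in> ball 0 1" by (intro dilate_in_ball r) simp
      have lim0: "(\<lambda>n. nrm (\<lambda>z. f z - g n z) * nrm (kz (of_real r * z))) \<longlonglongrightarrow> 0"
        using tendsto_mult_right[OF g(2)] by simp
      have "(\<lambda>n. f (of_real r * z) - g n (of_real r * z)) \<longlonglongrightarrow> 0"
        by (rule Lim_null_comparison[OF always_eventually lim0]) (use cmod_le_nrm[OF fg z] in simp)
      then have "(\<lambda>n. f (of_real r * z) - (f (of_real r * z) - g n (of_real r * z))) \<longlonglongrightarrow> f (of_real r * z) - 0"
        by (rule tendsto_diff[OF tendsto_const])
      then show "(\<lambda>n. (cmod (g n (of_real r * z)))\<^sup>2) \<longlonglongrightarrow> (cmod (f (of_real r * z)))\<^sup>2"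
        by (intro tendsto_intros) simp
    qed
  qed
qed

lemma nt_ext_circle_measurable:
  assumes "f holomorphic_on ball 0 1"
  shows "nt_ext f \<in> borel_measurable \<sigma>"
proof -
  have "nt_ext f \<in> borel_measurable (restrict_space (restrict_space borel (cball 0 1)) (sphere 0 1))"
    by (intro measurable_restrict_space1 nt_ext_measurable assms)
  moreover have "sets (restrict_space (restrict_space borel (cball 0 1)) (sphere 0 1)) = sets \<sigma>"
    by (auto simp: sets_restrict_restrict_space sets_circle_measure intro!: arg_cong[where f = "\<lambda>A. sets (restrict_space borel A)"])
  ultimately show ?thesis using measurable_cong_sets by blast
qed

text \<open>For dilates of \<open>f\<close> the Cauchy formula turns the integral into a finite sum
  of interior values of \<open>f\<close>. That sum tends to \<open>ip f (kcomb S c)\<close> by the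
  reproducing property, and the integral tends to that of the boundary values because
  \<open>L2_mean_le\<close> bounds the square means of the dilates.\<close>

lemma ip_kcomb_eq_integral:
  assumes f: "f \<in> H" and S: "finite S" "S \<subseteq> ball 0 1" and ae: "AE \<zeta> in \<sigma>. \<zeta> \<in> nt_points f"
  shows "ip f (kcomb S c) = (\<integral>z. nt_ext f z * cnj (szego_comb S c z) \<partial>\<sigma>)"
proof -
  have Gc: "continuous_on (sphere 0 1) (\<lambda>z. cnj (szego_comb S c z))"
    by (intro continuous_intros continuous_on_szego_comb S) auto
  have "bounded ((\<lambda>z. cnj (szego_comb S c z)) ` sphere 0 1)"
    by (rule compact_imp_bounded, rule compact_continuous_image[OF Gc]) auto
  then obtain B where B: "\<And>z. z \<in> sphere 0 1 \<Longrightarrow> cmod (cnj (szego_comb S c z)) \<le> B"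
    unfolding bounded_iff by blast
  have fm: "(\<lambda>z. f (of_real (rad n) * z)) \<in> borel_measurable \<sigma>" for n
    by (intro borel_measurable_circleI continuous_on_subset[OF continuous_on_dilate[OF hol[OF f] rad(1,2)]]) auto
  have "(\<lambda>n. \<integral>z. f (of_real (rad n) * z) * cnj (szego_comb S c z) \<partial>\<sigma>)
      \<longlonglongrightarrow> (\<integral>z. nt_ext f z * cnj (szego_comb S c z) \<partial>\<sigma>)"
  proof (rule tendsto_integral_mult_of_L2_bounded[OF circle.finite_measure_axioms fm nt_ext_circle_measurable[OF hol[OF f]]])
    show "AE x in \<sigma>. (\<lambda>n. f (of_real (rad n) * x)) \<longlonglongrightarrow> nt_ext f x"
      using ae by eventually_elim (rule nt_ext_rad)
    show "(\<integral>\<^sup>+x. ennreal ((cmod (f (of_real (rad n) * x)))\<^sup>2) \<partial>\<sigma>) \<le> ennreal ((nrm f)\<^sup>2)" for n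
      by (intro L2_mean_le f rad)
    show "(\<lambda>z. cnj (szego_comb S c z)) \<in> borel_measurable \<sigma>" by (rule borel_measurable_circleI[OF Gc])
  qed (use B in auto)
  moreover have "(\<integral>z. f (of_real (rad n) * z) * cnj (szego_comb S c z) \<partial>\<sigma>) =
      (\<Sum>w\<in>S. cnj (c w) * f (of_real (rad n) * w))" for n
    by (intro integral_cnj_szego_comb continuous_on_dilate holomorphic_on_dilate hol f rad S)
  moreover have "(\<lambda>n. \<Sum>w\<in>S. cnj (c w) * f (of_real (rad n) * w)) \<longlonglongrightarrow> (\<Sum>w\<in>S. cnj (c w) * f w)"
    by (intro tendsto_intros holomorphic_rad_tendsto hol f) (use S in auto)
  ultimately show ?thesis
    using LIMSEQ_unique by (simp add: ip_kcomb[OF S f]) blast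
qed

text \<open>\<open>W\<close> is a majorant of \<open>1 / (1 - |b|^2)\<close> and may be infinite.
  The Cauchy--Schwarz inequality is carried out as a family of linear estimates with a parameter
  \<open>t\<close>, chosen at the end, since these pass easily through extended integrals.\<close>

theorem nrm_le_weighted_norm:
  assumes f: "f \<in> H" and ae: "AE \<zeta> in \<sigma>. \<zeta> \<in> nt_points f" "AE \<zeta> in \<sigma>. \<zeta> \<in> nt_points b"
    and W: "W \<in> borel_measurable \<sigma>" "AE \<zeta> in \<sigma>. 1 \<le> W \<zeta> * ennreal (1 - (cmod (nt_ext b \<zeta>))\<^sup>2)"
    and le: "(\<integral>\<^sup>+z. ennreal ((cmod (nt_ext f z))\<^sup>2) * W z \<partial>\<sigma>) \<le> ennreal A" and A: "0 \<le> A"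
  shows "nrm f \<le> sqrt A"
proof (rule nrm_le_of_kspan_pairing[OF f])
  fix g assume "g \<in> kspan"
  then obtain S c where S: "g = kcomb S c" "finite S" "S \<subseteq> ball 0 1" by (auto simp: kspan_def)
  define G where "G = szego_comb S c"
  define B where "B z = 1 - (cmod (nt_ext b z))\<^sup>2" for z
  have [measurable]: "nt_ext f \<in> borel_measurable \<sigma>" "nt_ext b \<in> borel_measurable \<sigma>"
    by (intro nt_ext_circle_measurable hol f bh)+
  have [measurable]: "G \<in> borel_measurable \<sigma>" unfolding G_def
    by (intro borel_measurable_circleI continuous_on_szego_comb S) auto
  note [measurable] = W(1)
  have [measurable]: "B \<in> borel_measurable \<sigma>" unfolding B_def by measurable
  define P where "P z = ennreal ((cmod (nt_ext f z))\<^sup>2) * W z" for z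
  define Q where "Q z = ennreal (B z * (cmod (G z))\<^sup>2)" for z
  have [measurable]: "P \<in> borel_measurable \<sigma>" "Q \<in> borel_measurable \<sigma>"
    unfolding P_def Q_def by measurable
  have Qle: "(\<integral>\<^sup>+z. Q z \<partial>\<sigma>) \<le> ennreal ((nrm g)\<^sup>2)"
    unfolding Q_def B_def G_def S(1) by (rule weighted_norm_le[OF S(2,3) ae(2)])
  have Ple: "(\<integral>\<^sup>+z. P z \<partial>\<sigma>) \<le> ennreal A"
    unfolding P_def by (rule le)
  have gH: "g \<in> H" using S kcomb_mem by auto
  have g0: "0 \<le> nrm g" by (rule nrm_nonneg[OF gH])
  have pw: "AE z in \<sigma>. 2 * ennreal (cmod (nt_ext f z * cnj (G z))) \<le> ennreal t * P z + ennreal (1 / t) * Q z"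
    if t: "0 < t" for t
    using W(2)
  proof eventually_elim
    case (elim z)
    \<comment> \<open>A product with \<open>0\<close> is \<open>0\<close> even when
      \<open>W z\<close> is infinite, so \<open>1 \<le> W z * ennreal (B z)\<close> excludes a
      vanishing weight.\<close>
    then have Bpos: "0 < B z"
    proof -
      have "B z \<le> 0 \<Longrightarrow> ennreal (B z) = 0" by (simp add: ennreal_neg)
      then show ?thesis using elim unfolding B_def by force
    qed
    define x where "x = cmod (nt_ext f z)"
    define y where "y = cmod (G z)"
    have xy: "0 \<le> x" "0 \<le> y" by (auto simp: x_def y_def)
    have "2 * (x * y) \<le> t * (x\<^sup>2 / B z) + (1 / t) * (B z * y\<^sup>2)"
    proof -
      have "0 \<le> (t * x - B z * y)\<^sup>2 / (t * B z)" using t Bpos by simp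
      also have "\<dots> = t * (x\<^sup>2 / B z) - 2 * (x * y) + (1 / t) * (B z * y\<^sup>2)"
        using t Bpos by (simp add: field_simps power2_eq_square)
      finally show ?thesis by simp
    qed
    then have "ennreal (2 * (x * y)) \<le> ennreal (t * (x\<^sup>2 / B z) + (1 / t) * (B z * y\<^sup>2))"
      by (rule ennreal_leI)
    also have "\<dots> = ennreal t * ennreal (x\<^sup>2 / B z) + ennreal (1 / t) * Q z"
    proof -
      have "0 \<le> t * (x\<^sup>2 / B z)" "0 \<le> (1 / t) * (B z * y\<^sup>2)" "0 \<le> x\<^sup>2 / B z" "0 \<le> B z * y\<^sup>2"
        using t Bpos by auto
      then show ?thesis
        using t by (simp only: ennreal_plus ennreal_mult Q_def y_def zero_le_divide_1_iff less_imp_le)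
    qed
    also have "\<dots> \<le> ennreal t * P z + ennreal (1 / t) * Q z"
    proof (intro add_mono mult_left_mono order_refl)
      have "ennreal (x\<^sup>2 / B z) = ennreal (x\<^sup>2) * ennreal (1 / B z) * 1"
        using Bpos by (simp flip: ennreal_mult)
      also have "\<dots> \<le> ennreal (x\<^sup>2) * ennreal (1 / B z) * (W z * ennreal (B z))"
        using elim unfolding B_def by (intro mult_left_mono) auto
      also have "\<dots> = ennreal (x\<^sup>2) * W z * (ennreal (1 / B z) * ennreal (B z))" by (simp add: mult_ac)
      also have "ennreal (1 / B z) * ennreal (B z) = 1" using Bpos by (simp flip: ennreal_mult)
      finally show "ennreal (x\<^sup>2 / B z) \<le> P z" by (simp add: P_def x_def)
    qed auto
    finally show ?case by (simp add: x_def y_def norm_mult ennreal_mult)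
  qed
  have main: "2 * cmod (ip f g) \<le> t * A + (1 / t) * (nrm g)\<^sup>2" if t: "0 < t" for t
  proof -
    have "2 * ennreal (cmod (ip f g)) \<le> 2 * (\<integral>\<^sup>+z. ennreal (cmod (nt_ext f z * cnj (G z))) \<partial>\<sigma>)"
    proof (intro mult_left_mono)
      have "ip f g = (\<integral>z. nt_ext f z * cnj (G z) \<partial>\<sigma>)"
        unfolding S(1) G_def by (rule ip_kcomb_eq_integral[OF f S(2,3) ae(1)])
      then show "ennreal (cmod (ip f g)) \<le> (\<integral>\<^sup>+z. ennreal (cmod (nt_ext f z * cnj (G z))) \<partial>\<sigma>)"
        by (cases "integrable \<sigma> (\<lambda>z. nt_ext f z * cnj (G z))")
           (auto simp: not_integrable_integral_eq intro: integral_norm_bound_ennreal)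
    qed simp
    also have "\<dots> = (\<integral>\<^sup>+z. 2 * ennreal (cmod (nt_ext f z * cnj (G z))) \<partial>\<sigma>)"
      by (rule nn_integral_cmult[symmetric]) measurable
    also have "\<dots> \<le> (\<integral>\<^sup>+z. ennreal t * P z + ennreal (1 / t) * Q z \<partial>\<sigma>)"
      by (rule nn_integral_mono_AE[OF pw[OF t]])
    also have "\<dots> = ennreal t * (\<integral>\<^sup>+z. P z \<partial>\<sigma>) + ennreal (1 / t) * (\<integral>\<^sup>+z. Q z \<partial>\<sigma>)"
      by (simp add: nn_integral_add nn_integral_cmult)
    also have "\<dots> \<le> ennreal t * ennreal A + ennreal (1 / t) * ennreal ((nrm g)\<^sup>2)"
      by (intro add_mono mult_left_mono Ple Qle) auto
    also have "\<dots> = ennreal (t * A + (1 / t) * (nrm g)\<^sup>2)"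
    proof -
      have "0 \<le> t * A" "0 \<le> (1 / t) * (nrm g)\<^sup>2" "0 \<le> (nrm g)\<^sup>2" using t A by auto
      then show ?thesis
        using t A by (simp only: ennreal_plus ennreal_mult zero_le_divide_1_iff less_imp_le)
    qed
    finally have "ennreal (2 * cmod (ip f g)) \<le> ennreal (t * A + (1 / t) * (nrm g)\<^sup>2)"
      by (simp add: ennreal_mult)
    then show ?thesis using t A by (subst (asm) ennreal_le_iff) auto
  qed
  show "cmod (ip f g) \<le> sqrt A * nrm g"
  proof (cases "A = 0 \<or> nrm g = 0")
    case False
    then have pos: "0 < sqrt A" "0 < nrm g" using A g0 by auto
    \<comment> \<open>The two terms balance at \<open>t = nrm g / sqrt A\<close>, both being
      \<open>nrm g * sqrt A\<close>.\<close>
    have "2 * cmod (ip f g) \<le> (nrm g / sqrt A) * A + (1 / (nrm g / sqrt A)) * (nrm g)\<^sup>2"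
      by (rule main) (use pos in simp)
    also have "(nrm g / sqrt A) * A = nrm g * sqrt A"
    proof -
      have "(nrm g / sqrt A) * (sqrt A * sqrt A) = (nrm g / sqrt A * sqrt A) * sqrt A" by (simp only: mult.assoc)
      moreover have "nrm g / sqrt A * sqrt A = nrm g" using pos by simp
      moreover have "sqrt A * sqrt A = A" using A by simp
      ultimately show ?thesis by (simp only:)
    qed
    also have "(1 / (nrm g / sqrt A)) * (nrm g)\<^sup>2 = nrm g * sqrt A"
      using pos by (simp add: power2_eq_square)
    finally show ?thesis by (simp add: mult.commute)
  next
    \<comment> \<open>No parameter balances the terms here; \<open>t\<close> is sent to an end of
      its range instead, to infinity when \<open>A = 0\<close> and to \<open>0\<close> when
      \<open>nrm g = 0\<close>.\<close>
    case True
    have "2 * cmod (ip f g) \<le> 0"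
    proof (cases "A = 0")
      case A0: True
      have "2 * cmod (ip f g) \<le> e" if "0 < e" for e
      proof -
        have "2 * cmod (ip f g) \<le> (1 / (e / ((nrm g)\<^sup>2 + 1))) * A + (1 / (1 / (e / ((nrm g)\<^sup>2 + 1)))) * (nrm g)\<^sup>2"
          using main[of "1 / (e / ((nrm g)\<^sup>2 + 1))"] that by (simp add: add_nonneg_pos)
        also have "\<dots> = e * ((nrm g)\<^sup>2 / ((nrm g)\<^sup>2 + 1))" using A0 by simp
        also have "\<dots> \<le> e * 1" using that by (intro mult_left_mono) (auto simp: add_nonneg_pos)
        finally show ?thesis by simp
      qed
      then show ?thesis by (rule field_le_epsilon[of _ 0, simplified])
    next
      case A0: False
      then have g00: "nrm g = 0" using True by simp
      have "2 * cmod (ip f g) \<le> e" if "0 < e" for e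
        using main[of "e / A"] A A0 that g00 by simp
      then show ?thesis by (rule field_le_epsilon[of _ 0, simplified])
    qed
    then show ?thesis using A g0 by (simp add: order_trans[OF _ mult_nonneg_nonneg])
  qed
qed (use A in simp)

end

section \<open>Lebesgue decomposition and Carleson windows\<close>

lemma ess_inf_pos_iff: "0 < ess_inf m f \<longleftrightarrow> (\<exists>c>0. AE z in m. c \<le> f z)"
  unfolding ess_inf_def less_Sup_iff by auto

text \<open>Off the null set that carries the singular part, \<rho> is exactly
  \<open>density m h\<close>. One \<open>N\<close> serves all integrands.\<close>

lemma ac_density_nn_integral:
  assumes ac: "ac_density m \<rho> h" and s: "sets \<rho> = sets m"
  obtains N where "N \<in> null_sets m" "\<And>G. G \<in> borel_measurable m \<Longrightarrow>
     (\<integral>\<^sup>+z. G z * indicator (space m - N) z \<partial>\<rho>) = (\<integral>\<^sup>+z. G z * h z \<partial>m)"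
proof -
  have h[measurable]: "h \<in> borel_measurable m" using ac by (simp add: ac_density_def)
  obtain N where N: "N \<in> null_sets m"
    and eq: "\<And>A. A \<in> sets m \<Longrightarrow> emeasure \<rho> A = (\<integral>\<^sup>+z\<in>A. h z \<partial>m) + emeasure \<rho> (A \<inter> N)"
    using ac unfolding ac_density_def by blast
  have Ns[measurable]: "N \<in> sets m" using N by auto
  have Ns'[measurable]: "N \<in> sets \<rho>" using s by auto
  have sp: "space \<rho> = space m" using s by (rule sets_eq_imp_space_eq)
  have D: "density \<rho> (indicator (space m - N)) = density m h"
  proof (rule measure_eqI)
    fix A assume "A \<in> sets (density \<rho> (indicator (space m - N)))"
    then have A: "A \<in> sets m" "A \<in> sets \<rho>" using s by auto
    have "emeasure (density \<rho> (indicator (space m - N))) A = (\<integral>\<^sup>+z. indicator (space m - N) z * indicator A z \<partial>\<rho>)"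
      using A s by (intro emeasure_density) auto
    also have "\<dots> = (\<integral>\<^sup>+z. indicator (A - N) z \<partial>\<rho>)"
      using sets.sets_into_space[OF A(1)] by (intro nn_integral_cong) (auto simp: indicator_def)
    also have "\<dots> = emeasure \<rho> (A - N)" using A by (intro nn_integral_indicator) auto
    also have "\<dots> = (\<integral>\<^sup>+z\<in>A - N. h z \<partial>m) + emeasure \<rho> ((A - N) \<inter> N)" using A by (intro eq) auto
    also have "(A - N) \<inter> N = {}" by auto
    also have "(\<integral>\<^sup>+z\<in>A - N. h z \<partial>m) + emeasure \<rho> {} = (\<integral>\<^sup>+z\<in>A. h z \<partial>m)"
      using AE_not_in[OF N] by (simp, intro nn_integral_cong_AE) (auto simp: indicator_def elim!: eventually_mono)
    finally show "emeasure (density \<rho> (indicator (space m - N))) A = emeasure (density m h) A"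
      using A by (simp add: emeasure_density)
  qed (use s in simp)
  have "(\<integral>\<^sup>+z. G z * indicator (space m - N) z \<partial>\<rho>) = (\<integral>\<^sup>+z. G z * h z \<partial>m)" if G[measurable]: "G \<in> borel_measurable m" for G
  proof -
    have G': "G \<in> borel_measurable \<rho>" using G measurable_cong_sets[OF s refl] by blast
    have "(\<integral>\<^sup>+z. G z * indicator (space m - N) z \<partial>\<rho>) = (\<integral>\<^sup>+z. G z \<partial>density \<rho> (indicator (space m - N)))"
      using s by (subst nn_integral_density[OF _ G']) (auto simp: mult.commute intro!: borel_measurable_indicator sets.Diff)
    also have "\<dots> = (\<integral>\<^sup>+z. G z * h z \<partial>m)"
      unfolding D by (subst nn_integral_density) (auto simp: mult.commute)
    finally show ?thesis .
  qed
  then show ?thesis using that N by blast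
qed

lemma ac_density_nn_integral_le:
  assumes ac: "ac_density m \<rho> h" and s: "sets \<rho> = sets m" and G: "G \<in> borel_measurable m"
  shows "(\<integral>\<^sup>+z. G z * h z \<partial>m) \<le> (\<integral>\<^sup>+z. G z \<partial>\<rho>)"
proof -
  obtain N where "N \<in> null_sets m" "(\<integral>\<^sup>+z. G z * indicator (space m - N) z \<partial>\<rho>) = (\<integral>\<^sup>+z. G z * h z \<partial>m)"
    using ac_density_nn_integral[OF ac s] G by metis
  then have "(\<integral>\<^sup>+z. G z * h z \<partial>m) = (\<integral>\<^sup>+z. G z * indicator (space m - N) z \<partial>\<rho>)" by simp
  also have "\<dots> \<le> (\<integral>\<^sup>+z. G z \<partial>\<rho>)"
    by (intro nn_integral_mono) (auto simp: indicator_def)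
  finally show ?thesis .
qed

text \<open>On the set where \<open>v < u\<close> the difference has integral \<open>0\<close>, so
  that set is null. Finiteness of the integral of \<open>u\<close> legitimates the subtraction of
  extended integrals.\<close>

lemma AE_le_if_nn_integral_le:
  fixes u v :: "'a \<Rightarrow> ennreal"
  assumes u[measurable]: "u \<in> borel_measurable m" and v[measurable]: "v \<in> borel_measurable m"
    and fin: "(\<integral>\<^sup>+z. u z \<partial>m) < \<infinity>"
    and le: "\<And>A. A \<in> sets m \<Longrightarrow> (\<integral>\<^sup>+z. u z * indicator A z \<partial>m) \<le> (\<integral>\<^sup>+z. v z * indicator A z \<partial>m)"
  shows "AE z in m. u z \<le> v z"
proof -
  define A where "A = {z \<in> space m. v z < u z}"
  have A[measurable]: "A \<in> sets m" unfolding A_def by measurable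
  have leA: "v z * indicator A z \<le> u z * indicator A z" for z
    by (auto simp: A_def indicator_def)
  have "(\<integral>\<^sup>+z. u z * indicator A z \<partial>m) \<le> (\<integral>\<^sup>+z. u z \<partial>m)"
    by (intro nn_integral_mono) (auto simp: indicator_def)
  then have finu: "(\<integral>\<^sup>+z. u z * indicator A z \<partial>m) < \<infinity>" using fin by (rule le_less_trans)
  have "(\<integral>\<^sup>+z. v z * indicator A z \<partial>m) \<le> (\<integral>\<^sup>+z. u z * indicator A z \<partial>m)"
    by (intro nn_integral_mono leA)
  then have finv: "(\<integral>\<^sup>+z. v z * indicator A z \<partial>m) < \<infinity>" using finu by (rule le_less_trans)
  have "(\<integral>\<^sup>+z. u z * indicator A z - v z * indicator A z \<partial>m) =
      (\<integral>\<^sup>+z. u z * indicator A z \<partial>m) - (\<integral>\<^sup>+z. v z * indicator A z \<partial>m)"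
    by (rule nn_integral_diff) (use finv leA in auto)
  also have "\<dots> = 0" using le[OF A] finv by (simp add: diff_eq_0_iff_ennreal)
  finally have "AE z in m. u z * indicator A z - v z * indicator A z = 0"
    by (subst (asm) nn_integral_0_iff_AE) auto
  then show ?thesis
    using AE_space
  proof eventually_elim
    case (elim z)
    show ?case
    proof (cases "z \<in> A")
      case True
      then have "u z - v z = 0" using elim by simp
      then show ?thesis by (metis diff_eq_0_iff_ennreal order_less_imp_le order_refl top_greatest)
    next
      case False
      then show ?thesis using elim by (auto simp: A_def)
    qed
  qed
qed

text \<open>Inner regularity of the measure with density \<open>g\<close> lifts the hypothesis from
  compact to Borel sets; removing the null set \<open>N\<close> then replaces \<rho> by its
  absolutely continuous part. Compact sets are what the grid of windows and the bump functions can
  handle.\<close>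

lemma AE_le_ac_density:
  fixes g G :: "complex \<Rightarrow> ennreal"
  assumes ac: "ac_density \<sigma> \<rho> h" and s: "sets \<rho> = sets \<sigma>"
    and g[measurable]: "g \<in> borel_measurable \<sigma>" and G[measurable]: "G \<in> borel_measurable \<sigma>"
    and fin: "(\<integral>\<^sup>+z. g z \<partial>\<sigma>) < \<infinity>"
    and le: "\<And>K. compact K \<Longrightarrow> K \<subseteq> sphere 0 1 \<Longrightarrow>
        (\<integral>\<^sup>+z. g z * indicator K z \<partial>\<sigma>) \<le> (\<integral>\<^sup>+z. G z * indicator K z \<partial>\<rho>)"
  shows "AE z in \<sigma>. g z \<le> G z * h z"
proof -
  have h[measurable]: "h \<in> borel_measurable \<sigma>" using ac by (simp add: ac_density_def)
  obtain N where N: "N \<in> null_sets \<sigma>" "\<And>G. G \<in> borel_measurable \<sigma> \<Longrightarrow>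
     (\<integral>\<^sup>+z. G z * indicator (space \<sigma> - N) z \<partial>\<rho>) = (\<integral>\<^sup>+z. G z * h z \<partial>\<sigma>)"
    using ac_density_nn_integral[OF ac s] by blast
  have Ns[measurable]: "N \<in> sets \<sigma>" using N by auto
  \<comment> \<open>\<sigma> lives on the trace of the Borel sets on the circle; the measure is
    pushed to the Borel sets of the plane, where \<open>inner_regular\<close> applies.\<close>
  define D where "D = distr (density \<sigma> g) borel (\<lambda>x. x)"
  have idm: "(\<lambda>x. x) \<in> measurable (density \<sigma> g) borel"
    by (simp add: measurable_ident_circle)
  have De: "emeasure D A = (\<integral>\<^sup>+z. g z * indicator A z \<partial>\<sigma>)" if "A \<in> sets borel" for A
  proof -
    have As: "A \<inter> sphere 0 1 \<in> sets \<sigma>" using that by (auto simp: sets_circle_iff)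
    have "emeasure D A = emeasure (density \<sigma> g) (A \<inter> sphere 0 1)"
      unfolding D_def by (subst emeasure_distr[OF idm that]) simp
    also have "\<dots> = (\<integral>\<^sup>+z. g z * indicator (A \<inter> sphere 0 1) z \<partial>\<sigma>)"
      using As by (intro emeasure_density) auto
    also have "\<dots> = (\<integral>\<^sup>+z. g z * indicator A z \<partial>\<sigma>)"
      by (intro nn_integral_cong) (auto simp: indicator_def)
    finally show ?thesis .
  qed
  have Dfin: "emeasure D (space D) \<noteq> \<infinity>"
    using fin De[of UNIV] by (simp add: D_def)
  have A: "(\<integral>\<^sup>+z. g z * indicator A z \<partial>\<sigma>) \<le> (\<integral>\<^sup>+z. G z * indicator A z \<partial>\<rho>)"
    if "A \<in> sets \<sigma>" for A
  proof -
    have Ab: "A \<in> sets borel" "A \<subseteq> sphere 0 1" using that by (auto simp: sets_circle_iff)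
    have "(\<integral>\<^sup>+z. g z * indicator A z \<partial>\<sigma>) = emeasure D A" by (simp add: De Ab)
    also have "\<dots> = (SUP K \<in> {K. K \<subseteq> A \<and> compact K}. emeasure D K)"
      by (rule inner_regular) (use Dfin Ab in \<open>auto simp: D_def\<close>)
    also have "\<dots> \<le> (\<integral>\<^sup>+z. G z * indicator A z \<partial>\<rho>)"
    proof (rule SUP_least)
      fix K assume K: "K \<in> {K. K \<subseteq> A \<and> compact K}"
      then have "emeasure D K = (\<integral>\<^sup>+z. g z * indicator K z \<partial>\<sigma>)"
        by (intro De borel_closed compact_imp_closed) auto
      also have "\<dots> \<le> (\<integral>\<^sup>+z. G z * indicator K z \<partial>\<rho>)"
        using K Ab by (intro le) auto
      also have "\<dots> \<le> (\<integral>\<^sup>+z. G z * indicator A z \<partial>\<rho>)"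
        using K by (intro nn_integral_mono) (auto simp: indicator_def)
      finally show "emeasure D K \<le> (\<integral>\<^sup>+z. G z * indicator A z \<partial>\<rho>)" .
    qed
    finally show ?thesis .
  qed
  show ?thesis
  proof (rule AE_le_if_nn_integral_le[OF g _ fin])
    fix A assume As[measurable]: "A \<in> sets \<sigma>"
    have "(\<integral>\<^sup>+z. g z * indicator A z \<partial>\<sigma>) = (\<integral>\<^sup>+z. g z * indicator (A - N) z \<partial>\<sigma>)"
      using AE_not_in[OF N(1)] by (intro nn_integral_cong_AE) (auto simp: indicator_def elim!: eventually_mono)
    also have "\<dots> \<le> (\<integral>\<^sup>+z. G z * indicator (A - N) z \<partial>\<rho>)" by (intro A) auto
    also have "\<dots> = (\<integral>\<^sup>+z. (G z * indicator A z) * indicator (space \<sigma> - N) z \<partial>\<rho>)"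
      using sets.sets_into_space[OF As] by (intro nn_integral_cong) (auto simp: indicator_def)
    also have "\<dots> = (\<integral>\<^sup>+z. (G z * indicator A z) * h z \<partial>\<sigma>)" by (intro N) auto
    also have "\<dots> = (\<integral>\<^sup>+z. G z * h z * indicator A z \<partial>\<sigma>)" by (simp add: mult_ac)
    finally show "(\<integral>\<^sup>+z. g z * indicator A z \<partial>\<sigma>) \<le> (\<integral>\<^sup>+z. G z * h z * indicator A z \<partial>\<sigma>)" .
  qed measurable
qed

section \<open>Carleson windows and compact subsets of the circle\<close>

lemma norm_cis_diff_le: "cmod (cis x - cis y) \<le> \<bar>x - y\<bar>"
proof -
  have "cis x - cis y = cis y * (cis (x - y) - 1)" by (simp add: cis_mult right_diff_distrib)
  then have "cmod (cis x - cis y) = cmod (exp (\<i> * of_real (x - y)) - 1)"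
    by (simp add: norm_mult cis_conv_exp)
  also have "\<dots> = 2 * \<bar>sin ((x - y) / 2)\<bar>" using dist_exp_i_1[of "x - y"] by (simp add: dist_norm)
  also have "\<dots> \<le> 2 * \<bar>(x - y) / 2\<bar>" by (intro mult_left_mono abs_sin_x_le_abs_x) auto
  finally show ?thesis by simp
qed

lemma carleson_window_borel:
  assumes "I \<in> sets borel"
  shows "carleson_window I \<in> sets borel"
proof -
  have p: "(\<lambda>z. z / of_real (cmod z)) \<in> borel_measurable borel" by measurable
  have "carleson_window I = cball 0 1 \<inter> (\<lambda>z. z / of_real (cmod z)) -` I \<inter> {z. 1 - cmod z \<le> measure \<sigma> I / 2}"
    by (auto simp: carleson_window_def)
  also have "\<dots> \<in> sets borel"
    using measurable_sets_borel[OF p assms]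
    by (intro sets.Int borel_closed[OF closed_cball] borel_closed[OF closed_Collect_le] continuous_intros)
  finally show ?thesis .
qed

context
  fixes \<mu> :: "complex measure"
  assumes \<mu>: "\<mu> \<in> disk_measures"
begin

lemma sets_disk: "sets \<mu> = sets (restrict_space borel (cball 0 1))"
  using \<mu> by (simp add: disk_measures_def)

lemma space_disk: "space \<mu> = cball 0 1"
  using sets_eq_imp_space_eq[OF sets_disk] by (simp add: space_restrict_space)

lemma sets_disk_iff: "A \<in> sets \<mu> \<longleftrightarrow> A \<subseteq> cball 0 1 \<and> A \<in> sets borel"
  by (simp add: sets_disk sets_restrict_space_iff)

lemma measurable_disk_iff: "f \<in> borel_measurable \<mu> \<longleftrightarrow> f \<in> borel_measurable (restrict_space borel (cball 0 1))"
  by (rule arg_cong[where f = "\<lambda>S. f \<in> S", OF measurable_cong_sets[OF sets_disk refl]])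

lemma sphere_sets_disk: "sphere 0 1 \<in> sets \<mu>"
  by (auto simp: sets_disk_iff)

lemma sets_circle_trace: "sets (restrict_space \<mu> (sphere 0 1)) = sets \<sigma>"
proof -
  have "sphere 0 1 \<inter> space \<mu> \<in> sets \<mu>"
    using sphere_sets_disk sets.sets_into_space[OF sphere_sets_disk] by (simp add: Int_absorb2)
  then have "A \<in> sets (restrict_space \<mu> (sphere 0 1)) \<longleftrightarrow> A \<in> sets \<sigma>" for A
    unfolding sets_restrict_space_iff[OF \<open>sphere 0 1 \<inter> space \<mu> \<in> sets \<mu>\<close>] sets_circle_iff sets_disk_iff
    by (auto simp: subset_iff)
  then show ?thesis by blast
qed

lemma nn_integral_circle_trace:
  "(\<integral>\<^sup>+z. f z \<partial>restrict_space \<mu> (sphere 0 1)) = (\<integral>\<^sup>+z. f z * indicator (sphere 0 1) z \<partial>\<mu>)"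
  by (rule nn_integral_restrict_space)
     (use sphere_sets_disk in \<open>simp add: sets_disk_iff space_disk\<close>)

lemma neighbourhood_sets_disk: "{z \<in> cball 0 1. infdist z K \<le> d} \<in> sets \<mu>"
proof -
  have "closed {z. infdist z K \<le> d}"
    by (intro closed_Collect_le continuous_intros)
  moreover have "{z \<in> cball 0 1. infdist z K \<le> d} = cball 0 1 \<inter> {z. infdist z K \<le> d}" by auto
  ultimately show ?thesis by (auto simp: sets_disk_iff intro!: borel_closed)
qed

text \<open>Windows over disjoint arcs are disjoint, because \<open>z / |z|\<close> recovers the
  arc. An arc is selected when its closure meets \<open>K\<close>, so that a point of
  \<open>K\<close> on the grid selects one too; the grid points missed by the open arcs are
  collected in the null set \<open>E\<close>.\<close>

lemma emeasure_grid_le: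
  assumes q: "q \<in> borel_measurable \<mu>" and K: "compact K" "K \<subseteq> sphere 0 1" "K \<noteq> {}"
    and c: "\<And>I. open_arc I \<Longrightarrow> c * emeasure \<sigma> I \<le> emeasure (density \<mu> q) (carleson_window I)"
  shows "c * emeasure \<sigma> K \<le>
    emeasure (density \<mu> q) {z \<in> cball 0 1. infdist z K \<le> 8 / real (Suc n)}"
proof -
  define d where "d = 2 * pi / real (Suc n)"
  have d: "0 < d" "real (Suc n) * d = 2 * pi" by (auto simp: d_def)
  define J where "J k = cis ` {real k * d<..<real (Suc k) * d}" for k
  define I where "I = {k. k \<le> n \<and> cis ` {real k * d..real (Suc k) * d} \<inter> K \<noteq> {}}"
  have Ifin: "finite I" unfolding I_def by (rule finite_subset[of _ "{..n}"]) auto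
  have range: "0 \<le> real k * d" "real k * d < real (Suc k) * d" "real (Suc k) * d \<le> 2 * pi" if "k \<in> I" for k
  proof -
    have "real (Suc k) * d \<le> real (Suc n) * d" using that d by (intro mult_right_mono) (auto simp: I_def)
    then show "real (Suc k) * d \<le> 2 * pi" unfolding d(2) .
  qed (use d in auto)
  have arc: "open_arc (J k)" if "k \<in> I" for k
    unfolding open_arc_def J_def
    by (rule exI[of _ "real k * d"], rule exI[of _ "real (Suc k) * d"])
       (use range[OF that] in auto)
  have mJ: "emeasure \<sigma> (J k) = ennreal (1 / Suc n)" if "k \<in> I" for k
  proof -
    have "emeasure \<sigma> (J k) = ennreal ((real (Suc k) * d - real k * d) / (2 * pi))"
      unfolding J_def using range[OF that] by (intro emeasure_cis_image) auto
    also have "(real (Suc k) * d - real k * d) / (2 * pi) = 1 / Suc n"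
    proof -
      have "real (Suc k) * d - real k * d = d" by (simp add: algebra_simps)
      then show ?thesis by (simp add: d_def)
    qed
    finally show ?thesis .
  qed
  have mJ': "measure \<sigma> (J k) = 1 / Suc n" if "k \<in> I" for k
    unfolding measure_def mJ[OF that] by simp
  have Js: "J k \<in> sets \<sigma>" for k unfolding J_def by (rule cis_image_sets)
  define E where "E = (\<lambda>k. cis (real k * d)) ` {..n}"
  have E: "E \<in> null_sets \<sigma>"
  proof -
    have "E = (\<Union>z\<in>E. {z})" by auto
    also have "\<dots> \<in> null_sets \<sigma>"
      by (intro null_sets_UN' countable_finite) (auto simp: E_def null_sets_def sets_circle_iff emeasure_circle_singleton)
    finally show ?thesis .
  qed
  have Kcov: "K \<subseteq> (\<Union>k\<in>I. J k) \<union> E"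
  proof
    fix z assume z: "z \<in> K"
    then have "cmod z = 1" using K by auto
    then obtain x where x: "z = cis x" "0 \<le> x" "x < 2 * pi"
      by (metis Arg2pi Arg2pi_eq cis_conv_exp mult_1 of_real_1)
    define k where "k = nat \<lfloor>x / d\<rfloor>"
    have "real k = of_int \<lfloor>x / d\<rfloor>" using x d by (simp add: k_def)
    then have "real k \<le> x / d" "x / d < real k + 1" by linarith+
    then have k: "real k * d \<le> x" "x < real (Suc k) * d" using d by (auto simp: field_simps)
    have "real k * d < real (Suc n) * d" using k x d by simp
    then have kn: "k \<le> n" using d by simp
    have "z \<in> cis ` {real k * d..real (Suc k) * d} \<inter> K" using z x k by auto
    then have kI: "k \<in> I" using kn by (auto simp: I_def)
    show "z \<in> (\<Union>k\<in>I. J k) \<union> E"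
    proof (cases "x = real k * d")
      case True
      then show ?thesis using x kn by (auto simp: E_def)
    next
      case False
      then have "z \<in> J k" using x k by (auto simp: J_def)
      then show ?thesis using kI by auto
    qed
  qed
  have Jdisj: "disjoint_family_on J I"
    unfolding disjoint_family_on_def
  proof (intro ballI impI)
    fix k l assume kl: "k \<in> I" "l \<in> I" "k \<noteq> l"
    show "J k \<inter> J l = {}"
    proof (rule ccontr)
      assume "J k \<inter> J l \<noteq> {}"
      then obtain w where "w \<in> J k" "w \<in> J l" by blast
      then obtain x y where xy: "x \<in> {real k * d<..<real (Suc k) * d}" "y \<in> {real l * d<..<real (Suc l) * d}" "cis x = cis y"
        unfolding J_def by blast
      have "x \<in> {0..<2 * pi}" "y \<in> {0..<2 * pi}" using xy range[OF kl(1)] range[OF kl(2)] by auto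
      then have "x = y" using inj_on_cis xy(3) by (auto dest: inj_onD)
      then have "real k * d < real (Suc l) * d" "real l * d < real (Suc k) * d" using xy by auto
      then have "k < Suc l" "l < Suc k" using d by (simp_all del: of_nat_Suc)
      then show False using kl by simp
    qed
  qed
  have Ws: "carleson_window (J k) \<in> sets \<mu>" for k
    using carleson_window_borel[of "J k"] Js[of k] by (auto simp: sets_disk_iff sets_circle_iff carleson_window_def)
  have Wdisj: "disjoint_family_on (\<lambda>k. carleson_window (J k)) I"
    using Jdisj unfolding disjoint_family_on_def carleson_window_def by blast
  have Wsub: "carleson_window (J k) \<subseteq> {z \<in> cball 0 1. infdist z K \<le> 8 / real (Suc n)}" if kI: "k \<in> I" for k
  proof
    fix z assume z: "z \<in> carleson_window (J k)"
    then obtain x where x: "x \<in> {real k * d<..<real (Suc k) * d}" "z / of_real (cmod z) = cis x"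
      by (auto simp: carleson_window_def J_def)
    have z1: "cmod z \<le> 1" "1 - cmod z \<le> 1 / Suc n / 2" using z mJ'[OF kI] by (auto simp: carleson_window_def)
    \<comment> \<open>The origin lies in no window, since \<open>0 / 0 = 0\<close> is not on the
      circle.\<close>
    have z0: "z \<noteq> 0" using x norm_cis[of x] by auto
    obtain y where y: "y \<in> {real k * d..real (Suc k) * d}" "cis y \<in> K" using kI unfolding I_def by blast
    have zc: "z = of_real (cmod z) * cis x" using x(2) z0 by (simp add: field_simps)
    have "z - cis x = of_real (cmod z - 1) * cis x" by (subst zc) (simp add: algebra_simps)
    then have 1: "cmod (z - cis x) \<le> 1 / Suc n / 2"
      using z1 by (simp add: norm_mult del: of_real_diff)
    have "\<bar>x - y\<bar> \<le> d" using x y by (auto simp: algebra_simps abs_le_iff)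
    then have 2: "cmod (cis x - cis y) \<le> d" using norm_cis_diff_le order_trans by blast
    have "infdist z K \<le> dist z (cis y)" using y by (intro infdist_le)
    also have "\<dots> \<le> cmod (z - cis x) + cmod (cis x - cis y)"
      unfolding dist_norm using norm_triangle_ineq[of "z - cis x" "cis x - cis y"] by simp
    also have "\<dots> \<le> 1 / Suc n / 2 + d" using 1 2 by simp
    \<comment> \<open>The window contributes its depth \<open>1 / (2 * Suc n)\<close> and the arc
      its length \<open>2 * pi / Suc n\<close>; \<open>8\<close> is a round bound for
      \<open>1 / 2 + 2 * pi\<close>.\<close>
    also have "\<dots> = (1 / 2 + 2 * pi) / Suc n" by (simp add: d_def add_divide_distrib)
    also have "\<dots> \<le> 8 / Suc n" using pi_approx by (intro divide_right_mono) auto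
    finally show "z \<in> {z \<in> cball 0 1. infdist z K \<le> 8 / real (Suc n)}" using z1 by simp
  qed
  note Vs = neighbourhood_sets_disk[of K "8 / real (Suc n)"]
  have "emeasure \<sigma> K \<le> emeasure \<sigma> ((\<Union>k\<in>I. J k) \<union> E)"
    using Kcov E Js Ifin by (intro emeasure_mono) auto
  also have "\<dots> = emeasure \<sigma> (\<Union>k\<in>I. J k)"
    using E Js Ifin by (intro emeasure_Un_null_set) auto
  also have "\<dots> = (\<Sum>k\<in>I. emeasure \<sigma> (J k))"
    using Js Jdisj Ifin by (intro sum_emeasure[symmetric]) auto
  finally have "c * emeasure \<sigma> K \<le> c * (\<Sum>k\<in>I. emeasure \<sigma> (J k))"
    by (rule mult_left_mono) simp
  also have "\<dots> \<le> (\<Sum>k\<in>I. emeasure (density \<mu> q) (carleson_window (J k)))"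
    unfolding sum_distrib_left by (intro sum_mono c arc)
  also have "\<dots> = emeasure (density \<mu> q) (\<Union>k\<in>I. carleson_window (J k))"
    using Ws Wdisj Ifin by (intro sum_emeasure) auto
  also have "\<dots> \<le> emeasure (density \<mu> q) {z \<in> cball 0 1. infdist z K \<le> 8 / real (Suc n)}"
    using Wsub Vs by (intro emeasure_mono) auto
  finally show ?thesis .
qed

text \<open>The neighbourhoods in the grid estimate shrink to \<open>K\<close> as the grid is
  refined. Continuity from above applies because \<open>q \<le> 1\<close> and \<mu> is
  finite.\<close>

lemma window_bound_imp_compact_bound:
  assumes q: "q \<in> borel_measurable \<mu>" "\<And>z. q z \<le> 1" and K: "compact K" "K \<subseteq> sphere 0 1"
    and c: "\<And>I. open_arc I \<Longrightarrow> c * emeasure \<sigma> I \<le> emeasure (density \<mu> q) (carleson_window I)"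
  shows "c * emeasure \<sigma> K \<le> emeasure (density \<mu> q) K"
proof (cases "K = {}")
  case False
  define V where "V n = {z \<in> cball 0 1. infdist z K \<le> 8 / real (Suc n)}" for n
  have Vs: "V n \<in> sets \<mu>" for n unfolding V_def by (rule neighbourhood_sets_disk)
  interpret finite_measure \<mu> using \<mu> by (simp add: disk_measures_def)
  have fin: "emeasure (density \<mu> q) (V n) \<noteq> \<infinity>" for n
  proof -
    have "emeasure (density \<mu> q) (V n) = (\<integral>\<^sup>+z. q z * indicator (V n) z \<partial>\<mu>)"
      by (rule emeasure_density[OF q(1) Vs])
    also have "\<dots> \<le> (\<integral>\<^sup>+z. 1 \<partial>\<mu>)" using q(2) by (intro nn_integral_mono) (auto simp: indicator_def)
    also have "\<dots> < \<infinity>" by (simp add: emeasure_finite less_top[symmetric])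
    finally show ?thesis by simp
  qed
  have dec: "decseq V"
    unfolding decseq_def V_def
  proof (intro allI impI subsetI)
    fix m n :: nat and z assume mn: "m \<le> n" and z: "z \<in> {z \<in> cball 0 1. infdist z K \<le> 8 / real (Suc n)}"
    have "8 / real (Suc n) \<le> 8 / real (Suc m)" using mn by (intro divide_left_mono) auto
    then show "z \<in> {z \<in> cball 0 1. infdist z K \<le> 8 / real (Suc m)}" using z by auto
  qed
  have "(\<lambda>n. emeasure (density \<mu> q) (V n)) \<longlonglongrightarrow> emeasure (density \<mu> q) (\<Inter>n. V n)"
    by (rule Lim_emeasure_decseq) (use Vs dec fin in auto)
  also have "(\<Inter>n. V n) = K"
  proof
    show "K \<subseteq> (\<Inter>n. V n)" using K by (auto simp: V_def)
    show "(\<Inter>n. V n) \<subseteq> K"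
    proof
      fix z assume z: "z \<in> (\<Inter>n. V n)"
      have "infdist z K \<le> 0"
      proof (rule field_le_epsilon)
        fix e :: real assume "0 < e"
        then obtain n where "1 / real (Suc n) < e / 8" using nat_approx_posE[of "e / 8"] by auto
        moreover have "infdist z K \<le> 8 * (1 / real (Suc n))" using z by (auto simp: V_def)
        ultimately show "infdist z K \<le> 0 + e" by linarith
      qed
      then have "infdist z K = 0" using infdist_nonneg[of z K] by simp
      then show "z \<in> K" using in_closed_iff_infdist_zero[OF compact_imp_closed[OF K(1)] False] by simp
    qed
  qed
  finally show ?thesis
    by (rule LIMSEQ_le_const) (use emeasure_grid_le[OF q(1) K False c] in \<open>auto simp: V_def\<close>)
qed simp

end

text \<open>The weight \<open>q\<close> will be \<open>1 - |b|\<close>. From right to left it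
  suffices that an arc is contained in its own window; the other direction passes through compact
  sets and \<open>AE_le_ac_density\<close>.\<close>

lemma windows_iff_ess_inf:
  assumes \<mu>: "\<mu> \<in> disk_measures" and ac: "ac_density \<sigma> (restrict_space \<mu> (sphere 0 1)) h"
    and q: "q \<in> borel_measurable (restrict_space borel (cball 0 1))" "\<And>z. q z \<le> (1::ennreal)"
  shows "(INF I\<in>{I. open_arc I}. emeasure (density \<mu> q) (carleson_window I) / emeasure \<sigma> I) > 0
    \<longleftrightarrow> ess_inf \<sigma> (\<lambda>z. q z * h z) > 0"
proof
  have q\<mu>: "q \<in> borel_measurable \<mu>" using q(1) by (rule measurable_disk_iff[OF \<mu>, THEN iffD2])
  have qm: "q \<in> borel_measurable \<sigma>"
  proof -
    have "q \<in> borel_measurable (restrict_space \<mu> (sphere 0 1))" by (rule measurable_restrict_space1[OF q\<mu>])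
    then show ?thesis using measurable_cong_sets[OF sets_circle_trace[OF \<mu>] refl] by blast
  qed
  have fin: "0 < emeasure \<sigma> I" "emeasure \<sigma> I < \<infinity>" if "open_arc I" for I
    using emeasure_open_arc_pos[OF that] circle.emeasure_finite[of I] by (simp_all add: less_top[symmetric])
  have comp: "(\<integral>\<^sup>+z. q z * indicator K z \<partial>restrict_space \<mu> (sphere 0 1)) = emeasure (density \<mu> q) K"
    if "K \<in> sets borel" "K \<subseteq> sphere 0 1" for K
  proof -
    have "K \<in> sets \<mu>" using that by (auto simp: sets_disk_iff[OF \<mu>])
    then have "emeasure (density \<mu> q) K = (\<integral>\<^sup>+z. q z * indicator K z \<partial>\<mu>)" by (rule emeasure_density[OF q\<mu>])
    moreover have "(\<integral>\<^sup>+z. q z * indicator K z \<partial>restrict_space \<mu> (sphere 0 1)) = (\<integral>\<^sup>+z. q z * indicator K z * indicator (sphere 0 1) z \<partial>\<mu>)"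
      by (rule nn_integral_circle_trace[OF \<mu>])
    moreover have "(\<integral>\<^sup>+z. q z * indicator K z * indicator (sphere 0 1) z \<partial>\<mu>) = (\<integral>\<^sup>+z. q z * indicator K z \<partial>\<mu>)"
      using that by (intro nn_integral_cong) (auto simp: indicator_def)
    ultimately show ?thesis by simp
  qed
  {
    assume *: "(INF I\<in>{I. open_arc I}. emeasure (density \<mu> q) (carleson_window I) / emeasure \<sigma> I) > 0"
    \<comment> \<open>The minimum with \<open>1\<close> keeps \<open>c\<close> finite, as required
      for the integral of the constant \<open>c\<close>.\<close>
    define c where "c = min 1 (INF I\<in>{I. open_arc I}. emeasure (density \<mu> q) (carleson_window I) / emeasure \<sigma> I)"
    have c0: "0 < c" using * by (simp add: c_def)
    have c1: "c \<le> 1" by (simp add: c_def)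
    have c: "c * emeasure \<sigma> I \<le> emeasure (density \<mu> q) (carleson_window I)" if "open_arc I" for I
    proof -
      have "c \<le> emeasure (density \<mu> q) (carleson_window I) / emeasure \<sigma> I"
        unfolding c_def using that by (intro min.coboundedI2 INF_lower) auto
      then have "c * emeasure \<sigma> I \<le> emeasure (density \<mu> q) (carleson_window I) / emeasure \<sigma> I * emeasure \<sigma> I"
        by (rule mult_right_mono) simp
      also have "\<dots> = emeasure (density \<mu> q) (carleson_window I)"
        using fin[OF that] by (simp add: ennreal_divide_times ennreal_mult_divide_eq)
      finally show ?thesis .
    qed
    have "AE z in \<sigma>. c \<le> q z * h z"
    proof (rule AE_le_ac_density[OF ac sets_circle_trace[OF \<mu>] _ qm])
      show "(\<integral>\<^sup>+z. c \<partial>\<sigma>) < \<infinity>" using c1 by (auto intro: le_less_trans)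
      fix K :: "complex set" assume K: "compact K" "K \<subseteq> sphere 0 1"
      then have Kb: "K \<in> sets borel" by (intro borel_closed compact_imp_closed)
      have "(\<integral>\<^sup>+z. c * indicator K z \<partial>\<sigma>) = c * emeasure \<sigma> K"
        using K Kb by (intro nn_integral_cmult_indicator) (simp add: sets_circle_iff)
      also have "\<dots> \<le> emeasure (density \<mu> q) K"
        by (rule window_bound_imp_compact_bound[OF \<mu> q\<mu> q(2) K c])
      finally show "(\<integral>\<^sup>+z. c * indicator K z \<partial>\<sigma>) \<le> (\<integral>\<^sup>+z. q z * indicator K z \<partial>restrict_space \<mu> (sphere 0 1))"
        using comp[OF Kb K(2)] by simp
    qed simp
    then show "ess_inf \<sigma> (\<lambda>z. q z * h z) > 0"
      unfolding ess_inf_pos_iff using c0 by blast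
  }
  {
    assume "ess_inf \<sigma> (\<lambda>z. q z * h z) > 0"
    then obtain c where c: "0 < c" "AE z in \<sigma>. c \<le> q z * h z"
      unfolding ess_inf_pos_iff by blast
    have "c \<le> emeasure (density \<mu> q) (carleson_window I) / emeasure \<sigma> I" if I: "open_arc I" for I
    proof -
      have Is: "I \<in> sets \<sigma>" by (rule open_arc_sets[OF I])
      then have Ib: "I \<in> sets borel" "I \<subseteq> sphere 0 1" by (auto simp: sets_circle_iff)
      have "c * emeasure \<sigma> I = (\<integral>\<^sup>+z. c * indicator I z \<partial>\<sigma>)"
        using Is by (rule nn_integral_cmult_indicator[symmetric])
      also have "\<dots> \<le> (\<integral>\<^sup>+z. q z * indicator I z * h z \<partial>\<sigma>)"
        using c(2) by (intro nn_integral_mono_AE) (auto simp: indicator_def elim!: eventually_mono)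
      also have "\<dots> \<le> (\<integral>\<^sup>+z. q z * indicator I z \<partial>restrict_space \<mu> (sphere 0 1))"
        using qm Is by (intro ac_density_nn_integral_le[OF ac sets_circle_trace[OF \<mu>]]) auto
      also have "\<dots> = emeasure (density \<mu> q) I" by (rule comp[OF Ib])
      also have "\<dots> \<le> emeasure (density \<mu> q) (carleson_window I)"
      proof (rule emeasure_mono)
        show "I \<subseteq> carleson_window I" using Ib by (auto simp: carleson_window_def)
        show "carleson_window I \<in> sets (density \<mu> q)"
          using carleson_window_borel[OF Ib(1)] by (auto simp: sets_disk_iff[OF \<mu>] carleson_window_def)
      qed
      finally have "c * emeasure \<sigma> I / emeasure \<sigma> I \<le> emeasure (density \<mu> q) (carleson_window I) / emeasure \<sigma> I"
        by (rule divide_right_mono_ennreal)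
      then show ?thesis using fin[OF I] by (simp add: ennreal_mult_divide_eq)
    qed
    then have "c \<le> (INF I\<in>{I. open_arc I}. emeasure (density \<mu> q) (carleson_window I) / emeasure \<sigma> I)"
      by (intro INF_greatest) auto
    then show "(INF I\<in>{I. open_arc I}. emeasure (density \<mu> q) (carleson_window I) / emeasure \<sigma> I) > 0"
      using c(1) by (rule order_less_le_trans[rotated])
  }
qed

section \<open>Testing on kernel functions\<close>

text \<open>Squared norms are additive under integration, which the later estimates exploit. When
  the integral is infinite, \<open>C > 0\<close> makes both right-hand sides infinite.\<close>

lemma le_L2_norm_ext_iff:
  assumes "0 < C" "0 \<le> a"
  shows "ennreal a \<le> ennreal C * L2_norm_ext \<mu> f \<longleftrightarrow>
    ennreal (a\<^sup>2) \<le> ennreal (C\<^sup>2) * (\<integral>\<^sup>+z. ennreal ((cmod (nt_ext f z))\<^sup>2) \<partial>\<mu>)"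
proof -
  define q where "q = (\<integral>\<^sup>+z. ennreal ((cmod (nt_ext f z))\<^sup>2) \<partial>\<mu>)"
  show ?thesis
  proof (cases "q = \<infinity>")
    case True
    then show ?thesis
      using assms by (simp add: L2_norm_ext_def Let_def q_def ennreal_mult_top)
  next
    case False
    then obtain x where x: "q = ennreal x" "0 \<le> x" by (cases q) auto
    have L: "L2_norm_ext \<mu> f = ennreal (sqrt x)"
      using False x by (simp add: L2_norm_ext_def Let_def q_def)
    have "a \<le> C * sqrt x \<longleftrightarrow> a\<^sup>2 \<le> C\<^sup>2 * x"
    proof -
      have "a \<le> C * sqrt x \<longleftrightarrow> a\<^sup>2 \<le> (C * sqrt x)\<^sup>2"
        using assms x by (auto intro: power2_le_imp_le power_mono)
      then show ?thesis using x by (simp add: power_mult_distrib)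
    qed
    moreover have "ennreal C * ennreal (sqrt x) = ennreal (C * sqrt x)" "ennreal (C\<^sup>2) * ennreal x = ennreal (C\<^sup>2 * x)"
      using assms x by (simp_all add: ennreal_mult)
    ultimately show ?thesis
      using assms x unfolding L q_def[symmetric] x(1) by (simp add: ennreal_le_iff)
  qed
qed

lemma circle_null_of_compact_null:
  assumes A: "A \<in> sets \<sigma>" and K: "\<And>K. compact K \<Longrightarrow> K \<subseteq> A \<Longrightarrow> emeasure \<sigma> K = 0"
  shows "A \<in> null_sets \<sigma>"
proof -
  have Ab: "A \<in> sets borel" "A \<subseteq> sphere 0 1" using A by (auto simp: sets_circle_iff)
  define D where "D = distr \<sigma> borel (\<lambda>x. x)"
  have De: "emeasure D B = emeasure \<sigma> (B \<inter> sphere 0 1)" if "B \<in> sets borel" for B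
    unfolding D_def by (subst emeasure_distr[OF measurable_ident_circle that]) simp
  have "emeasure \<sigma> A = emeasure D A" using De[OF Ab(1)] Ab(2) by (simp add: Int_absorb2)
  also have "\<dots> = (SUP K \<in> {K. K \<subseteq> A \<and> compact K}. emeasure D K)"
    by (rule inner_regular) (use Ab De[of UNIV] in \<open>auto simp: D_def\<close>)
  also have "\<dots> \<le> 0"
  proof (rule SUP_least)
    fix K assume K': "K \<in> {K. K \<subseteq> A \<and> compact K}"
    then have "K \<inter> sphere 0 1 = K" using Ab by auto
    then have "emeasure D K = emeasure \<sigma> K"
      using K' De[of K] by (simp add: borel_closed compact_imp_closed)
    then show "emeasure D K \<le> 0" using K K' by simp
  qed
  finally show ?thesis using A by (simp add: null_sets_def)
qed

lemma szego_swap: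
  assumes "cmod x = 1"
  shows "cmod (szego (of_real r * x) z) = cmod (szego (of_real r * z) x)"
proof -
  have "cnj (1 - cnj (of_real r * x) * z) = 1 - cnj (of_real r * z) * x" by simp
  then have "cmod (1 - cnj (of_real r * x) * z) = cmod (1 - cnj (of_real r * z) * x)"
    by (metis complex_mod_cnj)
  then show ?thesis by (simp add: szego_def norm_divide)
qed

lemma cmod_one_minus_cnj_mult_le:
  assumes "cmod a \<le> 1" "cmod c \<le> 1"
  shows "(cmod (1 - cnj a * c))\<^sup>2 \<le> 4"
proof -
  have "cmod (1 - cnj a * c) \<le> cmod 1 + cmod (cnj a * c)" by (rule norm_triangle_ineq4)
  also have "\<dots> \<le> 1 + 1 * 1" unfolding norm_mult complex_mod_cnj using assms by (intro add_mono mult_mono) auto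
  finally have "(cmod (1 - cnj a * c))\<^sup>2 \<le> 2\<^sup>2" by (intro power_mono) auto
  then show ?thesis by simp
qed

locale boundary_setup =
  fixes \<mu> :: "complex measure" and b :: "complex \<Rightarrow> complex"
  assumes \<mu>: "\<mu> \<in> disk_measures" and b: "b \<in> Hinf_ball" and adm: "admissible \<mu> b"
begin

abbreviation defect :: "nat \<Rightarrow> complex \<Rightarrow> real" where
  "defect n x \<equiv> 1 - (cmod (b (of_real (rad n) * x)))\<^sup>2"

abbreviation gap :: "complex \<Rightarrow> real" where
  "gap z \<equiv> 1 - (cmod (nt_ext b z))\<^sup>2"

lemma bh: "b holomorphic_on ball 0 1" and b1: "z \<in> ball 0 1 \<Longrightarrow> cmod (b z) \<le> 1"
  using b by (auto simp: Hinf_ball_def)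

lemma B1: "z \<in> cball 0 1 \<Longrightarrow> cmod (nt_ext b z) \<le> 1"
  using cmod_nt_ext_le_1[OF b] by simp

lemma fin\<mu>: "finite_measure \<mu>"
  using \<mu> by (simp add: disk_measures_def)

lemma AE_nt_points: "AE z in \<mu>. z \<in> sphere 0 1 \<longrightarrow> z \<in> nt_points b"
  using adm by (auto simp: admissible_def nt_points_def)

lemma B_meas: "nt_ext b \<in> borel_measurable \<mu>"
  unfolding measurable_disk_iff[OF \<mu>] by (rule nt_ext_measurable[OF bh])

lemma B_meas_circle: "nt_ext b \<in> borel_measurable \<sigma>"
proof -
  have "nt_ext b \<in> borel_measurable (restrict_space \<mu> (sphere 0 1))" by (rule measurable_restrict_space1[OF B_meas])
  then show ?thesis using measurable_cong_sets[OF sets_circle_trace[OF \<mu>] refl] by blast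
qed

lemma nt_ext_kb:
  assumes w: "w \<in> ball 0 1"
  shows "AE z in \<mu>. nt_ext (kb b w) z = (1 - cnj (b w) * nt_ext b z) * szego w z"
  using AE_nt_points AE_space
proof eventually_elim
  case (elim z)
  show ?case
  proof (cases "z \<in> ball 0 1")
    case True
    then show ?thesis by (simp add: nt_ext_def kb_def szego_def)
  next
    case False
    then have z: "cmod z = 1" using elim by (auto simp: space_disk[OF \<mu>])
    then have "z \<in> nt_points b" using elim by simp
    then show ?thesis using nt_ext_eq[OF z nt_points_kb[of w z b]] w by (simp add: szego_def)
  qed
qed

text \<open>By \<open>szego_swap\<close> the integral in \<open>x\<close> is a Poisson average at
  \<open>rad n * z\<close>, up to the factor \<open>\<theta> n\<close>. Inside the disk
  \<open>\<theta> n\<close> tends to \<open>0\<close>; on the circle it is \<open>1\<close>, and the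
  average converges by the non-tangential limit of \<open>b\<close> at \<open>z\<close>. The bound
  \<open>4\<close> comes from \<open>|1 - cnj a * c|^2 \<le> 4\<close> for \<open>a\<close>,
  \<open>c\<close> in the closed disk.\<close>

lemma kernel_average_limit:
  fixes \<phi> :: "complex \<Rightarrow> real"
  assumes \<phi>: "\<And>S. continuous_on S \<phi>" "\<And>x. 0 \<le> \<phi> x" "\<And>x. \<phi> x \<le> 1" and z: "z \<in> cball 0 1" "z \<in> sphere 0 1 \<longrightarrow> z \<in> nt_points b"
  defines "\<Phi> \<equiv> \<lambda>n. \<integral>\<^sup>+x. ennreal (\<phi> x * (1 - (rad n)\<^sup>2) * (cmod (1 - cnj (b (of_real (rad n) * x)) * nt_ext b z))\<^sup>2
      * (cmod (szego (of_real (rad n) * x) z))\<^sup>2) \<partial>\<sigma>"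
  shows "\<Phi> \<longlonglongrightarrow> ennreal (indicator (sphere 0 1) z * (\<phi> z * (gap z)\<^sup>2))" and "\<Phi> n \<le> 4"
proof -
  define g where "g n x = \<phi> x * (cmod (1 - cnj (b (of_real (rad n) * x)) * nt_ext b z))\<^sup>2" for n x
  define \<theta> where "\<theta> n = (1 - (rad n)\<^sup>2) / (1 - (cmod (of_real (rad n) * z))\<^sup>2)" for n
  have w: "cmod (of_real (rad n) * z) < 1" for n using dilate_in_ball[OF rad(1,2)[of n], of z] z by simp
  have wr: "cmod (of_real (rad n) * z) \<le> rad n" for n
    using z rad(1)[of n] unfolding norm_mult norm_of_real by (simp add: mult_left_le)
  have r2: "(rad n)\<^sup>2 < 1" for n using rad(1,2)[of n] by (simp add: abs_square_less_1)
  have w2: "(cmod (of_real (rad n) * z))\<^sup>2 \<le> (rad n)\<^sup>2" for n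
    using wr by (intro power_mono) auto
  have \<theta>: "0 \<le> \<theta> n" "\<theta> n \<le> 1" for n
    using w2[of n] r2[of n] by (auto simp: \<theta>_def)
  have gc: "continuous_on (sphere 0 1) (g n)" for n
    unfolding g_def by (intro continuous_intros \<phi> continuous_on_subset[OF continuous_on_dilate[OF bh rad(1,2)]]) auto
  have g4: "0 \<le> g n x" "g n x \<le> 4" if "x \<in> sphere 0 1" for n x
  proof -
    have "cmod (b (of_real (rad n) * x)) \<le> 1" using that by (intro b1 dilate_in_ball rad) auto
    then have "g n x \<le> 1 * 4" unfolding g_def using \<phi> B1[OF z(1)]
      by (intro mult_mono cmod_one_minus_cnj_mult_le) auto
    then show "g n x \<le> 4" by simp
    show "0 \<le> g n x" using \<phi> by (simp add: g_def)
  qed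
  define I where "I n = (\<integral>x. g n x * poisson (of_real (rad n) * z) x \<partial>\<sigma>)" for n
  have gp: "continuous_on (sphere 0 1) (\<lambda>x. g n x * poisson (of_real (rad n) * z) x)" for n
    by (intro continuous_intros gc continuous_on_poisson w)
  have gp0: "0 \<le> g n x * poisson (of_real (rad n) * z) x" if "x \<in> sphere 0 1" for n x
    using w[of n] by (intro mult_nonneg_nonneg g4 that poisson_nonneg) auto
  have I: "0 \<le> I n" "I n \<le> 4" for n
  proof -
    show "0 \<le> I n" unfolding I_def using gp0 by (intro Bochner_Integration.integral_nonneg) auto
    have "I n \<le> (\<integral>x. 4 * poisson (of_real (rad n) * z) x \<partial>\<sigma>)"
      unfolding I_def
    proof (intro Bochner_Integration.integral_mono integrable_circleI gp)
      show "continuous_on (sphere 0 1) (\<lambda>x. 4 * poisson (of_real (rad n) * z) x)"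
        by (intro continuous_intros continuous_on_poisson w)
      show "g n x * poisson (of_real (rad n) * z) x \<le> 4 * poisson (of_real (rad n) * z) x" if "x \<in> space \<sigma>" for x
        using that w[of n] by (intro mult_right_mono g4 poisson_nonneg) auto
    qed
    then show "I n \<le> 4" by (simp add: integral_poisson w)
  qed
  have \<Phi>: "\<Phi> n = ennreal (\<theta> n * I n)" for n
  proof -
    have "\<Phi> n = (\<integral>\<^sup>+x. ennreal (\<theta> n * (g n x * poisson (of_real (rad n) * z) x)) \<partial>\<sigma>)"
      unfolding \<Phi>_def
    proof (intro nn_integral_cong arg_cong[where f = ennreal])
      fix x assume "x \<in> space \<sigma>"
      then have x: "cmod x = 1" by simp
      have "1 - (cmod (of_real (rad n) * z))\<^sup>2 \<noteq> 0" using w2[of n] r2[of n] by simp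
      then have e: "\<theta> n * (1 - (cmod (of_real (rad n) * z))\<^sup>2) = 1 - (rad n)\<^sup>2"
        unfolding \<theta>_def times_divide_eq_left by (rule nonzero_mult_div_cancel_right)
      have "\<theta> n * (g n x * poisson (of_real (rad n) * z) x) =
         (\<theta> n * (1 - (cmod (of_real (rad n) * z))\<^sup>2)) * (g n x * (cmod (szego (of_real (rad n) * z) x))\<^sup>2)"
        unfolding poisson_def by (simp only: mult_ac)
      then show "\<phi> x * (1 - (rad n)\<^sup>2) * (cmod (1 - cnj (b (of_real (rad n) * x)) * nt_ext b z))\<^sup>2
          * (cmod (szego (of_real (rad n) * x) z))\<^sup>2 = \<theta> n * (g n x * poisson (of_real (rad n) * z) x)"
        unfolding e szego_swap[OF x] g_def by (simp only: mult_ac)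
    qed
    also have "\<dots> = ennreal (\<integral>x. \<theta> n * (g n x * poisson (of_real (rad n) * z) x) \<partial>\<sigma>)"
      by (intro nn_integral_circle_eq_integral continuous_intros gp mult_nonneg_nonneg \<theta> gp0)
         (use w in \<open>auto intro: continuous_on_subset[OF gc] continuous_on_poisson\<close>)
    finally show ?thesis by (simp add: I_def)
  qed
  have "\<theta> n * I n \<le> 1 * 4" by (intro mult_mono \<theta> I) auto
  then have "ennreal (\<theta> n * I n) \<le> ennreal 4" by (intro ennreal_leI) simp
  then show "\<Phi> n \<le> 4" by (simp add: \<Phi>)
  have "(\<lambda>n. \<theta> n * I n) \<longlonglongrightarrow> indicator (sphere 0 1) z * (\<phi> z * (gap z)\<^sup>2)"
  proof (cases "z \<in> sphere 0 1")
    case False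
    then have z1: "cmod z < 1" using z by auto
    then have z2: "(cmod z)\<^sup>2 < 1" by (simp add: abs_square_less_1)
    have "\<theta> \<longlonglongrightarrow> (1 - 1\<^sup>2) / (1 - (cmod (of_real 1 * z))\<^sup>2)"
      unfolding \<theta>_def using z2 by (intro tendsto_intros rad) auto
    then have t0: "(\<lambda>n. 4 * \<theta> n) \<longlonglongrightarrow> 0" using tendsto_mult_left[of \<theta> 0 sequentially 4] by simp
    have "(\<lambda>n. \<theta> n * I n) \<longlonglongrightarrow> 0"
    proof (rule Lim_null_comparison[OF always_eventually t0], intro allI)
      fix n
      have "\<theta> n * I n \<le> \<theta> n * 4" by (intro mult_left_mono I \<theta>)
      then show "norm (\<theta> n * I n) \<le> 4 * \<theta> n" using \<theta>(1)[of n] I(1)[of n] by simp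
    qed
    then show ?thesis using False by simp
  next
    case True
    then have z1: "cmod z = 1" and zn: "z \<in> nt_points b" using z by auto
    have "\<theta> n = 1" for n
      using r2[of n] z1 rad(1)[of n] unfolding \<theta>_def norm_mult norm_of_real by simp
    moreover have "I \<longlonglongrightarrow> \<phi> z * (gap z)\<^sup>2"
      unfolding I_def
    proof (rule poisson_average_tendsto[OF z1 rad gc])
      show "\<bar>g n x\<bar> \<le> 4" if "x \<in> sphere 0 1" for n x using g4[OF that, of n] by simp
      fix \<alpha> x assume \<alpha>: "1 < \<alpha>" and x: "\<And>n. x n \<in> sphere 0 1" "\<And>n. of_real (rad n) * x n \<in> stolz \<alpha> z"
      have r1: "(\<lambda>n. \<alpha> * (1 - rad n)) \<longlonglongrightarrow> 0"
        using tendsto_mult_left[OF tendsto_diff[OF tendsto_const rad(3)], of \<alpha> 1] by simp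
      have sl: "(\<lambda>n. of_real (rad n) * x n) \<longlonglongrightarrow> z"
      proof (rule LIM_zero_cancel, rule Lim_null_comparison[OF always_eventually r1], intro allI)
        fix n
        have "cmod (of_real (rad n) * x n - z) < \<alpha> * (1 - cmod (of_real (rad n) * x n))"
          using x(2)[of n] by (simp add: stolz_def)
        moreover have "cmod (of_real (rad n) * x n) = rad n" using x(1)[of n] rad(1)[of n] by (simp add: norm_mult)
        ultimately show "norm (of_real (rad n) * x n - z) \<le> \<alpha> * (1 - rad n)" by simp
      qed
      \<comment> \<open>\<phi> is evaluated at \<open>x n\<close> on the circle, whereas the Stolz
        condition concerns \<open>rad n * x n\<close>; so convergence of \<open>x n\<close> has to
        be derived separately.\<close>
      have r1': "(\<lambda>n. 1 - rad n) \<longlonglongrightarrow> 0"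
        using tendsto_diff[OF tendsto_const rad(3), of 1] by simp
      have "(\<lambda>n. of_real (rad n) * x n - x n) \<longlonglongrightarrow> 0"
      proof (rule Lim_null_comparison[OF always_eventually r1'], intro allI)
        fix n
        have "of_real (rad n) * x n - x n = of_real (rad n - 1) * x n" by (simp add: algebra_simps)
        then show "norm (of_real (rad n) * x n - x n) \<le> 1 - rad n"
          using x(1)[of n] rad(2)[of n] by (simp add: norm_mult del: of_real_diff)
      qed
      from tendsto_diff[OF sl this] have xl: "x \<longlonglongrightarrow> z" by simp
      have bl: "(\<lambda>n. b (of_real (rad n) * x n)) \<longlonglongrightarrow> nt_ext b z"
        by (rule nt_ext_seq[OF zn \<alpha> x(2) sl])
      have pl: "(\<lambda>n. \<phi> (x n)) \<longlonglongrightarrow> \<phi> z"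
        using \<phi>(1)[of UNIV] xl by (auto simp: continuous_on_eq_continuous_at intro: isCont_tendsto_compose)
      have "(\<lambda>n. g n (x n)) \<longlonglongrightarrow> \<phi> z * (cmod (1 - cnj (nt_ext b z) * nt_ext b z))\<^sup>2"
        unfolding g_def by (intro tendsto_intros bl pl)
      also have "cnj (nt_ext b z) * nt_ext b z = of_real ((cmod (nt_ext b z))\<^sup>2)"
        by (subst complex_norm_square) (rule mult.commute)
      also have "(cmod (1 - of_real ((cmod (nt_ext b z))\<^sup>2)))\<^sup>2 = (gap z)\<^sup>2"
        by (metis norm_of_real of_real_1 of_real_diff power2_abs)
      finally show "(\<lambda>n. g n (x n)) \<longlonglongrightarrow> \<phi> z * (gap z)\<^sup>2" .
    qed
    ultimately show ?thesis using True by simp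
  qed
  then show "\<Phi> \<longlonglongrightarrow> ennreal (indicator (sphere 0 1) z * (\<phi> z * (gap z)\<^sup>2))"
    unfolding \<Phi> by (rule tendsto_ennrealI)
qed

context
  fixes C :: real
  assumes C: "0 < C" and test: "\<And>w. w \<in> ball 0 1 \<Longrightarrow> ennreal ((1 - (cmod (b w))\<^sup>2) / (1 - (cmod w)\<^sup>2)) \<le>
      ennreal (C\<^sup>2) * (\<integral>\<^sup>+z. ennreal ((cmod ((1 - cnj (b w) * nt_ext b z) * szego w z))\<^sup>2) \<partial>\<mu>)"
begin

text \<open>The hypothesis \<open>test\<close> at \<open>w = r\<^sub>n x\<close> is multiplied by \<open>(1 - r\<^sub>n\<^sup>2) * bump K j x\<close> and integrated in \<open>x\<close>. After
  exchanging the integrals the inner one is a Poisson average of boundary values of \<open>b\<close>.\<close>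

lemma defect_le_bump:
  assumes K: "compact K" "K \<subseteq> sphere 0 1"
  shows "liminf (\<lambda>n. \<integral>\<^sup>+x. ennreal (indicator K x * defect n x) \<partial>\<sigma>)
    \<le> ennreal (C\<^sup>2) * (\<integral>\<^sup>+z. ennreal (indicator (sphere 0 1) z * (bump K j z * (gap z)\<^sup>2)) \<partial>\<mu>)"
proof -
  interpret \<mu>: finite_measure \<mu> by (rule fin\<mu>)
  interpret pair_sigma_finite \<sigma> \<mu> ..
  define \<phi> where "\<phi> = bump K j"
  have \<phi>: "\<And>S. continuous_on S \<phi>" "\<And>x. 0 \<le> \<phi> x" "\<And>x. \<phi> x \<le> 1"
    by (auto simp: \<phi>_def bump_nonneg bump_le_1 intro: continuous_intros)
  define \<Psi> where "\<Psi> n x z = ennreal (\<phi> x * (1 - (rad n)\<^sup>2) * (cmod (1 - cnj (b (of_real (rad n) * x)) * nt_ext b z))\<^sup>2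
      * (cmod (szego (of_real (rad n) * x) z))\<^sup>2)" for n x z
  have \<Psi>m: "case_prod (\<Psi> n) \<in> borel_measurable (\<sigma> \<Otimes>\<^sub>M \<mu>)" for n
  proof -
    have id\<mu>: "(\<lambda>z. z) \<in> borel_measurable \<mu>"
      unfolding measurable_disk_iff[OF \<mu>] by (rule measurable_restrict_space1) simp
    have bm: "(\<lambda>x. b (of_real (rad n) * x)) \<in> borel_measurable \<sigma>"
      by (intro borel_measurable_circleI continuous_on_subset[OF continuous_on_dilate[OF bh rad(1,2)]]) auto
    have \<phi>m: "\<phi> \<in> borel_measurable \<sigma>" by (intro borel_measurable_circleI \<phi>)
    have [measurable]: "(\<lambda>p. b (of_real (rad n) * fst p)) \<in> borel_measurable (\<sigma> \<Otimes>\<^sub>M \<mu>)"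
      "(\<lambda>p. \<phi> (fst p)) \<in> borel_measurable (\<sigma> \<Otimes>\<^sub>M \<mu>)"
      "(\<lambda>p. fst p) \<in> borel_measurable (\<sigma> \<Otimes>\<^sub>M \<mu>)"
      "(\<lambda>p. snd p) \<in> borel_measurable (\<sigma> \<Otimes>\<^sub>M \<mu>)"
      "(\<lambda>p. nt_ext b (snd p)) \<in> borel_measurable (\<sigma> \<Otimes>\<^sub>M \<mu>)"
      by (rule measurable_compose[OF measurable_fst bm] measurable_compose[OF measurable_fst \<phi>m]
          measurable_compose[OF measurable_fst measurable_ident_circle]
          measurable_compose[OF measurable_snd id\<mu>] measurable_compose[OF measurable_snd B_meas])+
    show ?thesis
      unfolding \<Psi>_def szego_def case_prod_unfold
      by (intro measurable_compose[OF _ measurable_ennreal] borel_measurable_times borel_measurable_diff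
          borel_measurable_power borel_measurable_const borel_measurable_norm borel_measurable_divide)
         measurable
  qed
  have step: "(\<integral>\<^sup>+x. ennreal (indicator K x * defect n x) \<partial>\<sigma>) \<le>
      ennreal (C\<^sup>2) * (\<integral>\<^sup>+z. \<integral>\<^sup>+x. \<Psi> n x z \<partial>\<sigma> \<partial>\<mu>)" for n
  proof -
    have r2: "(rad n)\<^sup>2 < 1" using rad(1,2)[of n] by (simp add: abs_square_less_1)
    have "(\<integral>\<^sup>+x. ennreal (indicator K x * defect n x) \<partial>\<sigma>) \<le>
        (\<integral>\<^sup>+x. ennreal (C\<^sup>2) * (\<integral>\<^sup>+z. \<Psi> n x z \<partial>\<mu>) \<partial>\<sigma>)"
    proof (rule nn_integral_mono)
      fix x assume "x \<in> space \<sigma>"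
      then have x: "cmod x = 1" by simp
      define w where "w = of_real (rad n) * x"
      have w: "w \<in> ball 0 1" unfolding w_def by (intro dilate_in_ball rad) (simp add: x)
      have cw: "cmod w = rad n" using x rad(1)[of n] by (simp add: w_def norm_mult)
      have bw: "(cmod (b w))\<^sup>2 \<le> 1" using b1[OF w] by (simp add: power_le_one)
      \<comment> \<open>On the circle of radius \<open>rad n\<close> the quantity
        \<open>1 - |w|^2\<close> is constant: it cancels the denominator of the squared kernel norm
        on the left and normalises the Poisson kernel on the right.\<close>
      define \<kappa> where "\<kappa> = \<phi> x * (1 - (rad n)\<^sup>2)"
      have \<kappa>0: "0 \<le> \<kappa>" using \<phi> r2 by (simp add: \<kappa>_def)
      have "indicator K x * (1 - (cmod (b w))\<^sup>2) \<le> \<phi> x * (1 - (cmod (b w))\<^sup>2)"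
        using bw \<phi>(2)[of x] bump_eq_1[of x K j] by (intro mult_right_mono) (auto simp: indicator_def \<phi>_def)
      also have "\<dots> = \<kappa> * ((1 - (cmod (b w))\<^sup>2) / (1 - (cmod w)\<^sup>2))"
        using r2 by (simp add: \<kappa>_def cw)
      finally have "ennreal (indicator K x * (1 - (cmod (b w))\<^sup>2)) \<le> ennreal (\<kappa> * ((1 - (cmod (b w))\<^sup>2) / (1 - (cmod w)\<^sup>2)))"
        by (rule ennreal_leI)
      also have "\<dots> = ennreal \<kappa> * ennreal ((1 - (cmod (b w))\<^sup>2) / (1 - (cmod w)\<^sup>2))"
        by (intro ennreal_mult \<kappa>0) (use bw r2 in \<open>simp add: cw\<close>)
      also have "\<dots> \<le> ennreal \<kappa> * (ennreal (C\<^sup>2) * (\<integral>\<^sup>+z. ennreal ((cmod ((1 - cnj (b w) * nt_ext b z) * szego w z))\<^sup>2) \<partial>\<mu>))"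
        by (intro mult_left_mono test w) simp
      also have "\<dots> = ennreal (C\<^sup>2) * (ennreal \<kappa> * (\<integral>\<^sup>+z. ennreal ((cmod ((1 - cnj (b w) * nt_ext b z) * szego w z))\<^sup>2) \<partial>\<mu>))"
        by (simp only: mult_ac)
      also have "ennreal \<kappa> * (\<integral>\<^sup>+z. ennreal ((cmod ((1 - cnj (b w) * nt_ext b z) * szego w z))\<^sup>2) \<partial>\<mu>) =
          (\<integral>\<^sup>+z. ennreal \<kappa> * ennreal ((cmod ((1 - cnj (b w) * nt_ext b z) * szego w z))\<^sup>2) \<partial>\<mu>)"
      proof (rule nn_integral_cmult[symmetric])
        have s: "szego w \<in> borel_measurable \<mu>"
          unfolding measurable_disk_iff[OF \<mu>]
          by (intro borel_measurable_continuous_on_restrict continuous_on_szego[where f = "\<lambda>x. x"] continuous_on_id) (use w in auto)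
        note [measurable] = s B_meas
        show "(\<lambda>z. ennreal ((cmod ((1 - cnj (b w) * nt_ext b z) * szego w z))\<^sup>2)) \<in> borel_measurable \<mu>" by measurable
      qed
      also have "\<dots> = (\<integral>\<^sup>+z. \<Psi> n x z \<partial>\<mu>)"
        using \<kappa>0 unfolding \<Psi>_def w_def[symmetric] \<kappa>_def[symmetric]
        by (intro nn_integral_cong) (simp only: ennreal_mult'[OF \<kappa>0, symmetric] norm_mult power_mult_distrib mult.assoc)
      finally show "ennreal (indicator K x * defect n x) \<le> ennreal (C\<^sup>2) * (\<integral>\<^sup>+z. \<Psi> n x z \<partial>\<mu>)"
        by (simp only: w_def)
    qed
    also have "\<dots> = ennreal (C\<^sup>2) * (\<integral>\<^sup>+x. \<integral>\<^sup>+z. \<Psi> n x z \<partial>\<mu> \<partial>\<sigma>)"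
      by (rule nn_integral_cmult) (rule \<mu>.borel_measurable_nn_integral[OF \<Psi>m])
    also have "(\<integral>\<^sup>+x. \<integral>\<^sup>+z. \<Psi> n x z \<partial>\<mu> \<partial>\<sigma>) = (\<integral>\<^sup>+z. \<integral>\<^sup>+x. \<Psi> n x z \<partial>\<sigma> \<partial>\<mu>)"
      using Fubini'[OF \<Psi>m] by simp
    finally show ?thesis .
  qed
  have "(\<lambda>n. \<integral>\<^sup>+z. \<integral>\<^sup>+x. \<Psi> n x z \<partial>\<sigma> \<partial>\<mu>) \<longlonglongrightarrow>
     (\<integral>\<^sup>+z. ennreal (indicator (sphere 0 1) z * (\<phi> z * (gap z)\<^sup>2)) \<partial>\<mu>)"
  proof (rule nn_integral_dominated_convergence[where w = "\<lambda>_. 4"])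
    show "(\<lambda>z. \<integral>\<^sup>+x. \<Psi> n x z \<partial>\<sigma>) \<in> borel_measurable \<mu>" for n
    proof -
      interpret Q: pair_sigma_finite \<mu> \<sigma> ..
      show ?thesis
        by (rule circle.borel_measurable_nn_integral) (use measurable_pair_swap[OF \<Psi>m] in \<open>simp add: case_prod_unfold\<close>)
    qed
    show "(\<lambda>z. ennreal (indicator (sphere 0 1) z * (\<phi> z * (gap z)\<^sup>2))) \<in> borel_measurable \<mu>"
    proof -
      have \<phi>m: "\<phi> \<in> borel_measurable \<mu>"
        unfolding measurable_disk_iff[OF \<mu>] by (intro borel_measurable_continuous_on_restrict \<phi>)
      note [measurable] = B_meas \<phi>m sphere_sets_disk[OF \<mu>]
      show ?thesis by measurable
    qed
    show "(\<integral>\<^sup>+z. 4 \<partial>\<mu>) < \<infinity>" by (simp add: \<mu>.emeasure_finite less_top[symmetric] ennreal_mult_eq_top_iff)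
    show "AE z in \<mu>. (\<integral>\<^sup>+x. \<Psi> n x z \<partial>\<sigma>) \<le> 4" for n
      using AE_nt_points AE_space
      by eventually_elim (unfold \<Psi>_def, rule kernel_average_limit(2)[OF \<phi>], auto simp: space_disk[OF \<mu>])
    show "AE z in \<mu>. (\<lambda>n. \<integral>\<^sup>+x. \<Psi> n x z \<partial>\<sigma>) \<longlonglongrightarrow> ennreal (indicator (sphere 0 1) z * (\<phi> z * (gap z)\<^sup>2))"
      using AE_nt_points AE_space
      by eventually_elim (unfold \<Psi>_def, rule kernel_average_limit(1)[OF \<phi>], auto simp: space_disk[OF \<mu>])
  qed simp
  then have "(\<lambda>n. ennreal (C\<^sup>2) * (\<integral>\<^sup>+z. \<integral>\<^sup>+x. \<Psi> n x z \<partial>\<sigma> \<partial>\<mu>)) \<longlonglongrightarrow>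
     ennreal (C\<^sup>2) * (\<integral>\<^sup>+z. ennreal (indicator (sphere 0 1) z * (\<phi> z * (gap z)\<^sup>2)) \<partial>\<mu>)"
    by (rule ennreal_tendsto_cmult[rotated]) simp
  then have "liminf (\<lambda>n. ennreal (C\<^sup>2) * (\<integral>\<^sup>+z. \<integral>\<^sup>+x. \<Psi> n x z \<partial>\<sigma> \<partial>\<mu>)) =
     ennreal (C\<^sup>2) * (\<integral>\<^sup>+z. ennreal (indicator (sphere 0 1) z * (\<phi> z * (gap z)\<^sup>2)) \<partial>\<mu>)"
    by (rule lim_imp_Liminf[rotated]) simp
  moreover have "liminf (\<lambda>n. \<integral>\<^sup>+x. ennreal (indicator K x * defect n x) \<partial>\<sigma>)
    \<le> liminf (\<lambda>n. ennreal (C\<^sup>2) * (\<integral>\<^sup>+z. \<integral>\<^sup>+x. \<Psi> n x z \<partial>\<sigma> \<partial>\<mu>))"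
    by (intro Liminf_mono always_eventually allI step)
  ultimately show ?thesis by (simp only: \<phi>_def)
qed

text \<open>Only the right-hand side of the bump estimate depends on \<open>j\<close>, and it tends
  to the integral over \<open>K\<close>. Empty \<open>K\<close> is set apart because the bump is
  then constantly \<open>1\<close>.\<close>

lemma defect_le:
  assumes K: "compact K" "K \<subseteq> sphere 0 1"
  shows "liminf (\<lambda>n. \<integral>\<^sup>+x. ennreal (indicator K x * defect n x) \<partial>\<sigma>)
    \<le> (\<integral>\<^sup>+z. (ennreal (C\<^sup>2) * ennreal ((gap z)\<^sup>2)) * indicator K z \<partial>restrict_space \<mu> (sphere 0 1))"
proof (cases "K = {}")
  case False
  interpret \<mu>: finite_measure \<mu> by (rule fin\<mu>)
  have Ks: "K \<in> sets \<mu>" using K by (auto simp: sets_disk_iff[OF \<mu>] borel_closed compact_imp_closed)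
  note [measurable] = B_meas sphere_sets_disk[OF \<mu>] Ks
  have bm[measurable]: "bump K j \<in> borel_measurable \<mu>" for j
    unfolding measurable_disk_iff[OF \<mu>] by (intro borel_measurable_continuous_on_restrict continuous_intros)
  have "(\<lambda>j. \<integral>\<^sup>+z. ennreal (indicator (sphere 0 1) z * (bump K j z * (gap z)\<^sup>2)) \<partial>\<mu>) \<longlonglongrightarrow>
      (\<integral>\<^sup>+z. ennreal (indicator (sphere 0 1) z * (indicator K z * (gap z)\<^sup>2)) \<partial>\<mu>)"
  proof (rule nn_integral_dominated_convergence[where w = "\<lambda>_. 1"])
    show "(\<integral>\<^sup>+z. 1 \<partial>\<mu>) < \<infinity>" by (simp add: \<mu>.emeasure_finite less_top[symmetric])
    show "AE z in \<mu>. ennreal (indicator (sphere 0 1) z * (bump K j z * (gap z)\<^sup>2)) \<le> 1" for j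
      using AE_space
    proof eventually_elim
      case (elim z)
      then have "(cmod (nt_ext b z))\<^sup>2 \<le> 1" using B1[of z] by (simp add: space_disk[OF \<mu>] power_le_one)
      then have "(gap z)\<^sup>2 \<le> 1" by (intro power_le_one) auto
      then have "bump K j z * (gap z)\<^sup>2 \<le> 1 * 1"
        using bump_nonneg[of K j z] bump_le_1[of K j z] by (intro mult_mono) auto
      then show ?case by (auto simp: indicator_def ennreal_le_1)
    qed
    show "AE z in \<mu>. (\<lambda>j. ennreal (indicator (sphere 0 1) z * (bump K j z * (gap z)\<^sup>2)))
        \<longlonglongrightarrow> ennreal (indicator (sphere 0 1) z * (indicator K z * (gap z)\<^sup>2))"
      by (intro AE_I2 tendsto_ennrealI tendsto_mult tendsto_const bump_tendsto compact_imp_closed K False)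
  qed measurable
  then have "(\<lambda>j. ennreal (C\<^sup>2) * (\<integral>\<^sup>+z. ennreal (indicator (sphere 0 1) z * (bump K j z * (gap z)\<^sup>2)) \<partial>\<mu>)) \<longlonglongrightarrow>
      ennreal (C\<^sup>2) * (\<integral>\<^sup>+z. ennreal (indicator (sphere 0 1) z * (indicator K z * (gap z)\<^sup>2)) \<partial>\<mu>)"
    by (rule ennreal_tendsto_cmult[rotated]) simp
  then have "liminf (\<lambda>n. \<integral>\<^sup>+x. ennreal (indicator K x * defect n x) \<partial>\<sigma>)
    \<le> ennreal (C\<^sup>2) * (\<integral>\<^sup>+z. ennreal (indicator (sphere 0 1) z * (indicator K z * (gap z)\<^sup>2)) \<partial>\<mu>)"
    by (rule LIMSEQ_le_const) (use defect_le_bump[OF K] in blast)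
  also have "\<dots> = (\<integral>\<^sup>+z. ennreal (C\<^sup>2) * ennreal (indicator (sphere 0 1) z * (indicator K z * (gap z)\<^sup>2)) \<partial>\<mu>)"
    by (rule nn_integral_cmult[symmetric]) measurable
  also have "\<dots> = (\<integral>\<^sup>+z. (ennreal (C\<^sup>2) * ennreal ((gap z)\<^sup>2)) * indicator K z * indicator (sphere 0 1) z \<partial>\<mu>)"
    by (intro nn_integral_cong) (auto simp: indicator_def)
  finally show ?thesis unfolding nn_integral_circle_trace[OF \<mu>] .
qed (simp add: Liminf_const)

end

end

section \<open>Consequences of the kernel test for a non-extreme \<open>b\<close>\<close>

context boundary_setup
begin

context
  fixes C :: real
  assumes nonext: "Hinf_nonextreme b" and C: "0 < C"
    and test: "\<And>w. w \<in> ball 0 1 \<Longrightarrow> ennreal ((1 - (cmod (b w))\<^sup>2) / (1 - (cmod w)\<^sup>2)) \<le>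
      ennreal (C\<^sup>2) * (\<integral>\<^sup>+z. ennreal ((cmod ((1 - cnj (b w) * nt_ext b z) * szego w z))\<^sup>2) \<partial>\<mu>)"
begin

lemma defect_nonneg: "x \<in> sphere 0 1 \<Longrightarrow> 0 \<le> defect n x"
  using b1[of "of_real (rad n) * x"] dilate_in_ball[OF rad(1,2)[of n], of x] by (simp add: power_le_one)

lemma defect_integral:
  assumes K: "compact K" "K \<subseteq> sphere 0 1"
  shows "integrable \<sigma> (\<lambda>x. indicator K x * defect n x)"
    and "(\<integral>\<^sup>+x. ennreal (indicator K x * defect n x) \<partial>\<sigma>) =
      ennreal (\<integral>x. indicator K x * defect n x \<partial>\<sigma>)"
proof -
  have Ks: "K \<in> sets \<sigma>"
    using K by (auto simp: sets_circle_iff intro: borel_closed compact_imp_closed)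
  have c: "continuous_on (sphere 0 1) (\<lambda>x. defect n x)"
    by (intro continuous_intros continuous_on_subset[OF continuous_on_dilate[OF bh rad(1,2)]]) auto
  show i: "integrable \<sigma> (\<lambda>x. indicator K x * defect n x)"
    using integrable_mult_indicator[OF Ks integrable_circleI[OF c]] by simp
  show "(\<integral>\<^sup>+x. ennreal (indicator K x * defect n x) \<partial>\<sigma>) =
      ennreal (\<integral>x. indicator K x * defect n x \<partial>\<sigma>)"
    using defect_nonneg by (intro nn_integral_eq_integral[OF i] AE_I2) (auto simp: indicator_def)
qed

text \<open>A vanishing lower limit means that the means of the defect tend to \<open>0\<close>
  along a subsequence of the radii, which contradicts non-extremality unless \<open>K\<close> is
  null.\<close>

lemma null_of_defect_liminf_zero:
  assumes K: "compact K" "K \<subseteq> sphere 0 1"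
    and z: "liminf (\<lambda>n. \<integral>\<^sup>+x. ennreal (indicator K x * defect n x) \<partial>\<sigma>) = 0"
  shows "emeasure \<sigma> K = 0"
proof (rule ccontr)
  assume "emeasure \<sigma> K \<noteq> 0"
  then have pos: "0 < measure \<sigma> K"
    by (simp add: circle.emeasure_eq_measure less_le)
  define a where "a n = (\<integral>x. indicator K x * defect n x \<partial>\<sigma>)" for n
  have a0: "0 \<le> a n" for n
    unfolding a_def using defect_nonneg by (intro Bochner_Integration.integral_nonneg) (auto simp: indicator_def)
  have "liminf (\<lambda>n. ennreal (a n)) = 0" using z unfolding defect_integral(2)[OF K] a_def .
  then obtain s where s: "strict_mono s" "((\<lambda>n. ennreal (a n)) \<circ> s) \<longlonglongrightarrow> 0"
    using liminf_subseq_lim[of "\<lambda>n. ennreal (a n)"] by auto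
  have "(\<lambda>n. a (s n)) \<longlonglongrightarrow> 0"
    using s(2) a0 tendsto_ennreal_iff[of "\<lambda>n. a (s n)" sequentially 0] by (simp add: o_def)
  then have lim: "(\<lambda>n. \<integral>x. indicator K x * (1 - (cmod (b (of_real ((rad \<circ> s) n) * x)))\<^sup>2) \<partial>\<sigma>) \<longlonglongrightarrow> 0"
    by (simp add: a_def)
  show False
    by (rule Hinf_nonextreme_defect[OF nonext K pos _ _ LIMSEQ_subseq_LIMSEQ[OF rad(3) s(1)] lim]) (simp_all add: rad)
qed

text \<open>\<mu> does not charge a compact set of points at which \<open>b\<close> has no limit, so
  \<open>defect_le\<close> makes the lower limit of the defect means there \<open>0\<close>, and
  non-extremality makes the set null. The testing inequality thus provides the boundary values of
  \<open>b\<close>.\<close>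

lemma AE_circle_nt_points: "AE x in \<sigma>. x \<in> nt_points b"
proof -
  have Z: "sphere 0 1 - nt_points b \<in> sets \<sigma>"
    by (auto simp: sets_circle_iff intro!: sets.Diff)
  have "sphere 0 1 - nt_points b \<in> null_sets \<sigma>"
  proof (rule circle_null_of_compact_null[OF Z])
    fix K assume K: "compact K" "K \<subseteq> sphere 0 1 - nt_points b"
    then have K1: "K \<subseteq> sphere 0 1" by auto
    have "(\<integral>\<^sup>+z. (ennreal (C\<^sup>2) * ennreal ((gap z)\<^sup>2)) * indicator K z \<partial>restrict_space \<mu> (sphere 0 1)) =
        (\<integral>\<^sup>+z. 0 \<partial>\<mu>)"
      unfolding nn_integral_circle_trace[OF \<mu>]
    proof (rule nn_integral_cong_AE)
      show "AE z in \<mu>. (ennreal (C\<^sup>2) * ennreal ((gap z)\<^sup>2)) * indicator K z * indicator (sphere 0 1) z = 0"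
        using AE_nt_points by eventually_elim (use K in \<open>auto simp: indicator_def\<close>)
    qed
    then have "liminf (\<lambda>n. \<integral>\<^sup>+x. ennreal (indicator K x * defect n x) \<partial>\<sigma>) = 0"
      using defect_le[OF C test K(1) K1] by simp
    then show "emeasure \<sigma> K = 0" by (rule null_of_defect_liminf_zero[OF K(1) K1])
  qed
  from AE_not_in[OF this] AE_space show ?thesis
    by eventually_elim auto
qed

text \<open>Where the boundary value has modulus \<open>1\<close> the defect tends to
  \<open>0\<close> pointwise and boundedly, hence in mean over compact sets.\<close>

lemma AE_circle_norm_less_1: "AE x in \<sigma>. cmod (nt_ext b x) < 1"
proof -
  define A where "A = {x \<in> sphere 0 1. x \<in> nt_points b \<and> cmod (nt_ext b x) = 1}"
  have A: "A \<in> sets \<sigma>"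
  proof -
    note [measurable] = B_meas_circle
    have "{x \<in> space \<sigma>. cmod (nt_ext b x) = 1} \<in> sets \<sigma>" by measurable
    then have "{x \<in> space \<sigma>. cmod (nt_ext b x) = 1} \<inter> (nt_points b \<inter> sphere 0 1) \<in> sets \<sigma>"
      by (rule sets.Int) (auto simp: sets_circle_iff)
    moreover have "{x \<in> space \<sigma>. cmod (nt_ext b x) = 1} \<inter> (nt_points b \<inter> sphere 0 1) = A"
      by (auto simp: A_def)
    ultimately show ?thesis by simp
  qed
  have "A \<in> null_sets \<sigma>"
  proof (rule circle_null_of_compact_null[OF A])
    fix K assume K: "compact K" "K \<subseteq> A"
    then have K1: "K \<subseteq> sphere 0 1" by (auto simp: A_def)
    have Ks: "K \<in> sets \<sigma>"
      using K K1 by (auto simp: sets_circle_iff intro: borel_closed compact_imp_closed)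
    have "(\<lambda>n. \<integral>x. indicator K x * defect n x \<partial>\<sigma>) \<longlonglongrightarrow> (\<integral>x. 0 \<partial>\<sigma>)"
    proof (rule integral_dominated_convergence[where w = "\<lambda>_. 1"])
      show "(\<lambda>x. indicator K x * defect n x) \<in> borel_measurable \<sigma>" for n
        using defect_integral(1)[OF K(1) K1] by (rule borel_measurable_integrable)
      show "AE x in \<sigma>. norm (indicator K x * defect n x) \<le> 1" for n
        using defect_nonneg by (intro AE_I2) (auto simp: indicator_def)
      show "AE x in \<sigma>. (\<lambda>n. indicator K x * defect n x) \<longlonglongrightarrow> 0"
      proof (rule AE_I2)
        fix x
        show "(\<lambda>n. indicator K x * defect n x) \<longlonglongrightarrow> 0"
        proof (cases "x \<in> K")
          case True
          then have x: "x \<in> nt_points b" "cmod (nt_ext b x) = 1" using K by (auto simp: A_def)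
          have "(\<lambda>n. defect n x) \<longlonglongrightarrow> 1 - (cmod (nt_ext b x))\<^sup>2"
            by (intro tendsto_intros nt_ext_rad x)
          then show ?thesis using True x by simp
        qed simp
      qed
    qed auto
    then have "(\<lambda>n. ennreal (\<integral>x. indicator K x * defect n x \<partial>\<sigma>)) \<longlonglongrightarrow> ennreal 0"
      by (intro tendsto_ennrealI) simp
    then have "liminf (\<lambda>n. \<integral>\<^sup>+x. ennreal (indicator K x * defect n x) \<partial>\<sigma>) = ennreal 0"
      unfolding defect_integral(2)[OF K(1) K1] by (rule lim_imp_Liminf[rotated]) simp
    then show "emeasure \<sigma> K = 0"
      by (intro null_of_defect_liminf_zero[OF K(1) K1]) simp
  qed
  from AE_not_in[OF this] AE_circle_nt_points AE_space show ?thesis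
    by eventually_elim (use B1 in \<open>force simp: A_def less_le\<close>)
qed

text \<open>In the limit the test gives \<open>t \<le> C^2 * t^2 * h\<close> almost everywhere for
  \<open>t = 1 - |b|^2\<close>. Division by \<open>t > 0\<close> and
  \<open>t \<le> 2 * (1 - |b|)\<close> produce the lower bound \<open>1 / (2 * C^2)\<close>.\<close>

lemma ess_inf_pos_of_kernel_test:
  assumes ac: "ac_density \<sigma> (restrict_space \<mu> (sphere 0 1)) h"
  shows "0 < ess_inf \<sigma> (\<lambda>z. ennreal (1 - cmod (nt_ext b z)) * h z)"
proof -
  define t where "t z = gap z" for z
  have tm[measurable]: "t \<in> borel_measurable \<sigma>"
    unfolding t_def using B_meas_circle by measurable
  have t01: "0 \<le> t z" "t z \<le> 1" if "z \<in> sphere 0 1" for z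
    using B1[of z] that by (auto simp: t_def power_le_one)
  have "AE z in \<sigma>. ennreal (t z) \<le> (ennreal (C\<^sup>2) * ennreal ((t z)\<^sup>2)) * h z"
  proof (rule AE_le_ac_density[OF ac sets_circle_trace[OF \<mu>]])
    have "(\<integral>\<^sup>+z. ennreal (t z) \<partial>\<sigma>) \<le> (\<integral>\<^sup>+z. 1 \<partial>\<sigma>)"
      using t01 by (intro nn_integral_mono) (auto simp: ennreal_le_1)
    then show "(\<integral>\<^sup>+z. ennreal (t z) \<partial>\<sigma>) < \<infinity>" by (auto intro: le_less_trans)
    fix K assume K: "compact K" "K \<subseteq> sphere (0::complex) 1"
    have Ks: "K \<in> sets \<sigma>"
      using K by (auto simp: sets_circle_iff intro: borel_closed compact_imp_closed)
    have "(\<integral>\<^sup>+z. ennreal (t z) * indicator K z \<partial>\<sigma>) =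
        (\<integral>\<^sup>+x. liminf (\<lambda>n. ennreal (indicator K x * defect n x)) \<partial>\<sigma>)"
    proof (rule nn_integral_cong_AE)
      show "AE x in \<sigma>. ennreal (t x) * indicator K x = liminf (\<lambda>n. ennreal (indicator K x * defect n x))"
        using AE_circle_nt_points
      proof eventually_elim
        case (elim x)
        have "(\<lambda>n. ennreal (indicator K x * defect n x)) \<longlonglongrightarrow> ennreal (indicator K x * t x)"
          unfolding t_def by (intro tendsto_ennrealI tendsto_intros nt_ext_rad elim)
        then have "liminf (\<lambda>n. ennreal (indicator K x * defect n x)) = ennreal (indicator K x * t x)"
          by (rule lim_imp_Liminf[rotated]) simp
        then show ?case by (simp add: indicator_def)
      qed
    qed
    also have "\<dots> \<le> liminf (\<lambda>n. \<integral>\<^sup>+x. ennreal (indicator K x * defect n x) \<partial>\<sigma>)"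
    proof (rule nn_integral_liminf)
      show "(\<lambda>x. ennreal (indicator K x * defect n x)) \<in> borel_measurable \<sigma>" for n
        using borel_measurable_integrable[OF defect_integral(1)[OF K]] by (rule measurable_compose) simp
    qed
    also have "\<dots> \<le> (\<integral>\<^sup>+z. (ennreal (C\<^sup>2) * ennreal ((gap z)\<^sup>2)) * indicator K z \<partial>restrict_space \<mu> (sphere 0 1))"
      by (rule defect_le[OF C test K])
    finally show "(\<integral>\<^sup>+z. ennreal (t z) * indicator K z \<partial>\<sigma>) \<le>
       (\<integral>\<^sup>+z. (ennreal (C\<^sup>2) * ennreal ((t z)\<^sup>2)) * indicator K z \<partial>restrict_space \<mu> (sphere 0 1))"
      by (simp only: t_def)
  qed measurable
  then have "AE z in \<sigma>. ennreal (1 / (2 * C\<^sup>2)) \<le> ennreal (1 - cmod (nt_ext b z)) * h z"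
    using AE_circle_norm_less_1 AE_space
  proof eventually_elim
    case (elim z)
    define B where "B = cmod (nt_ext b z)"
    have B: "0 \<le> B" "B < 1" using elim by (auto simp: B_def)
    have tz: "t z = (1 - B) * (1 + B)" by (simp add: t_def B_def power2_eq_square algebra_simps)
    have tp: "0 < t z" using B unfolding tz by simp
    have "(1 - B) * (1 + B) \<le> (1 - B) * 2" using B by (intro mult_left_mono) auto
    then have le: "t z \<le> 2 * (1 - B)" unfolding tz by simp
    have "1 = ennreal (1 / t z) * ennreal (t z)" using tp by (simp flip: ennreal_mult)
    also have "\<dots> \<le> ennreal (1 / t z) * ((ennreal (C\<^sup>2) * ennreal ((t z)\<^sup>2)) * h z)"
      using elim(1) by (intro mult_left_mono) auto
    also have "\<dots> = (ennreal (1 / t z) * ennreal (C\<^sup>2) * ennreal ((t z)\<^sup>2)) * h z" by (simp only: mult.assoc)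
    also have "ennreal (1 / t z) * ennreal (C\<^sup>2) * ennreal ((t z)\<^sup>2) = ennreal (1 / t z * C\<^sup>2 * (t z)\<^sup>2)"
      using tp by (simp only: ennreal_mult zero_le_divide_1_iff mult_nonneg_nonneg zero_le_power2 less_imp_le)
    also have "1 / t z * C\<^sup>2 * (t z)\<^sup>2 = C\<^sup>2 * t z" using tp by (simp add: power2_eq_square)
    also have "ennreal (C\<^sup>2 * t z) * h z \<le> ennreal (2 * C\<^sup>2 * (1 - B)) * h z"
      using mult_left_mono[OF le, of "C\<^sup>2"] by (intro mult_right_mono ennreal_leI) (simp_all add: algebra_simps)
    finally have "ennreal (1 / (2 * C\<^sup>2)) * 1 \<le> ennreal (1 / (2 * C\<^sup>2)) * (ennreal (2 * C\<^sup>2 * (1 - B)) * h z)"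
      by (rule mult_left_mono) simp
    also have "\<dots> = (ennreal (1 / (2 * C\<^sup>2)) * ennreal (2 * C\<^sup>2 * (1 - B))) * h z" by (simp only: mult.assoc)
    also have "ennreal (1 / (2 * C\<^sup>2)) * ennreal (2 * C\<^sup>2 * (1 - B)) = ennreal (1 / (2 * C\<^sup>2) * (2 * C\<^sup>2 * (1 - B)))"
      using B by (intro ennreal_mult[symmetric]) auto
    also have "1 / (2 * C\<^sup>2) * (2 * C\<^sup>2 * (1 - B)) = 1 - B" using C by simp
    finally show ?case by (simp add: B_def)
  qed
  moreover have "0 < ennreal (1 / (2 * C\<^sup>2))" using C by simp
  ultimately show ?thesis unfolding ess_inf_pos_iff by blast
qed

end

section \<open>From the essential infimum back to the norm inequality\<close>

lemma has_nt_limit_sum: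
  assumes "\<And>w. w \<in> S \<Longrightarrow> has_nt_limit (f w) \<zeta> (L w)"
  shows "has_nt_limit (\<lambda>z. \<Sum>w\<in>S. c w * f w z) \<zeta> (\<Sum>w\<in>S. c w * L w)"
  using assms unfolding has_nt_limit_def by (auto intro!: tendsto_intros)

text \<open>Here \<open>m\<close> is absolutely continuous with respect to \<open>\<mu>\<close>, so admissibility already provides
  non-tangential limits \<open>m\<close>-almost everywhere, and Fatou's theorem is not needed.\<close>

lemma AE_circle_nt_points_of_ess_inf:
  assumes ac: "ac_density \<sigma> (restrict_space \<mu> (sphere 0 1)) h"
    and c: "0 < c" "AE z in \<sigma>. c \<le> ennreal (1 - cmod (nt_ext b z)) * h z"
    and f: "admissible \<mu> f"
  shows "AE z in \<sigma>. z \<in> nt_points f"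
proof -
  have Z: "sphere 0 1 - nt_points f \<in> sets \<sigma>"
    by (auto simp: sets_circle_iff intro!: sets.Diff)
  have h[measurable]: "h \<in> borel_measurable \<sigma>" using ac by (simp add: ac_density_def)
  note [measurable] = Z
  have "(\<integral>\<^sup>+z. indicator (sphere 0 1 - nt_points f) z * h z \<partial>\<sigma>) \<le>
      (\<integral>\<^sup>+z. indicator (sphere 0 1 - nt_points f) z \<partial>restrict_space \<mu> (sphere 0 1))"
    by (rule ac_density_nn_integral_le[OF ac sets_circle_trace[OF \<mu>]]) measurable
  also have "\<dots> = (\<integral>\<^sup>+z. 0 \<partial>\<mu>)"
    unfolding nn_integral_circle_trace[OF \<mu>]
  proof (rule nn_integral_cong_AE)
    have "AE z in \<mu>. z \<in> sphere 0 1 \<longrightarrow> z \<in> nt_points f"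
      using f by (auto simp: admissible_def nt_points_def)
    then show "AE z in \<mu>. (indicator (sphere 0 1 - nt_points f) z :: ennreal) * indicator (sphere 0 1) z = 0"
      by eventually_elim (auto simp: indicator_def)
  qed
  finally have "(\<integral>\<^sup>+z. indicator (sphere 0 1 - nt_points f) z * h z \<partial>\<sigma>) = 0" by simp
  then have "AE z in \<sigma>. indicator (sphere 0 1 - nt_points f) z * h z = 0"
    by (subst (asm) nn_integral_0_iff_AE) auto
  then show ?thesis
    using c(2) AE_space
  proof eventually_elim
    case (elim z)
    \<comment> \<open>Almost every point without a limit has \<open>h z = 0\<close>, because \<mu>
      does not charge the set of such points; the lower bound \<open>c > 0\<close> excludes
      this.\<close>
    have "h z \<noteq> 0" using elim(2) c(1) by auto
    then have "indicator (sphere 0 1 - nt_points f) z = (0::ennreal)" using elim(1) by simp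
    then show ?case using elim(3) by (auto simp: indicator_def split: if_splits)
  qed
qed

end

locale dBR_boundary = boundary_setup \<mu> b + dBR b H ip
  for \<mu> :: "complex measure" and b H ip
begin

lemma kb_mem: "w \<in> ball 0 1 \<Longrightarrow> kb b w \<in> H"
  using kz_mem unfolding kz_eq .

lemma admissible_kspan:
  assumes "g \<in> kspan"
  shows "admissible \<mu> g"
proof -
  obtain S c where S: "g = kcomb S c" "finite S" "S \<subseteq> ball 0 1" using assms by (auto simp: kspan_def)
  have "AE z in \<mu>. z \<in> sphere 0 1 \<longrightarrow> (\<exists>L. has_nt_limit g z L)"
    using AE_nt_points
  proof eventually_elim
    case (elim z)
    show ?case
    proof
      assume "z \<in> sphere 0 1"
      then have z: "z \<in> nt_points b" using elim by blast
      have "has_nt_limit (\<lambda>z. \<Sum>w\<in>S. c w * kb b w z) z (\<Sum>w\<in>S. c w * ((1 - cnj (b w) * nt_ext b z) / (1 - cnj w * z)))"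
        by (intro has_nt_limit_sum nt_points_kb z) (use S in auto)
      then show "\<exists>L. has_nt_limit g z L" unfolding S(1) kcomb_def kz_eq by blast
    qed
  qed
  then show ?thesis using hol kspan_H[OF assms] by (auto simp: admissible_def)
qed

lemma admissible_kb: "w \<in> ball 0 1 \<Longrightarrow> admissible \<mu> (kb b w)"
  using admissible_kspan[OF kspan_kz] unfolding kz_eq .

text \<open>The reproducing property evaluates the abstract norm, its square being
  \<open>kb b w w\<close>, and \<open>nt_ext_kb\<close> makes the right-hand side explicit. In this
  form the test involves only \<open>b\<close> and \<mu>.\<close>

lemma kernel_test_iff:
  assumes "0 < C" "w \<in> ball 0 1"
  shows "ennreal (ip_norm ip (kb b w)) \<le> ennreal C * L2_norm_ext \<mu> (kb b w) \<longleftrightarrow>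
    ennreal ((1 - (cmod (b w))\<^sup>2) / (1 - (cmod w)\<^sup>2)) \<le>
      ennreal (C\<^sup>2) * (\<integral>\<^sup>+z. ennreal ((cmod ((1 - cnj (b w) * nt_ext b z) * szego w z))\<^sup>2) \<partial>\<mu>)"
proof -
  have k: "kb b w \<in> H" by (rule kb_mem[OF assms(2)])
  have "ip (kb b w) (kb b w) = kb b w w" using ip_kz[OF assms(2) k] unfolding kz_eq .
  also have "\<dots> = of_real ((1 - (cmod (b w))\<^sup>2) / (1 - (cmod w)\<^sup>2))"
    using assms(2) unfolding kb_def of_real_divide of_real_diff complex_norm_square by (simp add: mult.commute)
  finally have n: "(ip_norm ip (kb b w))\<^sup>2 = (1 - (cmod (b w))\<^sup>2) / (1 - (cmod w)\<^sup>2)"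
    unfolding nrm_eq[symmetric] nrm_power2[OF k] by (simp only: Re_complex_of_real)
  have i: "(\<integral>\<^sup>+z. ennreal ((cmod (nt_ext (kb b w) z))\<^sup>2) \<partial>\<mu>) =
      (\<integral>\<^sup>+z. ennreal ((cmod ((1 - cnj (b w) * nt_ext b z) * szego w z))\<^sup>2) \<partial>\<mu>)"
    using nt_ext_kb[OF assms(2)] by (intro nn_integral_cong_AE) (auto elim!: eventually_mono)
  have "0 \<le> ip_norm ip (kb b w)" using nrm_nonneg[OF k] by (simp add: nrm_eq)
  then show ?thesis
    by (subst le_L2_norm_ext_iff[OF assms(1)]) (simp_all only: n i)
qed

lemma reverse_Carleson_imp_kernel_test:
  assumes "reverse_Carleson \<mu> H ip"
  shows "\<exists>C>0. \<forall>w\<in>ball 0 1. ennreal (ip_norm ip (kb b w)) \<le> ennreal C * L2_norm_ext \<mu> (kb b w)"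
  using assms kb_mem admissible_kb unfolding reverse_Carleson_def by blast

text \<open>The weight handed to \<open>nrm_le_weighted_norm\<close> is \<open>h / \<delta>\<close>,
  which leads to the constant \<open>sqrt (1 / \<delta>)\<close>. An infinite \<open>L^2\<close>
  norm is set apart, since that estimate works with a real bound.\<close>

lemma ess_inf_imp_reverse_Carleson:
  assumes ac: "ac_density \<sigma> (restrict_space \<mu> (sphere 0 1)) h"
    and pos: "0 < ess_inf \<sigma> (\<lambda>z. ennreal (1 - cmod (nt_ext b z)) * h z)"
  shows "reverse_Carleson \<mu> H ip"
proof -
  obtain c where c: "0 < c" "AE z in \<sigma>. c \<le> ennreal (1 - cmod (nt_ext b z)) * h z"
    using pos unfolding ess_inf_pos_iff by blast
  \<comment> \<open>\<open>c\<close> is an extended number and may be infinite; a positive real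
    below it is enough.\<close>
  obtain \<delta> where \<delta>: "0 < \<delta>" "ennreal \<delta> \<le> c"
  proof (cases c)
    case (real r)
    then show ?thesis using that[of r] c(1) by simp
  next
    case top
    then show ?thesis using that[of 1] by simp
  qed
  have h[measurable]: "h \<in> borel_measurable \<sigma>" using ac by (simp add: ac_density_def)
  define W where "W z = ennreal (1 / \<delta>) * h z" for z
  have W: "W \<in> borel_measurable \<sigma>" unfolding W_def by measurable
  have W1: "AE z in \<sigma>. 1 \<le> W z * ennreal (gap z)"
    using c(2) AE_space
  proof eventually_elim
    case (elim z)
    have Bz: "0 \<le> cmod (nt_ext b z)" "cmod (nt_ext b z) \<le> 1" using elim(2) B1[of z] by auto
    have "1 = ennreal (1 / \<delta>) * ennreal \<delta>" using \<delta> by (simp flip: ennreal_mult)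
    also have "\<dots> \<le> ennreal (1 / \<delta>) * (ennreal (1 - cmod (nt_ext b z)) * h z)"
      using order_trans[OF \<delta>(2) elim(1)] by (rule mult_left_mono) simp
    also have "\<dots> \<le> ennreal (1 / \<delta>) * (ennreal (gap z) * h z)"
    proof (intro mult_left_mono mult_right_mono ennreal_leI)
      \<comment> \<open>This puts the weight \<open>1 - |b|\<close> of (4) below the weight
        \<open>1 - |b|^2\<close> of the norm estimate.\<close>
      have "(cmod (nt_ext b z))\<^sup>2 \<le> cmod (nt_ext b z)"
        unfolding power2_eq_square using Bz by (simp add: mult_left_le)
      then show "1 - cmod (nt_ext b z) \<le> gap z" by simp
    qed auto
    finally show ?case by (simp only: W_def mult_ac)
  qed
  have ineq: "ennreal (ip_norm ip f) \<le> ennreal (sqrt (1 / \<delta>)) * L2_norm_ext \<mu> f" if f: "f \<in> H" "admissible \<mu> f" for f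
  proof -
    define q where "q = (\<integral>\<^sup>+z. ennreal ((cmod (nt_ext f z))\<^sup>2) \<partial>\<mu>)"
    have n0: "0 \<le> nrm f" by (rule nrm_nonneg[OF f(1)])
    have fm: "nt_ext f \<in> borel_measurable \<sigma>"
      by (rule nt_ext_circle_measurable[OF hol[OF f(1)]])
    have "ennreal ((nrm f)\<^sup>2) \<le> ennreal ((sqrt (1 / \<delta>))\<^sup>2) * q"
    proof (cases "q = \<infinity>")
      case True
      then show ?thesis using \<delta> by (simp add: ennreal_mult_top)
    next
      case False
      then obtain x where x: "q = ennreal x" "0 \<le> x" by (cases q) auto
      have "(\<integral>\<^sup>+z. ennreal ((cmod (nt_ext f z))\<^sup>2) * W z \<partial>\<sigma>) =
          (\<integral>\<^sup>+z. ennreal (1 / \<delta>) * (ennreal ((cmod (nt_ext f z))\<^sup>2) * h z) \<partial>\<sigma>)"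
        by (simp only: W_def mult_ac)
      also have "\<dots> = ennreal (1 / \<delta>) * (\<integral>\<^sup>+z. ennreal ((cmod (nt_ext f z))\<^sup>2) * h z \<partial>\<sigma>)"
        by (rule nn_integral_cmult) (use fm in measurable)
      also have "\<dots> \<le> ennreal (1 / \<delta>) * (\<integral>\<^sup>+z. ennreal ((cmod (nt_ext f z))\<^sup>2) \<partial>restrict_space \<mu> (sphere 0 1))"
        by (intro mult_left_mono ac_density_nn_integral_le[OF ac sets_circle_trace[OF \<mu>]]) (use fm in measurable)
      also have "\<dots> \<le> ennreal (1 / \<delta>) * q"
        unfolding nn_integral_circle_trace[OF \<mu>] q_def
        by (intro mult_left_mono nn_integral_mono) (auto simp: indicator_def)
      also have "\<dots> = ennreal (x / \<delta>)" using \<delta> x by (simp flip: ennreal_mult)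
      finally have le: "(\<integral>\<^sup>+z. ennreal ((cmod (nt_ext f z))\<^sup>2) * W z \<partial>\<sigma>) \<le> ennreal (x / \<delta>)" .
      have "nrm f \<le> sqrt (x / \<delta>)"
        by (rule nrm_le_weighted_norm[OF f(1) AE_circle_nt_points_of_ess_inf[OF ac c f(2)]
              AE_circle_nt_points_of_ess_inf[OF ac c adm] W W1 le]) (use x \<delta> in simp)
      then have "(nrm f)\<^sup>2 \<le> (sqrt (x / \<delta>))\<^sup>2" using n0 by (rule power_mono)
      also have "\<dots> = (sqrt (1 / \<delta>))\<^sup>2 * x" using x \<delta> by simp
      finally have "ennreal ((nrm f)\<^sup>2) \<le> ennreal ((sqrt (1 / \<delta>))\<^sup>2 * x)" by (rule ennreal_leI)
      also have "\<dots> = ennreal ((sqrt (1 / \<delta>))\<^sup>2) * q" unfolding x(1) using x(2) by (intro ennreal_mult) auto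
      finally show ?thesis .
    qed
    then show ?thesis
      using \<delta> n0 unfolding nrm_eq[symmetric] q_def by (subst le_L2_norm_ext_iff) auto
  qed
  show ?thesis
    unfolding reverse_Carleson_def
  proof (intro conjI ballI allI impI)
    fix f and e :: real assume f: "f \<in> H" and e: "0 < e"
    obtain g where g: "\<And>n. g n \<in> kspan" "(\<lambda>n. nrm (\<lambda>z. f z - g n z)) \<longlonglongrightarrow> 0"
      using kspan_dense_seq[OF f] by blast
    have "\<exists>n. nrm (\<lambda>z. f z - g n z) < e" using order_tendstoD(2)[OF g(2) e] by (auto simp: eventually_sequentially)
    then obtain n where "nrm (\<lambda>z. f z - g n z) < e" ..
    then show "\<exists>g\<in>H. admissible \<mu> g \<and> ip_norm ip (\<lambda>z. f z - g z) < e"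
      using g(1) kspan_H admissible_kspan unfolding nrm_eq by blast
  next
    show "\<exists>C>0. \<forall>f\<in>H. admissible \<mu> f \<longrightarrow> ennreal (ip_norm ip f) \<le> ennreal C * L2_norm_ext \<mu> f"
      using ineq \<delta> by (intro exI[of _ "sqrt (1 / \<delta>)"]) auto
  qed
qed

end

no_notation circle_measure (\<open>\<sigma>\<close>)

theorem theorem1p4:
  fixes \<mu> :: "complex measure"
    and b :: "complex \<Rightarrow> complex"
    and H :: "(complex \<Rightarrow> complex) set"
    and ip :: "(complex \<Rightarrow> complex) \<Rightarrow> (complex \<Rightarrow> complex) \<Rightarrow> complex"
    and h :: "complex \<Rightarrow> ennreal"
  assumes "\<mu> \<in> disk_measures"
    and "Hinf_nonextreme b"
    and "admissible \<mu> b"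
    and "de_Branges_Rovnyak b H ip"
    and "ac_density circle_measure (restrict_space \<mu> (sphere 0 1)) h"
  defines "\<nu> \<equiv> density \<mu> (\<lambda>z. ennreal (1 - cmod (nt_ext b z)))"
  shows "(reverse_Carleson \<mu> H ip \<longleftrightarrow>
           (\<exists>C>0. \<forall>w\<in>ball 0 1.
              ennreal (ip_norm ip (kb b w)) \<le> ennreal C * L2_norm_ext \<mu> (kb b w)))
       \<and> ((\<exists>C>0. \<forall>w\<in>ball 0 1.
              ennreal (ip_norm ip (kb b w)) \<le> ennreal C * L2_norm_ext \<mu> (kb b w)) \<longleftrightarrow>
           (INF I\<in>{I. open_arc I}. emeasure \<nu> (carleson_window I) / emeasure circle_measure I) > 0)
       \<and> ((INF I\<in>{I. open_arc I}. emeasure \<nu> (carleson_window I) / emeasure circle_measure I) > 0 \<longleftrightarrow>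
           ess_inf circle_measure (\<lambda>z. ennreal (1 - cmod (nt_ext b z)) * h z) > 0)"
proof -
  have b: "b \<in> Hinf_ball" using assms(2) by (simp add: Hinf_nonextreme_def)
  interpret boundary_setup \<mu> b
    by standard (use assms(1,3) b in auto)
  interpret rkhs "ball 0 1" "kb b" H ip
    using assms(4) by (simp add: de_Branges_Rovnyak_def)
  interpret dBR_boundary \<mu> b H ip
    by standard (use assms(4) b in \<open>auto simp: de_Branges_Rovnyak_def\<close>)
  let ?P1 = "reverse_Carleson \<mu> H ip"
  let ?P2 = "\<exists>C>0. \<forall>w\<in>ball 0 1. ennreal (ip_norm ip (kb b w)) \<le> ennreal C * L2_norm_ext \<mu> (kb b w)"
  let ?P3 = "(INF I\<in>{I. open_arc I}. emeasure \<nu> (carleson_window I) / emeasure circle_measure I) > 0"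
  let ?P4 = "ess_inf circle_measure (\<lambda>z. ennreal (1 - cmod (nt_ext b z)) * h z) > 0"
  have 34: "?P3 \<longleftrightarrow> ?P4"
    unfolding \<nu>_def
  proof (rule windows_iff_ess_inf[OF assms(1,5)])
    show "(\<lambda>z. ennreal (1 - cmod (nt_ext b z))) \<in> borel_measurable (restrict_space borel (cball 0 1))"
      using nt_ext_measurable[OF bh] by measurable
    show "ennreal (1 - cmod (nt_ext b z)) \<le> 1" for z by (simp add: ennreal_le_1)
  qed
  have 12: "?P1 \<Longrightarrow> ?P2" by (rule reverse_Carleson_imp_kernel_test)
  have 24: "?P4" if P2: "?P2"
  proof -
    obtain C where C: "0 < C" "\<And>w. w \<in> ball 0 1 \<Longrightarrow> ennreal (ip_norm ip (kb b w)) \<le> ennreal C * L2_norm_ext \<mu> (kb b w)"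
      using P2 by blast
    show ?thesis
      by (rule ess_inf_pos_of_kernel_test[OF assms(2) C(1) _ assms(5)])
         (use C(2) kernel_test_iff[OF C(1)] in blast)
  qed
  have 41: "?P4 \<Longrightarrow> ?P1" by (rule ess_inf_imp_reverse_Carleson[OF assms(5)])
  show ?thesis using 12 24 41 34 by blast
qed

end
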